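(* Let $\varrho:V\to\mathbb{R}_{\ge 0}$ be smooth with $\langle\varrho,1\rangle_{L^2(V)}>0$. As $N\to\infty$, $\mathbb{P}^{\varrho}_N(m(\pi^N_{\cdot})\in\cdot)\to\delta_{m(\varrho_\cdot)}$ (weak convergence of probability measures on $D([0,T];[-1,1])$), where $\varrho_t$ solves $$\dot{\varrho}_t(x,\sigma)=-\sigma\,\partial_x\varrho_t(x,\sigma)+c(-\sigma,m(\varrho_t))\,\varrho_t(x,-\sigma)-c(\sigma,m(\varrho_t))\,\varrho_t(x,\sigma),\qquad \varrho_0=\varrho.$$ Furthermore, $m_t:=m(\varrho_t)$ solves $$\dot m_t=c(-1,m_t)(1-m_t)-c(1,m_t)(1+m_t),\qquad m_0=m(\varrho).$$
   Context: Spaces. $\mathbb{T}_N=\mathbb{Z}/N\mathbb{Z}$, $S=\{-1,1\}$, $V_N=\mathbb{T}_N\times S$, $\Omega_N=\mathbb{N}^{V_N}$ (with $0\in\mathbb{N}$ here). $\mathbb{T}=[0,1]$ is the torus (endpoints identified), $V=\mathbb{T}\times S$. $\mathcal{M}_V$ is the space of positive Radon measures on $V$ with the weak topology; $D([0,T];E)$ is the Skorokhod space of $E$-valued paths, $T>0$ fixed. $\langle\beta,\phi\rangle$ is the integral of $\phi$ against $\beta\in\mathcal{M}_V$. $C^\infty([0,T]\times V)$ denotes functions smooth in $(t,x)$ for each $\sigma$. $\langle\psi,\phi\rangle_{L^2(V)}=\sum_{\sigma\in S}\int_{\mathbb{T}}\psi(x,\sigma)\phi(x,\sigma)\,dx$.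 Rates. $c:S\times[-1,1]\to(0,\infty)$ is bounded from above and bounded away from zero, and there is $L>0$ with $|c(\sigma,m_1)-c(\sigma,m_2)|\le L|m_1-m_2|$ for all $\sigma\in S$, $m_1,m_2\in[-1,1]$. Magnetization. For $\eta\in\Omega_N$, $|\eta|=\sum_{(x,\sigma)\in V_N}\eta(x,\sigma)$ and $m_N(\eta)=\frac{1}{|\eta|}\sum_{x\in\mathbb{T}_N}(\eta(x,1)-\eta(x,-1))$, with $m_N(\eta)=0$ if $|\eta|=0$. For $\beta\in\mathcal{M}_V$, $m(\beta)=\langle\beta,\mathbf{1}_{\sigma=1}-\mathbf{1}_{\sigma=-1}\rangle/\langle\beta,1\rangle$ (with $m(0)=0$), so $m(\pi^N(\eta))=m_N(\eta)$. For a density $\varrho\ge0$ on $V$, $m(\varrho)=\langle\varrho,\mathbf{1}_{\sigma=1}-\mathbf{1}_{\sigma=-1}\rangle_{L^2(V)}/\langle\varrho,1\rangle_{L^2(V)}$. Process. $\{\eta^N_t\}$ is the Markov process on $\Omega_N$ with generator $$\mathscr{L}_Nf(\eta)=N\sum_{(x,\sigma)\in V_N}\eta(x,\sigma)[f(\eta^{(x,\sigma)\to(x+\sigma,\sigma)})-f(\eta)]+\sum_{(x,\sigma)\in V_N}c(\sigma,m_N(\eta))\eta(x,\sigma)[f(\eta^{(x,\sigma)\to(x,-\sigma)})-f(\eta)],$$ where $\eta^{(x,\sigma)\to(y,\sigma')}$ is $\eta$ with one particle moved from $(x,\sigma)$ to $(y,\sigma')$. $\mathbb{P}^{\varrho}_N$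 is the path-space measure (up to time $T$) of this process when $\eta^N_0$ has the law $\mu_N^{\varrho}=\bigotimes_{(x,\sigma)\in V_N}\mathrm{Pois}(\varrho(x/N,\sigma))$. The empirical measure is $\pi^N(\eta)=\frac1N\sum_{(x,\sigma)\in V_N}\eta(x,\sigma)\delta_{(x/N,\sigma)}$, and $\pi^N_t=\pi^N(\eta^N_t)$. Solution concept. The PDE is understood in the weak sense: with $\alpha_t$ the measure with density $\varrho_t$, for all $G\in C^\infty([0,T]\times V)$ and $t\in[0,T]$, $$\langle\alpha_t,G_t\rangle-\langle\alpha_0,G_0\rangle-\int_0^t\Big\langle\alpha_s,\ \partial_sG_s+\sigma\partial_xG_s+c(\sigma,m(\varrho_s))\big(G_s(x,-\sigma)-G_s(x,\sigma)\big)\Big\rangle ds=0.$$ *)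

theory Defs
  imports "HOL-Probability.Probability"
begin

section \<open>Configurations, magnetization and empirical measure\<close>

type_synonym config = "int \<times> int \<Rightarrow> nat"

definition spins :: "int set" where
  "spins = {-1, 1}"

text \<open>The discrete torus is represented by the residues \<open>0, \<dots>, N - 1\<close>, with addition modulo \<open>N\<close>.\<close>

definition sites :: "nat \<Rightarrow> (int \<times> int) set" where
  "sites N = {0..<int N} \<times> spins"

text \<open>A configuration on \<open>sites N\<close> is extended by \<open>0\<close> to all of \<open>int \<times> int\<close>.\<close>

definition configs :: "nat \<Rightarrow> config set" where
  "configs N = {\<eta>. \<forall>v. v \<notin> sites N \<longrightarrow> \<eta> v = 0}"

definition num_particles :: "nat \<Rightarrow> config \<Rightarrow> nat" where
  "num_particles N \<eta> = (\<Sum>v\<in>sites N. \<eta> v)"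

text \<open>Division by zero gives zero, which is the convention for the empty configuration
  (and for the zero measure below).\<close>

definition magnetization :: "nat \<Rightarrow> config \<Rightarrow> real" where
  "magnetization N \<eta> =
     (\<Sum>x\<in>{0..<int N}. real (\<eta> (x, 1)) - real (\<eta> (x, -1))) / real (num_particles N \<eta>)"

text \<open>The measurable space underlying the continuum space \<open>V\<close>, the torus being
  represented by real numbers modulo \<open>1\<close> with fundamental domain \<open>[0,1)\<close>.\<close>

definition V_algebra :: "(real \<times> int) measure" where
  "V_algebra = borel \<Otimes>\<^sub>M count_space spins"

definition empirical_measure :: "nat \<Rightarrow> config \<Rightarrow> (real \<times> int) measure" where
  "empirical_measure N \<eta> =
     distr (point_measure (sites N) (\<lambda>v. ennreal (real (\<eta> v) / real N))) V_algebra
       (\<lambda>(x, \<sigma>). (real_of_int x / real N, \<sigma>))"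

definition measure_magnetization :: "(real \<times> int) measure \<Rightarrow> real" where
  "measure_magnetization \<beta> =
     (\<integral>(x, \<sigma>). (if \<sigma> = 1 then 1 else 0) - (if \<sigma> = -1 then 1 else 0) \<partial>\<beta>) / (\<integral>v. 1 \<partial>\<beta>)"

section \<open>The particle process\<close>

definition jump_rates :: "(int \<Rightarrow> real \<Rightarrow> real) \<Rightarrow> bool" where
  "jump_rates c \<longleftrightarrow>
     (\<exists>a>0. \<exists>b. \<forall>\<sigma>\<in>spins. \<forall>m\<in>{-1..1}. a \<le> c \<sigma> m \<and> c \<sigma> m \<le> b) \<and>
     (\<exists>L>0. \<forall>\<sigma>\<in>spins. \<forall>m1\<in>{-1..1}. \<forall>m2\<in>{-1..1}. \<bar>c \<sigma> m1 - c \<sigma> m2\<bar> \<le> L * \<bar>m1 - m2\<bar>)"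

text \<open>One particle moves from \<open>v\<close> to \<open>w\<close>; only used with a factor \<open>\<eta> v\<close> in front,
  so the truncated subtraction is harmless.\<close>

definition move :: "int \<times> int \<Rightarrow> int \<times> int \<Rightarrow> config \<Rightarrow> config" where
  "move v w \<eta> = (let \<eta>' = \<eta>(v := \<eta> v - 1) in \<eta>'(w := \<eta>' w + 1))"

definition generator ::
    "(int \<Rightarrow> real \<Rightarrow> real) \<Rightarrow> nat \<Rightarrow> (config \<Rightarrow> real) \<Rightarrow> config \<Rightarrow> real" where
  "generator c N f \<eta> =
     real N * (\<Sum>(x, \<sigma>)\<in>sites N. real (\<eta> (x, \<sigma>)) *
        (f (move (x, \<sigma>) ((x + \<sigma>) mod int N, \<sigma>) \<eta>) - f \<eta>)) +
     (\<Sum>(x, \<sigma>)\<in>sites N. c \<sigma> (magnetization N \<eta>) * real (\<eta> (x, \<sigma>)) *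
        (f (move (x, \<sigma>) (x, -\<sigma>) \<eta>) - f \<eta>))"

text \<open>Transition semigroups on \<open>configs N\<close>. Particle number is conserved by the dynamics, so
  from each starting point only finitely many configurations are reachable; hence the difference
  quotients converge pointwise for every bounded \<open>f\<close>, and this determines the semigroup.\<close>

definition transition_semigroup :: "nat \<Rightarrow> (real \<Rightarrow> config \<Rightarrow> config pmf) \<Rightarrow> bool" where
  "transition_semigroup N K \<longleftrightarrow>
     (\<forall>\<eta>\<in>configs N. K 0 \<eta> = return_pmf \<eta>) \<and>
     (\<forall>t\<ge>0. \<forall>\<eta>\<in>configs N. set_pmf (K t \<eta>) \<subseteq> configs N) \<and>
     (\<forall>s\<ge>0. \<forall>t\<ge>0. \<forall>\<eta>\<in>configs N. K (s + t) \<eta> = bind_pmf (K s \<eta>) (K t))"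

definition has_generator ::
    "nat \<Rightarrow> (real \<Rightarrow> config \<Rightarrow> config pmf) \<Rightarrow> ((config \<Rightarrow> real) \<Rightarrow> config \<Rightarrow> real) \<Rightarrow> bool" where
  "has_generator N K A \<longleftrightarrow>
     (\<forall>f. bounded (range f) \<longrightarrow> (\<forall>\<eta>\<in>configs N.
        ((\<lambda>t. (measure_pmf.expectation (K t \<eta>) f - f \<eta>) / t) \<longlongrightarrow> A f \<eta>) (at_right 0)))"

text \<open>The set \<open>D([0,T];E)\<close>; paths are \<open>undefined\<close> outside \<open>[0,T]\<close>.\<close>

definition cadlag_paths :: "real \<Rightarrow> 'a::topological_space set \<Rightarrow> (real \<Rightarrow> 'a) set" where
  "cadlag_paths T E = {\<omega> \<in> {0..T} \<rightarrow>\<^sub>E E.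
     (\<forall>t\<in>{0..<T}. (\<omega> \<longlongrightarrow> \<omega> t) (at_right t)) \<and>
     (\<forall>t\<in>{0<..T}. \<exists>l\<in>E. (\<omega> \<longlongrightarrow> l) (at_left t))}"

text \<open>The topology on \<open>config\<close> is the product topology, which is discrete on \<open>configs N\<close>. The
  \<open>\<sigma>\<close>-algebra on path space is the one generated by the evaluations.\<close>

definition path_algebra :: "real \<Rightarrow> nat \<Rightarrow> (real \<Rightarrow> config) measure" where
  "path_algebra T N =
     restrict_space (PiM {0..T} (\<lambda>_. count_space (configs N))) (cadlag_paths T (configs N))"

definition past :: "real \<Rightarrow> nat \<Rightarrow> real \<Rightarrow> (real \<Rightarrow> config) measure" where
  "past T N s = sigma (cadlag_paths T (configs N))
     {{\<omega> \<in> cadlag_paths T (configs N). \<omega> u = \<eta>} | u \<eta>. u \<in> {0..s}}"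

text \<open>\<open>P\<close> is the path-space measure, up to time \<open>T\<close>, of the Markov process with the generator
  above and initial law \<open>\<mu>\<close>.\<close>

definition path_law ::
    "real \<Rightarrow> (int \<Rightarrow> real \<Rightarrow> real) \<Rightarrow> nat \<Rightarrow> config pmf \<Rightarrow> (real \<Rightarrow> config) measure \<Rightarrow> bool" where
  "path_law T c N \<mu> P \<longleftrightarrow>
     prob_space P \<and> space P = cadlag_paths T (configs N) \<and> sets P = sets (path_algebra T N) \<and>
     distr P (count_space UNIV) (\<lambda>\<omega>. \<omega> 0) = measure_pmf \<mu> \<and>
     (\<exists>K. transition_semigroup N K \<and> has_generator N K (generator c N) \<and>
        (\<forall>s t f. 0 \<le> s \<longrightarrow> s \<le> t \<longrightarrow> t \<le> T \<longrightarrow> bounded (range f) \<longrightarrow>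
           (AE \<omega> in P. real_cond_exp P (past T N s) (\<lambda>\<omega>. f (\<omega> t)) \<omega> =
              measure_pmf.expectation (K (t - s) (\<omega> s)) f)))"

text \<open>The library constant \<open>poisson_pmf\<close> is only specified for positive rates.\<close>

definition Pois :: "real \<Rightarrow> nat pmf" where
  "Pois r = (if r = 0 then return_pmf 0 else poisson_pmf r)"

definition initial_law :: "nat \<Rightarrow> (real \<Rightarrow> int \<Rightarrow> real) \<Rightarrow> config pmf" where
  "initial_law N \<rho> = Pi_pmf (sites N) 0 (\<lambda>(x, \<sigma>). Pois (\<rho> (real_of_int x / real N) \<sigma>))"

section \<open>The Skorokhod topology and weak convergence\<close>

text \<open>Billingsley's form of the \<open>J\<^sub>1\<close> metric. The value outside of the path space is
  irrelevant; it is set to \<open>0\<close> as for the library's metrics on function spaces.\<close>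

definition time_changes :: "real \<Rightarrow> (real \<Rightarrow> real) set" where
  "time_changes T = {\<theta>. strict_mono_on {0..T} \<theta> \<and> \<theta> ` {0..T} = {0..T}}"

definition skorokhod_dist ::
    "real \<Rightarrow> 'a::metric_space set \<Rightarrow> (real \<Rightarrow> 'a) \<Rightarrow> (real \<Rightarrow> 'a) \<Rightarrow> real" where
  "skorokhod_dist T E f g =
     (if f \<in> cadlag_paths T E \<and> g \<in> cadlag_paths T E
      then Inf {e. 0 < e \<and> (\<exists>\<theta>\<in>time_changes T. \<forall>t\<in>{0..T}.
                 \<bar>\<theta> t - t\<bar> \<le> e \<and> dist (f t) (g (\<theta> t)) \<le> e)}
      else 0)"

definition skorokhod_topology :: "real \<Rightarrow> 'a::metric_space set \<Rightarrow> (real \<Rightarrow> 'a) topology" where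
  "skorokhod_topology T E = Metric_space.mtopology (cadlag_paths T E) (skorokhod_dist T E)"

definition borel_algebra :: "'a topology \<Rightarrow> 'a measure" where
  "borel_algebra X = sigma (topspace X) {U. openin X U}"

definition borel_prob :: "'a topology \<Rightarrow> 'a measure \<Rightarrow> bool" where
  "borel_prob X \<mu> \<longleftrightarrow> prob_space \<mu> \<and> space \<mu> = topspace X \<and> sets \<mu> = sets (borel_algebra X)"

definition converges_weakly :: "'a topology \<Rightarrow> (nat \<Rightarrow> 'a measure) \<Rightarrow> 'a measure \<Rightarrow> bool" where
  "converges_weakly X \<mu> \<nu> \<longleftrightarrow>
     (\<forall>\<^sub>F n in sequentially. borel_prob X (\<mu> n)) \<and> borel_prob X \<nu> \<and>
     (\<forall>F. continuous_map X euclideanreal F \<and> bounded (F ` topspace X) \<longrightarrow>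
        (\<lambda>n. \<integral>\<omega>. F \<omega> \<partial>\<mu> n) \<longlonglongrightarrow> (\<integral>\<omega>. F \<omega> \<partial>\<nu>))"

text \<open>The law of the path of magnetizations of the empirical measures under \<open>P\<close>.\<close>

definition magnetization_law ::
    "real \<Rightarrow> nat \<Rightarrow> (real \<Rightarrow> config) measure \<Rightarrow> (real \<Rightarrow> real) measure" where
  "magnetization_law T N P =
     distr P (borel_algebra (skorokhod_topology T {-1..1}))
       (\<lambda>\<omega>. \<lambda>t\<in>{0..T}. measure_magnetization (empirical_measure N (\<omega> t)))"

section \<open>The limiting equation\<close>

definition L2_inner :: "(real \<Rightarrow> int \<Rightarrow> real) \<Rightarrow> (real \<Rightarrow> int \<Rightarrow> real) \<Rightarrow> real" where
  "L2_inner \<psi> \<phi> = (\<Sum>\<sigma>\<in>spins. LBINT x:{0..1}. \<psi> x \<sigma> * \<phi> x \<sigma>)"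

definition density_magnetization :: "(real \<Rightarrow> int \<Rightarrow> real) \<Rightarrow> real" where
  "density_magnetization \<rho> =
     L2_inner \<rho> (\<lambda>x \<sigma>. (if \<sigma> = 1 then 1 else 0) - (if \<sigma> = -1 then 1 else 0)) /
     L2_inner \<rho> (\<lambda>x \<sigma>. 1)"

text \<open>Functions on the torus are \<open>1\<close>-periodic functions on the real line.\<close>

definition smooth_on_V :: "(real \<Rightarrow> int \<Rightarrow> real) \<Rightarrow> bool" where
  "smooth_on_V \<rho> \<longleftrightarrow> (\<forall>\<sigma>\<in>spins.
     (\<forall>x. \<rho> (x + 1) \<sigma> = \<rho> x \<sigma>) \<and>
     (\<forall>k x. ((deriv ^^ k) (\<lambda>y. \<rho> y \<sigma>)) differentiable (at x)))"

text \<open>\<open>C\<^sup>\<infinity>([0,T] \<times> V)\<close>: the function \<open>D i j\<close> is the derivative of order \<open>i\<close> in time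
  (one-sided at \<open>0\<close> and \<open>T\<close>) and order \<open>j\<close> in space.\<close>

definition smooth_on_time_V :: "real \<Rightarrow> (real \<Rightarrow> real \<Rightarrow> int \<Rightarrow> real) \<Rightarrow> bool" where
  "smooth_on_time_V T G \<longleftrightarrow> (\<forall>\<sigma>\<in>spins.
     (\<forall>t\<in>{0..T}. \<forall>x. G t (x + 1) \<sigma> = G t x \<sigma>) \<and>
     (\<exists>D :: nat \<Rightarrow> nat \<Rightarrow> real \<Rightarrow> real \<Rightarrow> real.
        (\<forall>t\<in>{0..T}. \<forall>x. D 0 0 t x = G t x \<sigma>) \<and>
        (\<forall>i j. continuous_on ({0..T} \<times> UNIV) (\<lambda>(t, x). D i j t x) \<and>
           (\<forall>t\<in>{0..T}. \<forall>x.
              ((\<lambda>s. D i j s x) has_real_derivative D (Suc i) j t x) (at t within {0..T}) \<and>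
              ((\<lambda>y. D i j t y) has_real_derivative D i (Suc j) t x) (at x)))))"

text \<open>The function against which \<open>\<alpha>\<^sub>s\<close> is integrated in the weak formulation, with \<open>m\<close> the
  magnetization at time \<open>s\<close>.\<close>

definition weak_integrand ::
    "real \<Rightarrow> (int \<Rightarrow> real \<Rightarrow> real) \<Rightarrow> (real \<Rightarrow> real \<Rightarrow> int \<Rightarrow> real) \<Rightarrow> real \<Rightarrow> real
      \<Rightarrow> real \<Rightarrow> int \<Rightarrow> real" where
  "weak_integrand T c G m s x \<sigma> =
     vector_derivative (\<lambda>u. G u x \<sigma>) (at s within {0..T}) +
     real_of_int \<sigma> * deriv (\<lambda>y. G s y \<sigma>) x +
     c \<sigma> m * (G s x (-\<sigma>) - G s x \<sigma>)"

text \<open>\<open>r t\<close> is the density of the measure \<open>\<alpha>\<^sub>t\<close>, so \<open>\<langle>\<alpha>\<^sub>t, \<phi>\<rangle>\<close> is \<open>L2_inner (r t) \<phi>\<close>; only its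
  restriction to \<open>[0,1]\<close> plays a role, up to null sets in the initial condition.\<close>

definition weak_solution ::
    "real \<Rightarrow> (int \<Rightarrow> real \<Rightarrow> real) \<Rightarrow> (real \<Rightarrow> int \<Rightarrow> real) \<Rightarrow> (real \<Rightarrow> real \<Rightarrow> int \<Rightarrow> real) \<Rightarrow> bool"
  where
  "weak_solution T c \<rho> r \<longleftrightarrow>
     (\<forall>t\<in>{0..T}. \<forall>\<sigma>\<in>spins.
        (\<forall>x\<in>{0..1}. 0 \<le> r t x \<sigma>) \<and> set_integrable lborel {0..1} (\<lambda>x. r t x \<sigma>)) \<and>
     (\<forall>\<sigma>\<in>spins. AE x in lborel. x \<in> {0..1} \<longrightarrow> r 0 x \<sigma> = \<rho> x \<sigma>) \<and>
     (\<forall>G. smooth_on_time_V T G \<longrightarrow>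
        set_integrable lborel {0..T}
          (\<lambda>s. L2_inner (r s) (weak_integrand T c G (density_magnetization (r s)) s)) \<and>
        (\<forall>t\<in>{0..T}. L2_inner (r t) (G t) - L2_inner (r 0) (G 0) -
           (LBINT s:{0..t}. L2_inner (r s) (weak_integrand T c G (density_magnetization (r s)) s))
           = 0))"

section \<open>Consistency of the definitions\<close>

text \<open>On a configuration, the two notions of magnetization agree.\<close>

lemma finite_sites [simp]: "finite (sites N)"
  by (simp add: sites_def spins_def)

lemma measure_magnetization_empirical_measure:
  assumes "N \<ge> 1"
  shows "measure_magnetization (empirical_measure N \<eta>) = magnetization N \<eta>"
proof -
  let ?M = "point_measure (sites N) (\<lambda>v. ennreal (real (\<eta> v) / real N))"
  let ?p = "\<lambda>(x, \<sigma>). (real_of_int x / real N, \<sigma>)"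
  have p: "?p \<in> measurable ?M V_algebra"
    by (auto simp: V_algebra_def sites_def point_measure_def space_pair_measure
          intro!: measurable_count_space_eq1[THEN iffD2])
  have int: "(\<integral>v. h v \<partial>empirical_measure N \<eta>) = (\<Sum>v\<in>sites N. real (\<eta> v) / real N * h (?p v))"
    if "h \<in> borel_measurable V_algebra" for h :: "real \<times> int \<Rightarrow> real"
    unfolding empirical_measure_def
    by (subst integral_distr[OF p that]) (simp add: lebesgue_integral_point_measure_finite)
  have m: "(\<lambda>(x::real, \<sigma>::int). (if \<sigma> = 1 then 1 else 0) - (if \<sigma> = -1 then 1 else 0) :: real)
      \<in> borel_measurable V_algebra"
    unfolding V_algebra_def by measurable
  have sites: "(\<Sum>v\<in>sites N. h v) = (\<Sum>x\<in>{0..<int N}. h (x, -1) + h (x, 1))" for h :: "int \<times> int \<Rightarrow> real"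
    unfolding sites_def spins_def by (simp add: sum.cartesian_product' algebra_simps)
  have "(\<integral>v. 1 \<partial>empirical_measure N \<eta>) = (\<Sum>v\<in>sites N. real (\<eta> v) / real N * 1)"
    by (rule int[of "\<lambda>_. 1"]) simp
  moreover have "\<dots> = real (num_particles N \<eta>) / real N"
    by (simp add: num_particles_def sum_divide_distrib)
  moreover note int[OF m]
  moreover have "(\<Sum>v\<in>sites N. real (\<eta> v) / real N *
        (case ?p v of (x, \<sigma>) \<Rightarrow> (if \<sigma> = 1 then 1 else 0) - (if \<sigma> = -1 then 1 else 0))) =
      (\<Sum>x\<in>{0..<int N}. real (\<eta> (x, 1)) - real (\<eta> (x, -1))) / real N"
    unfolding sites by (simp add: sum_divide_distrib diff_divide_distrib)
  ultimately have "measure_magnetization (empirical_measure N \<eta>) =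
      ((\<Sum>x\<in>{0..<int N}. real (\<eta> (x, 1)) - real (\<eta> (x, -1))) / real N) /
      (real (num_particles N \<eta>) / real N)"
    unfolding measure_magnetization_def by simp
  then show ?thesis
    using assms by (simp add: magnetization_def)
qed

lemma cadlag_paths_bounded:
  assumes f: "f \<in> cadlag_paths T E"
  shows "bounded (f ` {0..T})"
proof (cases "0 \<le> T")
  case True
  define Q where "Q a b \<longleftrightarrow> bounded (f ` ({a..b} \<inter> {0..T}))" for a b
  from True have "Q 0 T"
  proof (induction rule: Bolzano)
    case (trans a b c)
    then have "{a..c} \<inter> {0..T} = ({a..b} \<inter> {0..T}) \<union> ({b..c} \<inter> {0..T})" by auto
    with trans show ?case by (simp add: Q_def image_Un)
  next
    case (local x)
    have ev: "\<exists>d>0. bounded (f ` {y \<in> {0..T}. dist y x < d \<and> y \<in> A})"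
      if "(f \<longlongrightarrow> l) (at x within A)" for l A
    proof -
      from that have "\<forall>\<^sub>F y in at x within A. dist (f y) l < 1"
        by (rule tendstoD) simp
      then obtain d where d: "d > 0" "\<And>y. y \<in> A \<Longrightarrow> y \<noteq> x \<Longrightarrow> dist y x < d \<Longrightarrow> dist (f y) l < 1"
        unfolding eventually_at by blast
      have "f ` {y \<in> {0..T}. dist y x < d \<and> y \<in> A} \<subseteq> insert (f x) (ball l 1)"
        using d(2) by (force simp: dist_commute)
      then have "bounded (f ` {y \<in> {0..T}. dist y x < d \<and> y \<in> A})"
        by (rule bounded_subset[rotated]) simp
      with d(1) show ?thesis by blast
    qed
    have r: "\<exists>d>0. bounded (f ` {y \<in> {0..T}. dist y x < d \<and> y \<in> {x<..}})"
    proof (cases "x < T")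
      case True
      then show ?thesis using f local by (intro ev) (auto simp: cadlag_paths_def)
    next
      case False
      then have "{y \<in> {0..T}. dist y x < 1 \<and> y \<in> {x<..}} = {}" by auto
      then show ?thesis by (intro exI[of _ 1]) (simp only: image_empty bounded_empty, simp)
    qed
    have l: "\<exists>d>0. bounded (f ` {y \<in> {0..T}. dist y x < d \<and> y \<in> {..<x}})"
    proof (cases "0 < x")
      case True
      then obtain l where "(f \<longlongrightarrow> l) (at_left x)"
        using f local unfolding cadlag_paths_def by fastforce
      then show ?thesis by (rule ev)
    next
      case False
      then have "{y \<in> {0..T}. dist y x < 1 \<and> y \<in> {..<x}} = {}" by auto
      then show ?thesis by (intro exI[of _ 1]) (simp only: image_empty bounded_empty, simp)
    qed
    obtain d1 d2 where d: "d1 > 0" "d2 > 0"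
      "bounded (f ` {y \<in> {0..T}. dist y x < d1 \<and> y \<in> {x<..}})"
      "bounded (f ` {y \<in> {0..T}. dist y x < d2 \<and> y \<in> {..<x}})"
      using r l by blast
    show ?case
    proof (intro exI[of _ "min d1 d2"] conjI allI impI)
      fix a b assume ab: "a \<le> x \<and> x \<le> b \<and> b - a < min d1 d2"
      have "f ` ({a..b} \<inter> {0..T}) \<subseteq> insert (f x)
          (f ` {y \<in> {0..T}. dist y x < d1 \<and> y \<in> {x<..}} \<union>
           f ` {y \<in> {0..T}. dist y x < d2 \<and> y \<in> {..<x}})"
      proof
        fix z assume "z \<in> f ` ({a..b} \<inter> {0..T})"
        then obtain y where y: "z = f y" "a \<le> y" "y \<le> b" "0 \<le> y" "y \<le> T" by auto
        show "z \<in> insert (f x)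
          (f ` {y \<in> {0..T}. dist y x < d1 \<and> y \<in> {x<..}} \<union>
           f ` {y \<in> {0..T}. dist y x < d2 \<and> y \<in> {..<x}})"
          using y ab by (cases y x rule: linorder_cases) (auto simp: dist_real_def)
      qed
      then show "Q a b"
        unfolding Q_def by (rule bounded_subset[rotated]) (use d in simp)
    qed (use d in auto)
  qed
  then show ?thesis by (simp add: Q_def)
qed simp

text \<open>The Skorokhod distance is a metric, so that \<open>skorokhod_topology\<close> is a metric topology.\<close>

lemma Metric_space_skorokhod: "Metric_space (cadlag_paths T E) (skorokhod_dist T E)"
proof -
  define A :: "(real \<Rightarrow> 'a) \<Rightarrow> (real \<Rightarrow> 'a) \<Rightarrow> real set" where
    "A f g = {e. 0 < e \<and> (\<exists>\<theta>\<in>time_changes T. \<forall>t\<in>{0..T}.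
       \<bar>\<theta> t - t\<bar> \<le> e \<and> dist (f t) (g (\<theta> t)) \<le> e)}" for f g
  let ?D = "cadlag_paths T E"
  have d: "skorokhod_dist T E f g = Inf (A f g)" if "f \<in> ?D" "g \<in> ?D" for f g
    using that by (simp add: skorokhod_dist_def A_def)
  have bdd: "bdd_below (A f g)" for f g
    by (rule bdd_belowI[of _ 0]) (simp add: A_def)
  have ne: "A f g \<noteq> {}" if fg: "f \<in> ?D" "g \<in> ?D" for f g
  proof -
    have "bounded (f ` {0..T} \<union> g ` {0..T})"
      using fg by (simp add: cadlag_paths_bounded)
    then obtain B where B: "\<And>x y. x \<in> f ` {0..T} \<union> g ` {0..T} \<Longrightarrow> y \<in> f ` {0..T} \<union> g ` {0..T} \<Longrightarrow> dist x y \<le> B"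
      by (metis bounded_two_points)
    have "max 1 B \<in> A f g"
      unfolding A_def using B
      by (auto intro!: bexI[of _ id] simp: time_changes_def strict_mono_on_def le_max_iff_disj)
    then show ?thesis by blast
  qed
  have comm: "A f g \<subseteq> A g f" for f g
  proof
    fix e assume "e \<in> A f g"
    then obtain \<theta> where e: "0 < e" and \<theta>: "strict_mono_on {0..T} \<theta>" "\<theta> ` {0..T} = {0..T}"
      and le: "\<And>t. t \<in> {0..T} \<Longrightarrow> \<bar>\<theta> t - t\<bar> \<le> e \<and> dist (f t) (g (\<theta> t)) \<le> e"
      by (auto simp: A_def time_changes_def)
    define \<kappa> where "\<kappa> = inv_into {0..T} \<theta>"
    have inj: "inj_on \<theta> {0..T}" using \<theta>(1) by (rule strict_mono_on_imp_inj_on)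
    have k1: "\<kappa> t \<in> {0..T}" "\<theta> (\<kappa> t) = t" if "t \<in> {0..T}" for t
      using that \<theta>(2) unfolding \<kappa>_def by (metis inv_into_into, metis f_inv_into_f)
    have "\<kappa> ` {0..T} = {0..T}"
      unfolding \<kappa>_def using \<theta>(2) inj by (metis inv_into_image_cancel subset_refl)
    moreover have "strict_mono_on {0..T} \<kappa>"
      unfolding strict_mono_on_def
      by (metis k1 \<theta>(1) linorder_not_less strict_mono_on_leD)
    moreover have "\<bar>\<kappa> t - t\<bar> \<le> e \<and> dist (g t) (f (\<kappa> t)) \<le> e" if "t \<in> {0..T}" for t
      using le[OF k1(1)[OF that]] k1(2)[OF that] by (simp add: dist_commute abs_minus_commute)
    ultimately show "e \<in> A g f"
      using e by (auto simp: A_def time_changes_def intro!: bexI[of _ \<kappa>])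
  qed
  have tri: "e1 + e2 \<in> A f h" if e1: "e1 \<in> A f g" and e2: "e2 \<in> A g h" for e1 e2 f g h
  proof -
    from e1 obtain \<theta> where e: "0 < e1" and \<theta>: "strict_mono_on {0..T} \<theta>" "\<theta> ` {0..T} = {0..T}"
      and le: "\<And>t. t \<in> {0..T} \<Longrightarrow> \<bar>\<theta> t - t\<bar> \<le> e1 \<and> dist (f t) (g (\<theta> t)) \<le> e1"
      by (auto simp: A_def time_changes_def)
    from e2 obtain \<kappa> where e': "0 < e2" and \<kappa>: "strict_mono_on {0..T} \<kappa>" "\<kappa> ` {0..T} = {0..T}"
      and le': "\<And>t. t \<in> {0..T} \<Longrightarrow> \<bar>\<kappa> t - t\<bar> \<le> e2 \<and> dist (g t) (h (\<kappa> t)) \<le> e2"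
      by (auto simp: A_def time_changes_def)
    have in\<theta>: "\<theta> t \<in> {0..T}" if "t \<in> {0..T}" for t using \<theta>(2) that by blast
    have "(\<kappa> \<circ> \<theta>) ` {0..T} = {0..T}" unfolding image_comp[symmetric] \<theta>(2) \<kappa>(2) ..
    moreover have "strict_mono_on {0..T} (\<kappa> \<circ> \<theta>)"
      using \<theta>(1) \<kappa>(1) in\<theta> unfolding strict_mono_on_def comp_def by meson
    moreover have "\<bar>(\<kappa> \<circ> \<theta>) t - t\<bar> \<le> e1 + e2 \<and> dist (f t) (h ((\<kappa> \<circ> \<theta>) t)) \<le> e1 + e2"
      if "t \<in> {0..T}" for t
      using le[OF that] le'[OF in\<theta>[OF that]] dist_triangle[of "f t" "h (\<kappa> (\<theta> t))" "g (\<theta> t)"]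
      by auto
    ultimately show ?thesis
      using e e' unfolding A_def time_changes_def
      by (intro CollectI conjI bexI[of _ "\<kappa> \<circ> \<theta>"]) auto
  qed
  have small: "\<exists>\<theta>\<in>time_changes T. \<forall>t\<in>{0..T}. \<bar>\<theta> t - t\<bar> < e \<and> dist (f t) (g (\<theta> t)) < e"
    if "f \<in> ?D" "g \<in> ?D" "Inf (A f g) = 0" "e > 0" for f g e
  proof -
    have "\<exists>e'\<in>A f g. e' < e"
      using cInf_lessD[OF ne[OF that(1,2)], of e] that(3,4) by auto
    then obtain e' where "e' \<in> A f g" "e' < e" by blast
    then show ?thesis unfolding A_def by (fastforce intro: le_less_trans)
  qed
  show ?thesis
  proof
    fix f g show "0 \<le> skorokhod_dist T E f g"
    proof (cases "f \<in> ?D \<and> g \<in> ?D")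
      case True
      then show ?thesis using ne[of f g] by (auto simp: d A_def intro!: cInf_greatest)
    qed (auto simp: skorokhod_dist_def)
  next
    fix f g show "skorokhod_dist T E f g = skorokhod_dist T E g f"
      using comm[of f g] comm[of g f] d[of f g] d[of g f]
      by (cases "f \<in> ?D \<and> g \<in> ?D") (auto simp: skorokhod_dist_def)
  next
    fix f g h assume *: "f \<in> ?D" "g \<in> ?D" "h \<in> ?D"
    have "Inf (A f h) - e2 \<le> Inf (A f g)" if "e2 \<in> A g h" for e2
    proof (rule cInf_greatest[OF ne[OF *(1,2)]])
      fix e1 assume "e1 \<in> A f g"
      then have "Inf (A f h) \<le> e1 + e2" using that by (intro cInf_lower bdd tri)
      then show "Inf (A f h) - e2 \<le> e1" by simp
    qed
    then have "Inf (A f h) - Inf (A f g) \<le> e2" if "e2 \<in> A g h" for e2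
      using that by force
    then have "Inf (A f h) - Inf (A f g) \<le> Inf (A g h)"
      by (intro cInf_greatest[OF ne[OF *(2,3)]])
    then show "skorokhod_dist T E f h \<le> skorokhod_dist T E f g + skorokhod_dist T E g h"
      using * by (simp add: d)
  next
    fix f g assume fg: "f \<in> ?D" "g \<in> ?D"
    show "skorokhod_dist T E f g = 0 \<longleftrightarrow> f = g"
    proof
      assume "f = g"
      have "e \<in> A f f" if "e > 0" for e
        using that unfolding A_def
        by (auto intro!: bexI[of _ id] simp: time_changes_def strict_mono_on_def)
      then have "Inf (A f f) \<le> e" if "e > 0" for e using that bdd by (intro cInf_lower) auto
      then have "Inf (A f f) \<le> 0" by - (rule field_le_epsilon, simp)
      moreover have "0 \<le> Inf (A f f)"
        using ne[OF fg(1) fg(1)] by (auto simp: A_def intro!: cInf_greatest)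
      ultimately show "skorokhod_dist T E f g = 0"
        using fg \<open>f = g\<close> by (simp add: d)
    next
      assume "skorokhod_dist T E f g = 0"
      then have 0: "Inf (A f g) = 0" using fg by (simp add: d)
      have eq: "f t = g t" if t: "t \<in> {0..T}" for t
      proof (cases "t = T")
        case True
        have "dist (f T) (g T) \<le> e" if e: "e > 0" for e
        proof -
          obtain \<theta> where \<theta>: "\<theta> \<in> time_changes T"
            and le: "\<forall>t\<in>{0..T}. \<bar>\<theta> t - t\<bar> < e \<and> dist (f t) (g (\<theta> t)) < e"
            using small[OF fg 0 e] by blast
          have T: "T \<in> {0..T}" using t by auto
          have sm: "strict_mono_on {0..T} \<theta>" and im: "\<theta> ` {0..T} = {0..T}"
            using \<theta> by (simp_all add: time_changes_def)
          have "T \<in> \<theta> ` {0..T}" using im T by simp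
          then obtain s where s: "s \<in> {0..T}" "\<theta> s = T" by force
          have "\<theta> s \<le> \<theta> T"
            by (rule strict_mono_on_leD[OF sm s(1) T]) (use s in simp)
          moreover have "\<theta> T \<in> {0..T}" using im T by (metis imageI)
          ultimately have "\<theta> T = T" using s by auto
          moreover have "dist (f T) (g (\<theta> T)) < e" using bspec[OF le T] by simp
          ultimately show ?thesis by simp
        qed
        then have "dist (f T) (g T) \<le> 0" by - (rule field_le_epsilon, simp)
        then show ?thesis using True by simp
      next
        case False
        with t have tT: "t \<in> {0..<T}" by auto
        have "dist (f t) (g t) \<le> e" if e: "e > 0" for e
        proof -
          have "(f \<longlongrightarrow> f t) (at_right t)" "(g \<longlongrightarrow> g t) (at_right t)"
            using fg tT by (auto simp: cadlag_paths_def)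
          then have "\<forall>\<^sub>F s in at_right t. dist (f s) (f t) < e / 3 \<and> dist (g s) (g t) < e / 3"
            using e by (intro eventually_conj tendstoD) auto
          then obtain u0 where u0: "u0 > t"
            "\<And>s. t < s \<Longrightarrow> s < u0 \<Longrightarrow> dist (f s) (f t) < e / 3 \<and> dist (g s) (g t) < e / 3"
            unfolding eventually_at_right_field by blast
          define u where "u = min u0 T"
          have u: "t < u" "u \<le> u0" "u \<le> T" using u0 tT by (auto simp: u_def)
          define s where "s = (t + u) / 2"
          have "min (e / 3) ((u - t) / 2) > 0" using e u by simp
          from small[OF fg 0 this]
          obtain \<theta> where le: "\<forall>v\<in>{0..T}. \<bar>\<theta> v - v\<bar> < min (e / 3) ((u - t) / 2) \<and>
              dist (f v) (g (\<theta> v)) < min (e / 3) ((u - t) / 2)"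
            by blast
          have s: "s \<in> {0..T}" "t < s" "s < u" using u tT by (auto simp: s_def)
          have 1: "\<bar>\<theta> s - s\<bar> < (u - t) / 2" "dist (f s) (g (\<theta> s)) < e / 3"
            using bspec[OF le s(1)] by simp_all
          then have "t < \<theta> s" "\<theta> s < u" by (auto simp: s_def field_simps abs_less_iff)
          then have "dist (g (\<theta> s)) (g t) < e / 3" "dist (f s) (f t) < e / 3"
            using u0(2) u s by auto
          with 1(2) dist_triangle[of "f t" "g t" "f s"] dist_triangle[of "f s" "g t" "g (\<theta> s)"]
          show ?thesis by (simp add: dist_commute)
        qed
        then have "dist (f t) (g t) \<le> 0" by - (rule field_le_epsilon, simp)
        then show ?thesis by simp
      qed
      show "f = g"
      proof
        fix t show "f t = g t"
          using eq fg by (cases "t \<in> {0..T}") (auto simp: cadlag_paths_def PiE_def extensional_def)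
      qed
    qed
  qed
qed

end

theory Submission
  imports Defs
begin

text \<open>The generator maps the magnetization to a function of the magnetization alone, up to a term of
  order one over the number \<open>n\<close> of particles for its square. Hence, if \<open>m\<close> solves the limiting ordinary
  differential equation, \<open>exp (- C t) ((m\<^sub>N - m t)\<^sup>2 + \<kappa> / (n + 1))\<close> is a nonnegative supermartingale for
  suitable \<open>C\<close> and \<open>\<kappa>\<close>, and the maximal inequality bounds the probability that \<open>m\<^sub>N\<close> ever leaves a
  neighbourhood of \<open>m\<close> by the expectation at time \<open>0\<close>, which tends to \<open>0\<close> by a second moment computation
  for the Poisson distribution. Testing the weak form against functions of the spin shows that the
  magnetization of every weak solution solves the same equation; a weak solution is obtained by
  solving first for the magnetization and then the resulting linear transport equation along
  characteristics.\<close>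

section \<open>Drift of the magnetization under the generator\<close>

text \<open>The particle number \<open>n\<close> and the magnetization determine the two spin
  counts, which is why the generator closes on the magnetization. An explicit supermartingale then
  takes the place of a compactness argument for laws. Its correction \<kappa> / (n + 1) is constant
  along the dynamics; it sits inside the function, and not in a final estimate, because
  \<open>n\<close> is random under the Poisson law. Three obstacles shape the rest.
  \<open>has_generator\<close> gives only right derivatives at time 0; the forward equation is
  recovered from it because the configurations with a given particle number form a finite invariant
  set. The path measure lives on the \<sigma>-algebra of evaluations, whereas weak convergence
  refers to Borel sets of the Skorokhod topology; measurability is obtained from discretisations in
  time. Finally, the rates are controlled on [-1, 1] only, so the differential equation is solved
  with a clipped argument, and the clip is removed by comparison with the magnetization of the
  transport solution.\<close>

definition level :: "nat \<Rightarrow> nat \<Rightarrow> config set" where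
  "level N n = {\<eta> \<in> configs N. num_particles N \<eta> = n}"

definition drift :: "(int \<Rightarrow> real \<Rightarrow> real) \<Rightarrow> real \<Rightarrow> real" where
  "drift c m = c (-1) m * (1 - m) - c 1 m * (1 + m)"

text \<open>Finiteness turns the pointwise limits in \<open>has_generator\<close> into limits of
  finite sums, so that no exchange of limits has to be justified.\<close>

lemma finite_level: "finite (level N n)"
proof (rule finite_subset)
  show "level N n \<subseteq> PiE_dflt (sites N) 0 (\<lambda>_. {..n})"
  proof
    fix \<eta> assume \<eta>: "\<eta> \<in> level N n"
    have "\<eta> v \<le> n" if "v \<in> sites N" for v
      using member_le_sum[of v "sites N" \<eta>] that \<eta> by (simp add: level_def num_particles_def)
    with \<eta> show "\<eta> \<in> PiE_dflt (sites N) 0 (\<lambda>_. {..n})"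
      by (auto simp: PiE_dflt_def level_def configs_def)
  qed
qed (auto intro: finite_PiE_dflt)

lemma sum_sites:
  fixes h :: "int \<times> int \<Rightarrow> real"
  shows "(\<Sum>v\<in>sites N. h v) = (\<Sum>x\<in>{0..<int N}. h (x, 1)) + (\<Sum>x\<in>{0..<int N}. h (x, -1))"
  unfolding sites_def spins_def by (simp add: sum.cartesian_product' sum.distrib add.commute)

lemma magnetization_altdef:
  "magnetization N \<eta> =
     (\<Sum>v\<in>sites N. real_of_int (snd v) * real (\<eta> v)) / real (num_particles N \<eta>)"
  unfolding magnetization_def sum_sites by (simp add: sum_subtractf sum_negf)

lemma sum_move:
  fixes g :: "int \<times> int \<Rightarrow> real"
  assumes "v \<in> sites N" "w \<in> sites N" "\<eta> v > 0"
  shows "(\<Sum>u\<in>sites N. g u * real (move v w \<eta> u)) =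
    (\<Sum>u\<in>sites N. g u * real (\<eta> u)) - g v + g w"
proof -
  have "real (move v w \<eta> u) = real (\<eta> u) - (if u = v then 1 else 0) + (if u = w then 1 else 0)" for u
    using assms(3) by (auto simp: move_def Let_def of_nat_diff Suc_le_eq)
  then have "(\<Sum>u\<in>sites N. g u * real (move v w \<eta> u)) =
      (\<Sum>u\<in>sites N. g u * real (\<eta> u) - (if u = v then g u else 0) + (if u = w then g u else 0))"
    by (intro sum.cong refl) (simp only:, simp add: algebra_simps)
  then show ?thesis
    using assms(1,2) by (simp add: sum.distrib sum_subtractf)
qed

lemma num_particles_move:
  assumes "v \<in> sites N" "w \<in> sites N" "\<eta> v > 0"
  shows "num_particles N (move v w \<eta>) = num_particles N \<eta>"
  using sum_move[where \<eta>=\<eta>, OF assms, of "\<lambda>_. 1"] unfolding num_particles_def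
  by (simp flip: of_nat_sum)

lemma magnetization_move:
  assumes "v \<in> sites N" "w \<in> sites N" "\<eta> v > 0"
  shows "magnetization N (move v w \<eta>) =
    magnetization N \<eta> - real_of_int (snd v - snd w) / real (num_particles N \<eta>)"
  unfolding magnetization_altdef num_particles_move[where N=N and \<eta>=\<eta>, OF assms] sum_move[where \<eta>=\<eta>, OF assms]
  by (simp add: field_simps diff_divide_distrib add_divide_distrib)

lemma configs_move:
  assumes "v \<in> sites N" "w \<in> sites N" "\<eta> \<in> configs N"
  shows "move v w \<eta> \<in> configs N"
  using assms by (auto simp: configs_def move_def Let_def)

lemma neighbour_sites:
  assumes "(x, \<sigma>) \<in> sites N"
  shows "((x + \<sigma>) mod int N, \<sigma>) \<in> sites N" "(x, -\<sigma>) \<in> sites N"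
  using assms by (auto simp: sites_def spins_def)

text \<open>Moves out of an empty site have rate zero and have to be excluded from the hypothesis:
  there the truncated subtraction in \<open>move\<close> would create a particle.\<close>

lemma generator_cong_zero:
  assumes "\<And>v w. v \<in> sites N \<Longrightarrow> w \<in> sites N \<Longrightarrow> \<eta> v > 0 \<Longrightarrow> f (move v w \<eta>) = f \<eta>"
  shows "generator c N f \<eta> = 0"
proof -
  have z: "real (\<eta> (x, \<sigma>)) * (f (move (x, \<sigma>) w \<eta>) - f \<eta>) = 0"
    if "(x, \<sigma>) \<in> sites N" "w \<in> sites N" for x \<sigma> w
    using assms[OF that] by (cases "\<eta> (x, \<sigma>)") auto
  have z2: "c \<sigma> m * real (\<eta> (x, \<sigma>)) * (f (move (x, \<sigma>) w \<eta>) - f \<eta>) = 0"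
    if "(x, \<sigma>) \<in> sites N" "w \<in> sites N" for x \<sigma> w m
    using z[OF that] by (simp add: mult.assoc)
  have "(\<Sum>(x, \<sigma>)\<in>sites N. real (\<eta> (x, \<sigma>)) *
        (f (move (x, \<sigma>) ((x + \<sigma>) mod int N, \<sigma>) \<eta>) - f \<eta>)) = 0"
    using z neighbour_sites by (auto intro!: sum.neutral simp del: mult_eq_0_iff)
  moreover have "(\<Sum>(x, \<sigma>)\<in>sites N. c \<sigma> (magnetization N \<eta>) * real (\<eta> (x, \<sigma>)) *
        (f (move (x, \<sigma>) (x, -\<sigma>) \<eta>) - f \<eta>)) = 0"
    using z2 neighbour_sites by (auto intro!: sum.neutral simp del: mult_eq_0_iff)
  ultimately show ?thesis by (simp add: generator_def)
qed

text \<open>A displacement keeps the spin and hence the magnetization, so the part of the generator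
  with the factor \<open>N\<close> drops out. Flipping a particle of spin \<sigma> shifts the
  magnetization by -2 \<sigma> / n.\<close>

lemma generator_magnetization_fun:
  "generator c N (\<lambda>\<eta>. \<phi> (magnetization N \<eta>)) \<eta> =
    (\<Sum>v\<in>sites N. c (snd v) (magnetization N \<eta>) * real (\<eta> v) *
      (\<phi> (magnetization N \<eta> - 2 * real_of_int (snd v) / real (num_particles N \<eta>)) - \<phi> (magnetization N \<eta>)))"
proof -
  have 1: "real (\<eta> (x, \<sigma>)) * (\<phi> (magnetization N (move (x, \<sigma>) ((x + \<sigma>) mod int N, \<sigma>) \<eta>)) - \<phi> (magnetization N \<eta>)) = 0"
    if "(x, \<sigma>) \<in> sites N" for x \<sigma>
    using magnetization_move[OF that neighbour_sites(1)[OF that], of \<eta>]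
    by (cases "\<eta> (x, \<sigma>)") auto
  have 2: "c \<sigma> (magnetization N \<eta>) * real (\<eta> (x, \<sigma>)) * (\<phi> (magnetization N (move (x, \<sigma>) (x, -\<sigma>) \<eta>)) - \<phi> (magnetization N \<eta>))
    = c \<sigma> (magnetization N \<eta>) * real (\<eta> (x, \<sigma>)) * (\<phi> (magnetization N \<eta> - 2 * real_of_int \<sigma> / real (num_particles N \<eta>)) - \<phi> (magnetization N \<eta>))"
    if "(x, \<sigma>) \<in> sites N" for x \<sigma>
    using magnetization_move[OF that neighbour_sites(2)[OF that], of \<eta>]
    by (cases "\<eta> (x, \<sigma>)") auto
  have "(\<Sum>(x, \<sigma>)\<in>sites N. real (\<eta> (x, \<sigma>)) * (\<phi> (magnetization N (move (x, \<sigma>) ((x + \<sigma>) mod int N, \<sigma>) \<eta>)) - \<phi> (magnetization N \<eta>))) = 0"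
    using 1 by (auto intro!: sum.neutral simp del: mult_eq_0_iff)
  moreover have "(\<Sum>(x, \<sigma>)\<in>sites N. c \<sigma> (magnetization N \<eta>) * real (\<eta> (x, \<sigma>)) * (\<phi> (magnetization N (move (x, \<sigma>) (x, -\<sigma>) \<eta>)) - \<phi> (magnetization N \<eta>)))
     = (\<Sum>v\<in>sites N. c (snd v) (magnetization N \<eta>) * real (\<eta> v) *
      (\<phi> (magnetization N \<eta> - 2 * real_of_int (snd v) / real (num_particles N \<eta>)) - \<phi> (magnetization N \<eta>)))"
    using 2 by (intro sum.cong) auto
  ultimately show ?thesis by (simp add: generator_def)
qed

text \<open>For fixed \<open>n\<close> both counts are affine in the magnetization; this turns sums
  over sites into functions of the magnetization alone.\<close>

lemma spin_counts:
  assumes "num_particles N \<eta> > 0"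
  shows "(\<Sum>x\<in>{0..<int N}. real (\<eta> (x, 1))) = real (num_particles N \<eta>) * (1 + magnetization N \<eta>) / 2"
    and "(\<Sum>x\<in>{0..<int N}. real (\<eta> (x, -1))) = real (num_particles N \<eta>) * (1 - magnetization N \<eta>) / 2"
proof -
  let ?p = "\<Sum>x\<in>{0..<int N}. real (\<eta> (x, 1))" and ?q = "\<Sum>x\<in>{0..<int N}. real (\<eta> (x, -1))"
  have n: "real (num_particles N \<eta>) = ?p + ?q"
    unfolding num_particles_def of_nat_sum sum_sites ..
  have "real (num_particles N \<eta>) * magnetization N \<eta> = ?p - ?q"
    using assms by (simp add: magnetization_def sum_subtractf)
  with n show "?p = real (num_particles N \<eta>) * (1 + magnetization N \<eta>) / 2"
    "?q = real (num_particles N \<eta>) * (1 - magnetization N \<eta>) / 2"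
    by (simp_all add: algebra_simps)
qed

lemma magnetization_bounds: "magnetization N \<eta> \<in> {-1..1}"
proof (cases "num_particles N \<eta> > 0")
  case True
  have "0 \<le> (\<Sum>x\<in>{0..<int N}. real (\<eta> (x, 1)))" "0 \<le> (\<Sum>x\<in>{0..<int N}. real (\<eta> (x, -1)))"
    by (auto intro: sum_nonneg)
  then show ?thesis
    unfolding spin_counts[OF True] using True by (simp add: zero_le_mult_iff)
next
  case False
  then show ?thesis by (simp add: magnetization_def)
qed

lemma generator_magnetization:
  assumes "num_particles N \<eta> > 0"
  shows "generator c N (magnetization N) \<eta> = drift c (magnetization N \<eta>)"
proof -
  have "generator c N (magnetization N) \<eta> = (\<Sum>v\<in>sites N. c (snd v) (magnetization N \<eta>) * real (\<eta> v) *
      (- 2 * real_of_int (snd v) / real (num_particles N \<eta>)))"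
    using generator_magnetization_fun[of c N "\<lambda>x. x" \<eta>] by simp
  also have "\<dots> = c 1 (magnetization N \<eta>) * (-2 / real (num_particles N \<eta>)) * (\<Sum>x\<in>{0..<int N}. real (\<eta> (x, 1)))
      + c (-1) (magnetization N \<eta>) * (2 / real (num_particles N \<eta>)) * (\<Sum>x\<in>{0..<int N}. real (\<eta> (x, -1)))"
    unfolding sum_sites sum_distrib_left by (intro arg_cong2[where f = "(+)"] sum.cong) (simp_all add: mult_ac)
  also have "\<dots> = drift c (magnetization N \<eta>)"
    unfolding spin_counts[OF assms] drift_def using assms by (simp add: field_simps)
  finally show ?thesis .
qed

lemma generator_magnetization_square:
  assumes "num_particles N \<eta> > 0"
    and b: "\<And>\<sigma> m. \<sigma> \<in> spins \<Longrightarrow> m \<in> {-1..1} \<Longrightarrow> c \<sigma> m \<le> b"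
  shows "generator c N (\<lambda>\<eta>. (magnetization N \<eta>)\<^sup>2) \<eta> \<le>
    2 * magnetization N \<eta> * drift c (magnetization N \<eta>) + 4 * b / real (num_particles N \<eta>)"
proof -
  let ?m = "magnetization N \<eta>" and ?n = "real (num_particles N \<eta>)"
  have "generator c N (\<lambda>\<eta>. (magnetization N \<eta>)\<^sup>2) \<eta> = (\<Sum>v\<in>sites N. c (snd v) ?m * real (\<eta> v) *
      ((?m - 2 * real_of_int (snd v) / ?n)\<^sup>2 - ?m\<^sup>2))"
    using generator_magnetization_fun[of c N "\<lambda>x. x\<^sup>2" \<eta>] by simp
  also have "\<dots> = c 1 ?m * ((?m - 2 / ?n)\<^sup>2 - ?m\<^sup>2) * (\<Sum>x\<in>{0..<int N}. real (\<eta> (x, 1)))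
      + c (-1) ?m * ((?m + 2 / ?n)\<^sup>2 - ?m\<^sup>2) * (\<Sum>x\<in>{0..<int N}. real (\<eta> (x, -1)))"
    unfolding sum_sites sum_distrib_left by (intro arg_cong2[where f = "(+)"] sum.cong) (simp_all add: mult_ac)
  \<comment> \<open>The first-order parts of the two squares assemble the drift. The second-order
    parts 4 / n^2 meet counts of order n and leave a term of order 1 / n, in which the weights 1 + m
    and 1 - m add up to 2.\<close>
  also have "\<dots> = 2 * ?m * drift c ?m + (2 / ?n) * (c 1 ?m * (1 + ?m) + c (-1) ?m * (1 - ?m))"
    unfolding spin_counts[OF assms(1)] drift_def using assms by (simp add: field_simps power2_eq_square)
  also have "c 1 ?m * (1 + ?m) + c (-1) ?m * (1 - ?m) \<le> b * (1 + ?m) + b * (1 - ?m)"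
    using magnetization_bounds[of N \<eta>] b[of 1 ?m] b[of "-1" ?m]
    by (intro add_mono mult_right_mono) (auto simp: spins_def)
  finally show ?thesis using assms(1) by (simp add: field_simps mult_left_mono)
qed

lemma generator_empty:
  assumes "num_particles N \<eta> = 0"
  shows "generator c N f \<eta> = 0"
  using assms by (intro generator_cong_zero) (auto simp: num_particles_def)

section \<open>The semigroup on configurations with a fixed number of particles\<close>

lemma expectation_bounded:
  fixes f :: "'a \<Rightarrow> real"
  assumes "\<And>x. x \<in> set_pmf p \<Longrightarrow> \<bar>f x\<bar> \<le> B"
  shows "integrable (measure_pmf p) f" "\<bar>measure_pmf.expectation p f\<bar> \<le> B"
proof -
  show i: "integrable (measure_pmf p) f"
    by (rule measure_pmf.integrable_const_bound[where B=B]) (auto simp: AE_measure_pmf_iff assms)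
  have "\<bar>measure_pmf.expectation p f\<bar> \<le> measure_pmf.expectation p (\<lambda>x. \<bar>f x\<bar>)"
    using integral_norm_bound[of "measure_pmf p" f] by simp
  also have "\<dots> \<le> measure_pmf.expectation p (\<lambda>_. B)"
    by (rule integral_mono_AE) (use i in \<open>auto simp: AE_measure_pmf_iff assms\<close>)
  finally show "\<bar>measure_pmf.expectation p f\<bar> \<le> B" by simp
qed

text \<open>Adding the bound \<open>B\<close> makes the integrand nonnegative, so the identity can
  be read off from the one for nonnegative integrals.\<close>

lemma expectation_bind_pmf:
  fixes f :: "'b \<Rightarrow> real"
  assumes "\<And>x. \<bar>f x\<bar> \<le> B"
  shows "measure_pmf.expectation (bind_pmf p q) f =
    measure_pmf.expectation p (\<lambda>x. measure_pmf.expectation (q x) f)"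
proof -
  have g0: "0 \<le> f x + B" for x using assms[of x] by (simp add: abs_le_iff)
  have e0: "0 \<le> measure_pmf.expectation r f + B" for r :: "'b pmf"
    using expectation_bounded(2)[of r f B] assms by (simp add: abs_le_iff)
  have nn: "(\<integral>\<^sup>+x. ennreal (f x + B) \<partial>measure_pmf r) = ennreal (measure_pmf.expectation r f + B)" for r
    by (subst nn_integral_eq_integral) (use assms expectation_bounded(1)[of r f B] g0 in auto)
  have nn': "(\<integral>\<^sup>+x. ennreal (measure_pmf.expectation (q x) f + B) \<partial>measure_pmf p) =
      ennreal (measure_pmf.expectation p (\<lambda>x. measure_pmf.expectation (q x) f) + B)"
    by (subst nn_integral_eq_integral)
      (use expectation_bounded[of p "\<lambda>x. measure_pmf.expectation (q x) f" B] expectation_bounded(2)[of _ f B] assms e0 in auto)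
  have "ennreal (measure_pmf.expectation (bind_pmf p q) f + B) =
      ennreal (measure_pmf.expectation p (\<lambda>x. measure_pmf.expectation (q x) f) + B)"
    unfolding nn[symmetric] nn'[symmetric] nn_integral_bind_pmf ..
  moreover have "0 \<le> measure_pmf.expectation p (\<lambda>x. measure_pmf.expectation (q x) f) + B"
    using expectation_bounded(2)[of p "\<lambda>x. measure_pmf.expectation (q x) f" B]
      expectation_bounded(2)[of _ f B] assms by (simp add: abs_le_iff)
  ultimately show ?thesis using e0 by (simp add: ennreal_inj)
qed

lemma semigroup_expectation:
  fixes f :: "config \<Rightarrow> real"
  assumes K: "transition_semigroup N K" and f: "bounded (range f)"
    and "0 \<le> s" "0 \<le> t" "\<eta> \<in> configs N"
  shows "measure_pmf.expectation (K (s + t) \<eta>) f =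
    measure_pmf.expectation (K s \<eta>) (\<lambda>\<xi>. measure_pmf.expectation (K t \<xi>) f)"
proof -
  have "K (s + t) \<eta> = bind_pmf (K s \<eta>) (K t)"
    using assms by (simp add: transition_semigroup_def)
  moreover obtain B where "\<And>x. \<bar>f x\<bar> \<le> B"
    using f by (auto simp: bounded_iff)
  ultimately show ?thesis
    using expectation_bind_pmf[of f B "K s \<eta>" "K t"] by simp
qed

lemma semigroup_zero:
  assumes "transition_semigroup N K" "\<eta> \<in> configs N"
  shows "K 0 \<eta> = return_pmf \<eta>"
  using assms unfolding transition_semigroup_def by blast

text \<open>\<open>has_generator\<close> speaks about time 0 only, so the mass leaking out of a
  level up to time \<open>t\<close> is estimated over k intervals of length t / k. Each contributes
  o(t / k), because on the level the generator annihilates the indicator of the complement.\<close>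

lemma level_invariant:
  assumes K: "transition_semigroup N K" and A: "has_generator N K (generator c N)"
    and "0 \<le> t" and \<eta>: "\<eta> \<in> level N n"
  shows "set_pmf (K t \<eta>) \<subseteq> level N n"
proof -
  define f :: "config \<Rightarrow> real" where "f = indicator (- level N n)"
  have f: "bounded (range f)"
    by (auto simp: f_def bounded_iff intro!: exI[of _ 1] split: split_indicator)
  define u where "u h \<xi> = measure_pmf.expectation (K h \<xi>) f" for h \<xi>
  have u0: "0 \<le> u h \<xi>" for h \<xi>
    unfolding u_def f_def by (intro integral_nonneg_AE) auto
  have u1: "u h \<xi> \<le> 1" for h \<xi>
    using expectation_bounded(2)[of "K h \<xi>" f 1] unfolding u_def f_def
    by (auto split: split_indicator)
  \<comment> \<open>Summing over the finite level gives one modulus that serves all starting points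
    in it at once.\<close>
  define \<omega> where "\<omega> h = (\<Sum>\<xi>\<in>level N n. u h \<xi>)" for h
  have lev: "level N n \<subseteq> configs N" by (auto simp: level_def)
  have "generator c N f \<xi> = 0" if "\<xi> \<in> level N n" for \<xi>
    using that by (intro generator_cong_zero) (auto simp: f_def level_def num_particles_move configs_move)
  moreover have "((\<lambda>h. (u h \<xi> - f \<xi>) / h) \<longlongrightarrow> generator c N f \<xi>) (at_right 0)" if "\<xi> \<in> level N n" for \<xi>
    using A f that lev unfolding has_generator_def u_def by blast
  ultimately have "((\<lambda>h. u h \<xi> / h) \<longlongrightarrow> 0) (at_right 0)" if "\<xi> \<in> level N n" for \<xi>
    using that by (force simp: f_def)
  then have \<omega>: "((\<lambda>h. \<omega> h / h) \<longlongrightarrow> 0) (at_right 0)"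
    unfolding \<omega>_def sum_divide_distrib by (intro tendsto_null_sum)
  have step: "u (s + h) \<eta> \<le> u s \<eta> + \<omega> h" if "0 \<le> s" "0 \<le> h" for s h
  proof -
    have "u (s + h) \<eta> = measure_pmf.expectation (K s \<eta>) (u h)"
      unfolding u_def by (rule semigroup_expectation[OF K f that]) (use \<eta> lev in auto)
    also have "\<dots> \<le> measure_pmf.expectation (K s \<eta>) (\<lambda>\<xi>. f \<xi> + \<omega> h)"
    proof (rule integral_mono)
      show "integrable (K s \<eta>) (u h)"
        using u0 u1 by (intro expectation_bounded(1)[where B=1]) (simp add: abs_le_iff order_trans[OF _ u0])
      show "integrable (K s \<eta>) (\<lambda>\<xi>. f \<xi> + \<omega> h)"
        by (intro Bochner_Integration.integrable_add expectation_bounded(1)[where B=1 and f=f])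
          (auto simp: f_def split: split_indicator)
      \<comment> \<open>Outside the level \<open>f\<close> is 1 and the bound is trivial, so the
        semigroup is never examined there.\<close>
      show "u h \<xi> \<le> f \<xi> + \<omega> h" for \<xi>
      proof (cases "\<xi> \<in> level N n")
        case True
        then have "u h \<xi> \<le> \<omega> h"
          unfolding \<omega>_def using finite_level u0 by (intro member_le_sum) auto
        then show ?thesis using True by (simp add: f_def)
      next
        case False
        have "0 \<le> \<omega> h" unfolding \<omega>_def by (intro sum_nonneg u0)
        with u1[of h \<xi>] False show ?thesis by (simp add: f_def)
      qed
    qed
    also have "\<dots> = u s \<eta> + \<omega> h"
    proof -
      have "integrable (K s \<eta>) f"
        by (rule expectation_bounded(1)[where B=1]) (auto simp: f_def split: split_indicator)
      then show ?thesis by (simp add: u_def)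
    qed
    finally show ?thesis .
  qed
  have zero: "u 0 \<eta> = 0"
    using semigroup_zero[OF K, of \<eta>] \<eta> lev by (auto simp: u_def f_def)
  have iter: "u (real k * h) \<eta> \<le> real k * \<omega> h" if "0 \<le> h" for k h
  proof (induction k)
    case 0 show ?case using zero by simp
  next
    case (Suc k)
    then show ?case using step[of "real k * h" h] that by (simp add: algebra_simps)
  qed
  have "u t \<eta> \<le> 0"
  proof (cases "t = 0")
    case False
    with \<open>0 \<le> t\<close> have t: "0 < t" by simp
    have "filterlim (\<lambda>k. t / real (Suc k)) (at_right 0) sequentially"
      using t LIMSEQ_Suc[OF lim_const_over_n[of t]] by (auto simp: filterlim_at simp del: of_nat_Suc)
    then have "(\<lambda>k. t * (\<omega> (t / real (Suc k)) / (t / real (Suc k)))) \<longlonglongrightarrow> t * 0"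
      by (intro tendsto_mult_left filterlim_compose[OF \<omega>])
    moreover have "u t \<eta> \<le> t * (\<omega> (t / real (Suc k)) / (t / real (Suc k)))" for k
    proof -
      have "real (Suc k) * (t / real (Suc k)) = t" by simp
      moreover have "t * (x / (t / real (Suc k))) = real (Suc k) * x" for x using t by simp
      ultimately show ?thesis using iter[of "t / real (Suc k)" "Suc k"] t by (simp add: mult.commute)
    qed
    ultimately show ?thesis
      by (intro LIMSEQ_le_const[where X="\<lambda>k. t * (\<omega> (t / real (Suc k)) / (t / real (Suc k)))"]) auto
  qed (use zero in simp)
  with u0[of t \<eta>] have "measure_pmf.prob (K t \<eta>) (- level N n) = 0"
    unfolding u_def f_def by (simp add: measure_le_0_iff)
  then show ?thesis
    by (auto simp: measure_pmf_zero_iff)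
qed

lemma expectation_level:
  fixes f :: "config \<Rightarrow> real"
  assumes "set_pmf p \<subseteq> level N n"
  shows "measure_pmf.expectation p f = (\<Sum>\<xi>\<in>level N n. pmf p \<xi> * f \<xi>)"
  using integral_measure_pmf_real[where A = "level N n" and M = p and f = f, OF finite_level] assms by (auto simp: mult.commute)

text \<open>An increment of the expectation between two times is an average, under the law at the
  earlier time, of increments started at time 0. Letting the two times merge from either side gives
  continuity; a two-sided derivative then also uses that the law itself is continuous in time, which
  is the first claim applied to indicators.\<close>

lemma
  fixes f :: "config \<Rightarrow> real"
  assumes K: "transition_semigroup N K" and A: "has_generator N K (generator c N)"
    and \<eta>: "\<eta> \<in> level N n" and f: "bounded (range f)"
  shows semigroup_continuous: "continuous_on {0..} (\<lambda>s. measure_pmf.expectation (K s \<eta>) f)"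
    and kolmogorov_forward: "0 < s \<Longrightarrow> ((\<lambda>s. measure_pmf.expectation (K s \<eta>) f) has_real_derivative
      measure_pmf.expectation (K s \<eta>) (generator c N f)) (at s)"
proof -
  note lev = level_invariant[OF K A]
  have conf: "level N n \<subseteq> configs N" by (auto simp: level_def)
  define p where "p g s = measure_pmf.expectation (K s \<eta>) g" for g :: "config \<Rightarrow> real" and s
  define q where "q g h \<xi> = measure_pmf.expectation (K h \<xi>) g - g \<xi>" for g :: "config \<Rightarrow> real" and h \<xi>
  have q: "((\<lambda>h. q g h \<xi> / h) \<longlongrightarrow> generator c N g \<xi>) (at_right 0)"
    if "bounded (range g)" "\<xi> \<in> level N n" for g \<xi>
    using A that conf unfolding has_generator_def q_def by blast
  have q0: "((\<lambda>h. q g h \<xi>) \<longlongrightarrow> 0) (at_right 0)" if "bounded (range g)" "\<xi> \<in> level N n" for g \<xi>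
  proof -
    have "((\<lambda>h. q g h \<xi> / h * h) \<longlongrightarrow> generator c N g \<xi> * 0) (at_right 0)"
      by (intro tendsto_mult q that tendsto_ident_at)
    moreover have "\<forall>\<^sub>F h in at_right (0::real). q g h \<xi> / h * h = q g h \<xi>"
      by (auto simp: eventually_at_filter)
    ultimately show ?thesis by (simp add: filterlim_cong)
  qed
  have inc: "p g (s + h) - p g s = (\<Sum>\<xi>\<in>level N n. pmf (K s \<eta>) \<xi> * q g h \<xi>)"
    if "bounded (range g)" "0 \<le> s" "0 \<le> h" for g s h
  proof -
    have "p g (s + h) = measure_pmf.expectation (K s \<eta>) (\<lambda>\<xi>. measure_pmf.expectation (K h \<xi>) g)"
      unfolding p_def by (rule semigroup_expectation[OF K that]) (use \<eta> conf in auto)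
    then show ?thesis
      unfolding p_def q_def expectation_level[OF lev[OF \<open>0 \<le> s\<close> \<eta>]]
      by (simp add: sum_subtractf right_diff_distrib)
  qed
  \<comment> \<open>Both orders of \<open>s\<close> and \<open>s'\<close> are put into one formula,
    with the earlier time \<open>min s s'\<close> and the positive length \<bar>s' - s\<bar>, so
    that right limits at 0 yield two-sided limits.\<close>
  have inc_sym: "p g s' - p g s = sgn (s' - s) * (\<Sum>\<xi>\<in>level N n. pmf (K (min s s') \<eta>) \<xi> * q g \<bar>s' - s\<bar> \<xi>)"
    if "bounded (range g)" "0 \<le> s" "0 \<le> s'" "s \<noteq> s'" for g s s'
    using inc[OF that(1), of s "s' - s"] inc[OF that(1), of s' "s - s'"] that
    by (cases "s < s'") (auto simp: min_def sgn_if)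
  have abs0: "filterlim (\<lambda>s'. \<bar>s' - s\<bar>) (at_right 0) (at s within S)" for s :: real and S
    by (auto simp: filterlim_at eventually_at_filter intro!: tendsto_eq_intros)
  have cont: "continuous_on {0..} (p g)" if g: "bounded (range g)" for g
    unfolding continuous_on_def
  proof
    fix s :: real assume s: "s \<in> {0..}"
    have "((\<lambda>s'. p g s' - p g s) \<longlongrightarrow> 0) (at s within {0..})"
    proof (rule Lim_null_comparison)
      show "\<forall>\<^sub>F s' in at s within {0..}. norm (p g s' - p g s) \<le> (\<Sum>\<xi>\<in>level N n. \<bar>q g \<bar>s' - s\<bar> \<xi>\<bar>)"
        unfolding eventually_at_filter
      proof (intro always_eventually allI impI)
        fix s' :: real assume s': "s' \<noteq> s" "s' \<in> {0..}"
        have "\<bar>\<Sum>\<xi>\<in>level N n. pmf (K (min s s') \<eta>) \<xi> * q g \<bar>s' - s\<bar> \<xi>\<bar> \<le> (\<Sum>\<xi>\<in>level N n. \<bar>q g \<bar>s' - s\<bar> \<xi>\<bar>)"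
          by (rule order_trans[OF sum_abs], rule sum_mono)
             (simp add: abs_mult mult_left_le_one_le pmf_le_1)
        then show "norm (p g s' - p g s) \<le> (\<Sum>\<xi>\<in>level N n. \<bar>q g \<bar>s' - s\<bar> \<xi>\<bar>)"
          using inc_sym[OF g, of s s'] s s' by (auto simp: abs_mult abs_sgn_eq)
      qed
      show "((\<lambda>s'. \<Sum>\<xi>\<in>level N n. \<bar>q g \<bar>s' - s\<bar> \<xi>\<bar>) \<longlongrightarrow> 0) (at s within {0..})"
        by (intro tendsto_null_sum tendsto_rabs_zero filterlim_compose[OF q0[OF g] abs0])
    qed
    then show "(p g \<longlongrightarrow> p g s) (at s within {0..})" by (simp add: LIM_zero_iff)
  qed
  show "continuous_on {0..} (\<lambda>s. measure_pmf.expectation (K s \<eta>) f)"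
    using cont[OF f] by (simp add: p_def[abs_def])
  have pmf_lim: "((\<lambda>s'. pmf (K s' \<eta>) \<xi>) \<longlongrightarrow> pmf (K s \<eta>) \<xi>) (at s within {0..})" if "0 \<le> s" for s \<xi>
  proof -
    have b: "bounded (range (indicator {\<xi>} :: config \<Rightarrow> real))"
      by (auto simp: bounded_iff intro!: exI[of _ 1] split: split_indicator)
    show ?thesis
      using cont[OF b] that by (auto simp: p_def[abs_def] continuous_on_def pmf.rep_eq)
  qed
  assume s: "0 < s"
  \<comment> \<open>For \<open>s'\<close> below \<open>s\<close> the averaging law is the one at
    \<open>s'\<close>, so its weights have to converge as well.\<close>
  have mn: "((\<lambda>s'. pmf (K (min s s') \<eta>) \<xi>) \<longlongrightarrow> pmf (K s \<eta>) \<xi>) (at s)" for \<xi>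
  proof -
    have "\<forall>\<^sub>F s' in at s. 0 \<le> min s s'"
      using order_tendstoD(1)[OF tendsto_ident_at s] by eventually_elim (use s in auto)
    moreover have "((\<lambda>s'. min s s') \<longlongrightarrow> s) (at s)" by (auto intro!: tendsto_eq_intros)
    ultimately show ?thesis
      using continuous_on_tendsto_compose[of "{0..}" "\<lambda>s'. pmf (K s' \<eta>) \<xi>" "\<lambda>s'. min s s'" s "at s"] s pmf_lim
      by (auto simp: continuous_on_def)
  qed
  have "((\<lambda>s'. (p f s' - p f s) / (s' - s)) \<longlongrightarrow> (\<Sum>\<xi>\<in>level N n. pmf (K s \<eta>) \<xi> * generator c N f \<xi>)) (at s)"
  proof (rule Lim_transform_eventually)
    show "((\<lambda>s'. \<Sum>\<xi>\<in>level N n. pmf (K (min s s') \<eta>) \<xi> * (q f \<bar>s' - s\<bar> \<xi> / \<bar>s' - s\<bar>)) \<longlongrightarrow>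
        (\<Sum>\<xi>\<in>level N n. pmf (K s \<eta>) \<xi> * generator c N f \<xi>)) (at s)"
      by (intro tendsto_sum tendsto_mult mn) (rule filterlim_compose[OF q[OF f] abs0])
    have "\<forall>\<^sub>F s' in at s. 0 < s'" by (rule order_tendstoD(1)[OF tendsto_ident_at s])
    then show "\<forall>\<^sub>F s' in at s. (\<Sum>\<xi>\<in>level N n. pmf (K (min s s') \<eta>) \<xi> * (q f \<bar>s' - s\<bar> \<xi> / \<bar>s' - s\<bar>)) =
        (p f s' - p f s) / (s' - s)"
      unfolding eventually_at_filter
    proof eventually_elim
      case (elim s')
      show ?case
      proof (intro impI)
        assume "s' \<noteq> s"
        with inc_sym[OF f, of s s'] s elim
        have "(p f s' - p f s) / (s' - s) = (\<Sum>\<xi>\<in>level N n. pmf (K (min s s') \<eta>) \<xi> * q f \<bar>s' - s\<bar> \<xi>) / \<bar>s' - s\<bar>"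
          by (auto simp: sgn_if abs_if minus_divide_right)
        then show "(\<Sum>\<xi>\<in>level N n. pmf (K (min s s') \<eta>) \<xi> * (q f \<bar>s' - s\<bar> \<xi> / \<bar>s' - s\<bar>)) =
            (p f s' - p f s) / (s' - s)"
          by (simp add: sum_divide_distrib)
      qed
    qed
  qed
  then show "((\<lambda>s. measure_pmf.expectation (K s \<eta>) f) has_real_derivative
      measure_pmf.expectation (K s \<eta>) (generator c N f)) (at s)"
    unfolding has_field_derivative_iff p_def expectation_level[OF lev[OF less_imp_le[OF s] \<eta>], of "generator c N f"] .
qed


section \<open>Lipschitz bound for the drift and the Lyapunov function\<close>

lemma
  assumes b: "\<And>\<sigma> m. \<sigma> \<in> spins \<Longrightarrow> m \<in> {-1..1} \<Longrightarrow> 0 \<le> c \<sigma> m \<and> c \<sigma> m \<le> b"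
    and L: "\<And>\<sigma> m m'. \<sigma> \<in> spins \<Longrightarrow> m \<in> {-1..1} \<Longrightarrow> m' \<in> {-1..1} \<Longrightarrow> \<bar>c \<sigma> m - c \<sigma> m'\<bar> \<le> L * \<bar>m - m'\<bar>"
    and m: "m \<in> {-1..1}" "m' \<in> {-1..1}"
  shows drift_lipschitz: "\<bar>drift c m - drift c m'\<bar> \<le> (4 * L + 2 * b) * \<bar>m - m'\<bar>"
    and drift_bounded: "\<bar>drift c m\<bar> \<le> 2 * b"
proof -
  have s: "(1::int) \<in> spins" "(-1::int) \<in> spins" by (auto simp: spins_def)
  \<comment> \<open>The differences of rates carry factors 1 - m and 1 + m, each at most 2; the
    remaining terms carry rates at most \<open>b\<close>. This gives 4 L + 2 b.\<close>
  have "drift c m - drift c m' = (c (-1) m - c (-1) m') * (1 - m) - (c 1 m - c 1 m') * (1 + m)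
      - c (-1) m' * (m - m') - c 1 m' * (m - m')"
    by (simp add: drift_def algebra_simps)
  also have "\<bar>\<dots>\<bar> \<le> \<bar>c (-1) m - c (-1) m'\<bar> * (1 - m) + \<bar>c 1 m - c 1 m'\<bar> * (1 + m)
      + c (-1) m' * \<bar>m - m'\<bar> + c 1 m' * \<bar>m - m'\<bar>"
  proof -
    have "\<bar>(c (-1) m - c (-1) m') * (1 - m)\<bar> = \<bar>c (-1) m - c (-1) m'\<bar> * (1 - m)"
      "\<bar>(c 1 m - c 1 m') * (1 + m)\<bar> = \<bar>c 1 m - c 1 m'\<bar> * (1 + m)"
      "\<bar>c (-1) m' * (m - m')\<bar> = c (-1) m' * \<bar>m - m'\<bar>" "\<bar>c 1 m' * (m - m')\<bar> = c 1 m' * \<bar>m - m'\<bar>"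
      using m b[OF s(1) m(2)] b[OF s(2) m(2)] by (auto simp: abs_mult)
    then show ?thesis by linarith
  qed
  also have "\<dots> \<le> L * \<bar>m - m'\<bar> * 2 + L * \<bar>m - m'\<bar> * 2 + b * \<bar>m - m'\<bar> + b * \<bar>m - m'\<bar>"
    using m L[OF s(1) m] L[OF s(2) m] b[OF s(1) m(2)] b[OF s(2) m(2)]
    by (intro add_mono mult_mono) (auto intro: order_trans[OF abs_ge_zero])
  finally show "\<bar>drift c m - drift c m'\<bar> \<le> (4 * L + 2 * b) * \<bar>m - m'\<bar>"
    by (simp add: algebra_simps)
  \<comment> \<open>The drift is a difference of two quantities in [0, 2 b], so its modulus is at
    most 2 b and not merely 4 b.\<close>
  have "0 \<le> c (-1) m * (1 - m)" "0 \<le> c 1 m * (1 + m)" "c (-1) m * (1 - m) \<le> b * (1 - m)" "c 1 m * (1 + m) \<le> b * (1 + m)"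
    using m b[OF s(1) m(1)] b[OF s(2) m(1)] by (auto intro!: mult_right_mono)
  moreover have "b * (1 - m) \<le> b * 2" "b * (1 + m) \<le> b * 2"
    using m b[OF s(1) m(1)] by (auto intro!: mult_left_mono)
  ultimately show "\<bar>drift c m\<bar> \<le> 2 * b" unfolding drift_def by linarith
qed

text \<open>The summand with \<kappa> depends on the configuration only through the conserved
  particle number. Discounted by \<open>exp (- C * t)\<close> it decreases fast enough to pay for
  the fluctuations of the square; the denominator n + 1 in place of n covers the empty
  configuration.\<close>

definition lyapunov :: "real \<Rightarrow> real \<Rightarrow> nat \<Rightarrow> (real \<Rightarrow> real) \<Rightarrow> real \<Rightarrow> config \<Rightarrow> real" where
  "lyapunov C \<kappa> N m t \<eta> =
     exp (- C * t) * ((magnetization N \<eta> - m t)\<^sup>2 + \<kappa> / (real (num_particles N \<eta>) + 1))"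

lemma lyapunov_bounds:
  assumes "m t \<in> {-1..1}" "0 \<le> \<kappa>" "0 \<le> C" "0 \<le> t"
  shows "0 \<le> lyapunov C \<kappa> N m t \<eta>" "lyapunov C \<kappa> N m t \<eta> \<le> 4 + \<kappa>"
proof -
  have "(magnetization N \<eta> - m t)\<^sup>2 \<le> 2\<^sup>2"
    using assms(1) magnetization_bounds[of N \<eta>] by (intro power2_le_iff_abs_le[THEN iffD2]) auto
  moreover have "\<kappa> / (real (num_particles N \<eta>) + 1) \<le> \<kappa>"
    using assms(2) by (simp add: field_simps mult_left_mono)
  moreover have "exp (- C * t) \<le> 1" using assms by simp
  ultimately show "lyapunov C \<kappa> N m t \<eta> \<le> 4 + \<kappa>"
    unfolding lyapunov_def using mult_mono[of "exp (- C * t)" 1 "(magnetization N \<eta> - m t)\<^sup>2 + \<kappa> / (real (num_particles N \<eta>) + 1)" "4 + \<kappa>"] assms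
    by simp
  show "0 \<le> lyapunov C \<kappa> N m t \<eta>" using assms by (simp add: lyapunov_def)
qed

text \<open>Before discounting, the expectation grows at most like 2 (M - m) (drift M - drift m) + 4
  b / n. The first part is at most C (M - m)^2 once \<open>C\<close> is twice the Lipschitz
  constant, the second at most C \<kappa> / (n + 1); the discount removes exactly the sum of these
  bounds.\<close>

lemma lyapunov_supermartingale:
  assumes K: "transition_semigroup N K" and A: "has_generator N K (generator c N)"
    and b: "\<And>\<sigma> m. \<sigma> \<in> spins \<Longrightarrow> m \<in> {-1..1} \<Longrightarrow> 0 \<le> c \<sigma> m \<and> c \<sigma> m \<le> b"
    and L: "\<And>\<sigma> m m'. \<sigma> \<in> spins \<Longrightarrow> m \<in> {-1..1} \<Longrightarrow> m' \<in> {-1..1} \<Longrightarrow> \<bar>c \<sigma> m - c \<sigma> m'\<bar> \<le> L * \<bar>m - m'\<bar>"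
    and C: "2 * (4 * L + 2 * b) \<le> C" "8 * b \<le> C * \<kappa>" and \<kappa>: "0 \<le> \<kappa>"
    and m: "\<And>t. t \<in> {0..T} \<Longrightarrow> m t \<in> {-1..1}"
    and ode: "\<And>t. t \<in> {0..T} \<Longrightarrow> (m has_real_derivative drift c (m t)) (at t within {0..T})"
    and st: "0 \<le> s" "s \<le> t" "t \<le> T" and \<eta>: "\<eta> \<in> configs N"
  shows "measure_pmf.expectation (K (t - s) \<eta>) (lyapunov C \<kappa> N m t) \<le> lyapunov C \<kappa> N m s \<eta>"
proof -
  define n where "n = num_particles N \<eta>"
  have \<eta>n: "\<eta> \<in> level N n" using \<eta> by (simp add: level_def n_def)
  define M where "M = magnetization N"
  define M2 where "M2 = (\<lambda>\<xi>. (magnetization N \<xi>)\<^sup>2)"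
  have Mb: "bounded (range M)"
  proof (rule boundedI[of _ 1])
    fix x assume "x \<in> range M"
    then obtain \<xi> where "x = M \<xi>" by auto
    then show "norm x \<le> 1"
      using magnetization_bounds[of N \<xi>] by (simp add: M_def abs_le_iff)
  qed
  have M2b: "bounded (range M2)"
  proof -
    have "\<bar>M2 \<xi>\<bar> \<le> 1" for \<xi>
      using magnetization_bounds[of N \<xi>] by (simp add: M2_def abs_square_le_1 abs_le_iff)
    then show ?thesis by (auto simp: bounded_iff)
  qed
  define E where "E f u = measure_pmf.expectation (K u \<eta>) f" for f :: "config \<Rightarrow> real" and u
  have E: "E f u = (\<Sum>\<xi>\<in>level N n. pmf (K u \<eta>) \<xi> * f \<xi>)" if "0 \<le> u" for f u
    unfolding E_def by (rule expectation_level[OF level_invariant[OF K A that \<eta>n]])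
  have E1: "(\<Sum>\<xi>\<in>level N n. pmf (K u \<eta>) \<xi>) = 1" if "0 \<le> u" for u
    using E[OF that, of "\<lambda>_. 1"] by (simp add: E_def)
  define k where "k = \<kappa> / (real n + 1)"
  \<comment> \<open>The forward equation is available for a fixed function. Expanding the square
    moves the time dependence into the coefficients of the expectations of \<open>M\<close> and
    \<open>M2\<close>.\<close>
  define g where "g u = exp (- C * (s + u)) * (E M2 u - 2 * m (s + u) * E M u + (m (s + u))\<^sup>2 + k)" for u
  have g: "g u = E (lyapunov C \<kappa> N m (s + u)) u" if "0 \<le> u" for u
  proof -
    have "E (lyapunov C \<kappa> N m (s + u)) u = (\<Sum>\<xi>\<in>level N n. pmf (K u \<eta>) \<xi> *
        (exp (- C * (s + u)) * (M2 \<xi> - 2 * m (s + u) * M \<xi> + (m (s + u))\<^sup>2 + k)))"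
      unfolding E[OF that]
      by (intro sum.cong) (auto simp: lyapunov_def level_def k_def M_def M2_def power2_diff algebra_simps)
    also have "\<dots> = exp (- C * (s + u)) * (E M2 u - 2 * m (s + u) * E M u + ((m (s + u))\<^sup>2 + k) * (\<Sum>\<xi>\<in>level N n. pmf (K u \<eta>) \<xi>))"
      unfolding E[OF that] by (simp add: sum_distrib_left sum_distrib_right sum.distrib sum_subtractf algebra_simps)
    finally show ?thesis using E1[OF that] by (simp add: g_def)
  qed
  have contE: "continuous_on {0..t - s} (E f)" if "bounded (range f)" for f
    using continuous_on_subset[OF semigroup_continuous[OF K A \<eta>n that]] by (auto simp: E_def[abs_def])
  have contm: "continuous_on {0..T} m"
    using ode by (meson DERIV_continuous continuous_on_eq_continuous_within)
  have "g (t - s) \<le> g 0"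
  proof (rule DERIV_nonpos_imp_decreasing_open[of 0 "t - s" g])
    show "0 \<le> t - s" using st by simp
    show "continuous_on {0..t - s} g"
      unfolding g_def using st
      by (intro continuous_intros contE Mb M2b continuous_on_compose2[OF contm]) auto
    fix u assume u: "0 < u" "u < t - s"
    let ?G = "exp (- C * (s + u)) * (E (generator c N M2) u - 2 * (drift c (m (s + u)) * E M u + m (s + u) * E (generator c N M) u)
        + 2 * m (s + u) * drift c (m (s + u))) + - C * exp (- C * (s + u)) * (E M2 u - 2 * m (s + u) * E M u + (m (s + u))\<^sup>2 + k)"
    have su: "s + u \<in> {0<..<T}" using u st by auto
    then have "(m has_real_derivative drift c (m (s + u))) (at (s + u))"
      using ode[of "s + u"] by (simp add: at_within_Icc_at)
    then have dm: "((\<lambda>u. m (s + u)) has_real_derivative drift c (m (s + u))) (at u)"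
      using DERIV_shift[of m _ u s] by (simp add: add.commute)
    have dE: "(E f has_real_derivative E (generator c N f) u) (at u)" if "bounded (range f)" for f
      unfolding E_def by (rule kolmogorov_forward[OF K A \<eta>n that u(1)])
    have "(g has_real_derivative ?G) (at u)"
      unfolding g_def
      by (rule derivative_eq_intros dm dE Mb M2b refl | simp add: algebra_simps power2_eq_square)+
    moreover have "?G \<le> 0"
    proof -
      let ?m = "m (s + u)"
      have mb: "?m \<in> {-1..1}" using m su by auto
      have pt: "generator c N M2 \<xi> - 2 * (drift c ?m * M \<xi> + ?m * generator c N M \<xi>) + 2 * ?m * drift c ?m
          - C * (M2 \<xi> - 2 * ?m * M \<xi> + ?m\<^sup>2 + k) \<le> 0" if \<xi>: "\<xi> \<in> level N n" for \<xi>
      proof (cases "n = 0")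
        \<comment> \<open>Without particles the magnetization is frozen at 0 while \<open>m\<close>
          keeps moving. Then k = \<kappa>, and 2 m drift \<le> 4 b is absorbed by C \<kappa> \<ge> 8
          b.\<close>
        case True
        with \<xi> have "num_particles N \<xi> = 0" by (simp add: level_def)
        then have z: "generator c N M2 \<xi> = 0" "generator c N M \<xi> = 0" "M \<xi> = 0" "M2 \<xi> = 0"
          by (simp_all add: generator_empty M_def M2_def magnetization_def)
        have "?m * drift c ?m \<le> \<bar>?m\<bar> * \<bar>drift c ?m\<bar>" by (metis abs_ge_self abs_mult)
        also have "\<dots> \<le> 1 * (2 * b)"
          using mb drift_bounded[of c b L ?m, OF b L mb mb] by (intro mult_mono) auto
        finally have "?m * drift c ?m \<le> 2 * b" by simp
        moreover have "0 \<le> C * ?m\<^sup>2"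
        proof -
          have "0 \<le> b" using b[of 1 0] by (force simp: spins_def)
          moreover have "0 \<le> L" using L[of 1 0 1] by (simp add: spins_def)
          ultimately have "0 \<le> C" using C(1) by auto
          then show ?thesis by simp
        qed
        moreover have "0 \<le> b" using b[of 1 0] by (force simp: spins_def)
        ultimately show ?thesis using C(2) True by (simp add: z k_def algebra_simps)
      next
        case False
        then have pos: "0 < num_particles N \<xi>" and n: "num_particles N \<xi> = n" using \<xi> by (auto simp: level_def)
        have G1: "generator c N M \<xi> = drift c (M \<xi>)"
          unfolding M_def by (rule generator_magnetization[OF pos])
        have G2: "generator c N M2 \<xi> \<le> 2 * M \<xi> * drift c (M \<xi>) + 4 * b / real n"
          using generator_magnetization_square[OF pos, of c b] b n by (simp add: M_def M2_def)
        have Mr: "M \<xi> \<in> {-1..1}" unfolding M_def by (rule magnetization_bounds)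
        have "(M \<xi> - ?m) * (drift c (M \<xi>) - drift c ?m) \<le> \<bar>M \<xi> - ?m\<bar> * \<bar>drift c (M \<xi>) - drift c ?m\<bar>"
          by (metis abs_ge_self abs_mult)
        also have "\<dots> \<le> \<bar>M \<xi> - ?m\<bar> * ((4 * L + 2 * b) * \<bar>M \<xi> - ?m\<bar>)"
          by (intro mult_left_mono drift_lipschitz b L Mr mb) auto
        also have "\<dots> = (4 * L + 2 * b) * (M \<xi> - ?m)\<^sup>2"
          by (simp only: mult.left_commute[of "\<bar>M \<xi> - ?m\<bar>"] abs_mult_self_eq power2_eq_square)
        finally have "2 * ((M \<xi> - ?m) * (drift c (M \<xi>) - drift c ?m)) \<le> C * (M \<xi> - ?m)\<^sup>2"
          using mult_right_mono[OF C(1) zero_le_power2[of "M \<xi> - ?m"]] unfolding mult.assoc by linarith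
        \<comment> \<open>For n \<ge> 1 one has n + 1 \<le> 2 n; this is the origin of the 8 in the
          condition on C \<kappa>.\<close>
        moreover have "4 * b / real n \<le> C * k"
        proof -
          have "0 \<le> b" using b[of 1 0] by (force simp: spins_def)
          then have "4 * b / real n \<le> 8 * b / (real n + 1)"
            using False mult_left_mono[of 1 "real n" b] by (simp add: field_simps)
          also have "\<dots> \<le> C * \<kappa> / (real n + 1)" using C(2) by (intro divide_right_mono) auto
          finally show ?thesis by (simp add: k_def)
        qed
        moreover have "C * (M2 \<xi> - 2 * ?m * M \<xi> + ?m\<^sup>2 + k) = C * (M \<xi> - ?m)\<^sup>2 + C * k"
          by (simp add: M_def M2_def power2_diff algebra_simps)
        moreover have "2 * M \<xi> * drift c (M \<xi>) - 2 * (drift c ?m * M \<xi> + ?m * drift c (M \<xi>)) + 2 * ?m * drift c ?m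
            = 2 * ((M \<xi> - ?m) * (drift c (M \<xi>) - drift c ?m))" by (simp add: algebra_simps)
        ultimately show ?thesis using G2 unfolding G1 by linarith
      qed
      have u0: "0 \<le> u" using u by simp
      \<comment> \<open>The factors 1 are placeholders for the total mass of the law on the level,
        so that the left side becomes a single weighted sum of the expressions bounded in
        \<open>pt\<close>.\<close>
      have "E (generator c N M2) u - 2 * (drift c ?m * E M u + ?m * E (generator c N M) u) + 2 * ?m * drift c ?m * 1
          - C * (E M2 u - 2 * ?m * E M u + ?m\<^sup>2 * 1 + k * 1) =
        (\<Sum>\<xi>\<in>level N n. pmf (K u \<eta>) \<xi> * (generator c N M2 \<xi> - 2 * (drift c ?m * M \<xi> + ?m * generator c N M \<xi>) + 2 * ?m * drift c ?m
          - C * (M2 \<xi> - 2 * ?m * M \<xi> + ?m\<^sup>2 + k)))"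
        unfolding E[OF u0] E1[OF u0, symmetric]
        by (simp add: sum_distrib_left sum_distrib_right sum.distrib sum_subtractf algebra_simps)
      also have "\<dots> \<le> 0"
        by (intro sum_nonpos mult_nonneg_nonpos pt) auto
      finally have "exp (- C * (s + u)) * (E (generator c N M2) u - 2 * (drift c ?m * E M u + ?m * E (generator c N M) u) + 2 * ?m * drift c ?m
          - C * (E M2 u - 2 * ?m * E M u + ?m\<^sup>2 + k)) \<le> 0"
        by (intro mult_nonneg_nonpos) auto
      then show ?thesis by (simp add: algebra_simps)
    qed
    ultimately show "\<exists>y. (g has_real_derivative y) (at u) \<and> y \<le> 0" by blast
  qed
  moreover have "g 0 = lyapunov C \<kappa> N m s \<eta>"
    using g[of 0] semigroup_zero[OF K \<eta>] by (simp add: E_def)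
  moreover have "g (t - s) = measure_pmf.expectation (K (t - s) \<eta>) (lyapunov C \<kappa> N m t)"
    using g[of "t - s"] st by (simp add: E_def)
  ultimately show ?thesis by simp
qed

section \<open>Maximal inequality along paths\<close>

lemma countable_configs: "countable (configs N)"
proof -
  have "configs N = PiE_dflt (sites N) 0 (\<lambda>_. UNIV)"
    by (auto simp: configs_def PiE_dflt_def)
  also have "\<dots> = (\<lambda>h x. if x \<in> sites N then h x else 0) ` PiE (sites N) (\<lambda>_. UNIV)"
    by (rule dflt_image_PiE[symmetric])
  finally show ?thesis
    by (simp add: countable_PiE)
qed

text \<open>Stopping at the first crossing, written without stopping times: \<open>r\<close> times
  the probability of a crossing up to \<open>k\<close>, plus the expectation of \<open>Z k\<close>
  on the event of no crossing, stays below the initial expectation. The hypothesis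
  \<open>super\<close> is integrated over events, the form in which the Markov property will be
  available.\<close>

lemma (in prob_space) supermartingale_maximal_inequality:
  fixes Z :: "nat \<Rightarrow> 'a \<Rightarrow> real"
  assumes F: "\<And>k. k \<le> n \<Longrightarrow> subalgebra M (F k)"
    and mono: "\<And>k. k < n \<Longrightarrow> sets (F k) \<subseteq> sets (F (Suc k))"
    and meas: "\<And>k. k \<le> n \<Longrightarrow> Z k \<in> borel_measurable (F k)"
    and int: "\<And>k. k \<le> n \<Longrightarrow> integrable M (Z k)"
    and nonneg: "\<And>k \<omega>. k \<le> n \<Longrightarrow> \<omega> \<in> space M \<Longrightarrow> 0 \<le> Z k \<omega>"
    and super: "\<And>k A. k < n \<Longrightarrow> A \<in> sets (F k) \<Longrightarrow>
      (\<integral>\<omega>. indicator A \<omega> * Z (Suc k) \<omega> \<partial>M) \<le> (\<integral>\<omega>. indicator A \<omega> * Z k \<omega> \<partial>M)"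
  shows "r * prob {\<omega> \<in> space M. \<exists>k\<le>n. r \<le> Z k \<omega>} \<le> expectation (Z 0)"
proof -
  \<comment> \<open>\<open>B k\<close> looks only at times before \<open>k\<close>, so
    \<open>B (Suc k)\<close> belongs to \<open>F k\<close> and \<open>super\<close> applies to it in
    the step from \<open>k\<close> to \<open>Suc k\<close>.\<close>
  define B where "B k = {\<omega> \<in> space M. \<forall>j<k. Z j \<omega> < r}" for k
  have sp: "space (F k) = space M" if "k \<le> n" for k
    using F[OF that] by (simp add: subalgebra_def)
  have FM: "sets (F k) \<subseteq> sets M" if "k \<le> n" for k
    using F[OF that] by (simp add: subalgebra_def)
  have lev: "{\<omega> \<in> space M. Z k \<omega> < r} \<in> sets (F k)" if "k \<le> n" for k
    using measurable_sets[OF meas[OF that], of "{..<r}"] sp[OF that]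
    by (simp add: vimage_def Int_def conj_commute)
  have B_Suc: "B (Suc k) = B k \<inter> {\<omega> \<in> space M. Z k \<omega> < r}" for k
    by (auto simp: B_def less_Suc_eq)
  have BF: "k \<le> n \<Longrightarrow> B k \<in> sets (F k) \<and> B (Suc k) \<in> sets (F k)" for k
  proof (induction k)
    case 0
    have "B 0 = space (F 0)" using sp[of 0] by (simp add: B_def)
    then show ?case using lev[of 0] unfolding B_Suc by auto
  next
    case (Suc k)
    then have "B (Suc k) \<in> sets (F (Suc k))" using mono[of k] by auto
    then show ?case using lev[OF Suc.prems] unfolding B_Suc[of "Suc k"] by auto
  qed
  have BM: "B k \<in> sets M" "B (Suc k) \<in> sets M" if "k \<le> n" for k
    using BF[OF that] FM[OF that] by auto
  have int': "integrable M (\<lambda>\<omega>. indicator A \<omega> * Z k \<omega>)" if "A \<in> sets M" "k \<le> n" for A k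
    using integrable_mult_indicator[OF that(1) int[OF that(2)]] by simp
  have split: "r * prob (B k - B (Suc k)) + (\<integral>\<omega>. indicator (B (Suc k)) \<omega> * Z k \<omega> \<partial>M) \<le>
      (\<integral>\<omega>. indicator (B k) \<omega> * Z k \<omega> \<partial>M)" if "k \<le> n" for k
  proof -
    have "r * prob (B k - B (Suc k)) + (\<integral>\<omega>. indicator (B (Suc k)) \<omega> * Z k \<omega> \<partial>M) =
        (\<integral>\<omega>. r * indicator (B k - B (Suc k)) \<omega> + indicator (B (Suc k)) \<omega> * Z k \<omega> \<partial>M)"
      using BM[OF that] int'[OF BM(2)[OF that] that] by (subst Bochner_Integration.integral_add) (auto simp: emeasure_eq_measure)
    also have "\<dots> \<le> (\<integral>\<omega>. indicator (B k) \<omega> * Z k \<omega> \<partial>M)"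
      using BM[OF that] int'[OF BM(2)[OF that] that] int'[OF BM(1)[OF that] that]
      by (intro integral_mono Bochner_Integration.integrable_add)
         (auto simp: emeasure_eq_measure B_Suc split: split_indicator)
    finally show ?thesis .
  qed
  have main: "k \<le> n \<Longrightarrow> r * prob (space M - B (Suc k)) + (\<integral>\<omega>. indicator (B (Suc k)) \<omega> * Z k \<omega> \<partial>M) \<le> expectation (Z 0)" for k
  proof (induction k)
    case 0
    have "B 0 = space M" by (simp add: B_def)
    moreover have "(\<integral>\<omega>. indicator (space M) \<omega> * Z 0 \<omega> \<partial>M) = expectation (Z 0)"
      by (intro Bochner_Integration.integral_cong) auto
    ultimately show ?case using split[of 0] by simp
  next
    case (Suc k)
    have "space M - B (Suc (Suc k)) = (space M - B (Suc k)) \<union> (B (Suc k) - B (Suc (Suc k)))"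
      by (auto simp: B_def)
    moreover have "prob ((space M - B (Suc k)) \<union> (B (Suc k) - B (Suc (Suc k)))) =
        prob (space M - B (Suc k)) + prob (B (Suc k) - B (Suc (Suc k)))"
      using BM[of "Suc k"] Suc.prems by (intro finite_measure_Union) auto
    moreover have "(\<integral>\<omega>. indicator (B (Suc k)) \<omega> * Z (Suc k) \<omega> \<partial>M) \<le> (\<integral>\<omega>. indicator (B (Suc k)) \<omega> * Z k \<omega> \<partial>M)"
      using super[of k "B (Suc k)"] BF[of k] Suc.prems by auto
    ultimately show ?case
      using split[OF Suc.prems] Suc.IH Suc.prems by (simp add: distrib_left)
  qed
  have "{\<omega> \<in> space M. \<exists>k\<le>n. r \<le> Z k \<omega>} = space M - B (Suc n)"
    by (auto simp: B_def less_Suc_eq_le not_less)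
  moreover have "0 \<le> (\<integral>\<omega>. indicator (B (Suc n)) \<omega> * Z n \<omega> \<partial>M)"
    using nonneg by (intro integral_nonneg_AE) auto
  ultimately show ?thesis using main[of n] by simp
qed

section \<open>Path measures: evaluations, past and Markov property\<close>

lemma path_law_space:
  assumes "path_law T c N \<mu> P"
  shows "prob_space P" "space P = cadlag_paths T (configs N)"
  using assms by (auto simp: path_law_def)

lemma cadlag_paths_mem: "\<omega> \<in> cadlag_paths T E \<Longrightarrow> t \<in> {0..T} \<Longrightarrow> \<omega> t \<in> E"
  by (auto simp: cadlag_paths_def)

lemma measurable_evaluation:
  assumes P: "path_law T c N \<mu> P" and t: "t \<in> {0..T}"
  shows "(\<lambda>\<omega>. \<omega> t) \<in> measurable P (count_space (configs N))"
proof -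
  have "(\<lambda>\<omega>. \<omega> t) \<in> measurable (path_algebra T N) (count_space (configs N))"
    unfolding path_algebra_def
    by (intro measurable_restrict_space1 measurable_component_singleton t)
  then show ?thesis
    using P measurable_cong_sets[of P "path_algebra T N" "count_space (configs N)" "count_space (configs N)"] by (auto simp: path_law_def)
qed

lemma past_space: "space (past T N s) = cadlag_paths T (configs N)"
  by (simp add: past_def space_measure_of_conv)

lemma past_sets:
  "sets (past T N s) = sigma_sets (cadlag_paths T (configs N))
     {{\<omega> \<in> cadlag_paths T (configs N). \<omega> u = \<eta>} | u \<eta>. u \<in> {0..s}}"
  unfolding past_def by (rule sets_measure_of) auto

lemma past_mono: "s \<le> t \<Longrightarrow> sets (past T N s) \<subseteq> sets (past T N t)"
  unfolding past_sets by (rule sigma_sets_mono') fastforce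

lemma past_subalgebra:
  assumes P: "path_law T c N \<mu> P" and s: "s \<le> T"
  shows "subalgebra P (past T N s)"
  unfolding subalgebra_def
proof
  note sp = path_law_space(2)[OF P]
  show "space (past T N s) = space P" by (simp add: past_space sp)
  show "sets (past T N s) \<subseteq> sets P"
    unfolding past_sets sp[symmetric]
  proof (intro sets.sigma_sets_subset subsetI)
    fix A assume "A \<in> {{\<omega> \<in> space P. \<omega> u = \<eta>} |u \<eta>. u \<in> {0..s}}"
    then obtain u \<eta> where A: "A = {\<omega> \<in> space P. \<omega> u = \<eta>}" and u: "u \<in> {0..s}" by blast
    show "A \<in> sets P"
    proof (cases "\<eta> \<in> configs N")
      case True
      then show ?thesis
        using measurable_sets[OF measurable_evaluation[OF P, of u], of "{\<eta>}"] u s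
        by (simp add: A vimage_def Int_def conj_commute)
    next
      \<comment> \<open>The generating events of \<open>past\<close> range over all \<eta>; a value
        outside \<open>configs N\<close> is never taken.\<close>
      case False
      then have "A = {}" using u s cadlag_paths_mem by (fastforce simp: A sp)
      then show ?thesis by simp
    qed
  qed
qed

lemma measurable_past_evaluation:
  assumes u: "u \<in> {0..s}" "s \<le> T"
  shows "(\<lambda>\<omega>. \<omega> u) \<in> measurable (past T N s) (count_space (configs N))"
proof (subst measurable_count_space_eq_countable[OF countable_configs], intro conjI ballI)
  show "(\<lambda>\<omega>. \<omega> u) \<in> space (past T N s) \<rightarrow> configs N"
    using u by (auto simp: past_space intro: cadlag_paths_mem)
  fix \<eta> assume "\<eta> \<in> configs N"
  have "(\<lambda>\<omega>. \<omega> u) -` {\<eta>} \<inter> space (past T N s) = {\<omega> \<in> cadlag_paths T (configs N). \<omega> u = \<eta>}"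
    by (auto simp: past_space)
  then show "(\<lambda>\<omega>. \<omega> u) -` {\<eta>} \<inter> space (past T N s) \<in> sets (past T N s)"
    unfolding past_sets using u by (auto intro!: sigma_sets.Basic)
qed

text \<open>Integrating over events of the past replaces the almost sure identity for conditional
  expectations, with exceptional sets depending on the times and on \<open>f\<close>, by an exact
  identity.\<close>

lemma markov_property:
  assumes P: "path_law T c N \<mu> P"
  obtains K where "transition_semigroup N K" "has_generator N K (generator c N)"
    "\<And>s t (f :: config \<Rightarrow> real) A. 0 \<le> s \<Longrightarrow> s \<le> t \<Longrightarrow> t \<le> T \<Longrightarrow> bounded (range f) \<Longrightarrow> A \<in> sets (past T N s) \<Longrightarrow>
      (\<integral>\<omega>. indicator A \<omega> * f (\<omega> t) \<partial>P) = (\<integral>\<omega>. indicator A \<omega> * measure_pmf.expectation (K (t - s) (\<omega> s)) f \<partial>P)"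
proof -
  obtain K where K: "transition_semigroup N K" "has_generator N K (generator c N)"
    "\<And>s t f. 0 \<le> s \<Longrightarrow> s \<le> t \<Longrightarrow> t \<le> T \<Longrightarrow> bounded (range f) \<Longrightarrow>
       AE \<omega> in P. real_cond_exp P (past T N s) (\<lambda>\<omega>. f (\<omega> t)) \<omega> = measure_pmf.expectation (K (t - s) (\<omega> s)) f"
    using P unfolding path_law_def by blast
  interpret prob_space P by (rule path_law_space(1)[OF P])
  show thesis
  proof (rule that[OF K(1,2)])
    fix s t :: real and f :: "config \<Rightarrow> real" and A
    assume st: "0 \<le> s" "s \<le> t" "t \<le> T" and f: "bounded (range f)" and A: "A \<in> sets (past T N s)"
    note sub = past_subalgebra[OF P order_trans[OF st(2,3)]]
    interpret F: finite_measure_subalgebra P "past T N s"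
      by standard (rule sub)
    have meas: "(\<lambda>\<omega>. g (\<omega> u)) \<in> borel_measurable P" if "u \<in> {0..T}" for g :: "config \<Rightarrow> real" and u
      by (rule measurable_compose[OF measurable_evaluation[OF P that]]) simp
    obtain B where B: "\<And>x. \<bar>f x\<bar> \<le> B" using f by (auto simp: bounded_iff)
    have "integrable P (\<lambda>\<omega>. f (\<omega> t))"
      by (rule integrable_const_bound[where B=B]) (use B st in \<open>auto intro!: meas\<close>)
    from F.real_cond_exp_intA[OF this A]
    have "(\<integral>\<omega>. indicator A \<omega> * f (\<omega> t) \<partial>P) = (\<integral>\<omega>. indicator A \<omega> * real_cond_exp P (past T N s) (\<lambda>\<omega>. f (\<omega> t)) \<omega> \<partial>P)"
      by (simp add: set_lebesgue_integral_def)
    also have "\<dots> = (\<integral>\<omega>. indicator A \<omega> * measure_pmf.expectation (K (t - s) (\<omega> s)) f \<partial>P)"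
    proof (rule integral_cong_AE)
      have [measurable]: "A \<in> sets P" using A sub by (auto simp: subalgebra_def)
      have [measurable]: "(\<lambda>\<omega>. measure_pmf.expectation (K (t - s) (\<omega> s)) f) \<in> borel_measurable P"
        using meas[of s "\<lambda>\<eta>. measure_pmf.expectation (K (t - s) \<eta>) f"] st by simp
      show "(\<lambda>\<omega>. indicator A \<omega> * real_cond_exp P (past T N s) (\<lambda>\<omega>. f (\<omega> t)) \<omega>) \<in> borel_measurable P"
        by measurable
      show "(\<lambda>\<omega>. indicator A \<omega> * measure_pmf.expectation (K (t - s) (\<omega> s)) f) \<in> borel_measurable P"
        by measurable
      show "AE \<omega> in P. indicator A \<omega> * real_cond_exp P (past T N s) (\<lambda>\<omega>. f (\<omega> t)) \<omega> =
          indicator A \<omega> * measure_pmf.expectation (K (t - s) (\<omega> s)) f"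
        using K(3)[OF st f] by eventually_elim simp
    qed
    finally show "(\<integral>\<omega>. indicator A \<omega> * f (\<omega> t) \<partial>P) =
      (\<integral>\<omega>. indicator A \<omega> * measure_pmf.expectation (K (t - s) (\<omega> s)) f \<partial>P)" .
  qed
qed


text \<open>A coordinate is a natural number and converges only by becoming constant. Finitely many
  sites are involved, and off the sites every configuration vanishes.\<close>

lemma config_tendsto_eventually_eq:
  fixes f :: "'a \<Rightarrow> config"
  assumes "(f \<longlongrightarrow> l) F" "\<forall>\<^sub>F x in F. f x \<in> configs N" "l \<in> configs N"
  shows "\<forall>\<^sub>F x in F. f x = l"
proof -
  have "\<forall>\<^sub>F x in F. f x v = l v" for v
  proof -
    have "((\<lambda>x. f x v) \<longlongrightarrow> l v) F"
      using continuous_on_tendsto_compose[OF continuous_on_product_coordinates[of v] assms(1)] by simp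
    then show ?thesis by (simp add: tendsto_discrete)
  qed
  then have "\<forall>\<^sub>F x in F. \<forall>v\<in>sites N. f x v = l v"
    by (simp add: eventually_ball_finite)
  with assms(2) show ?thesis
  proof eventually_elim
    case (elim x)
    with assms(3) show ?case by (intro ext) (auto simp: configs_def)
  qed
qed

lemma cadlag_configs_right:
  assumes "\<omega> \<in> cadlag_paths T (configs N)" "t \<in> {0..<T}"
  shows "\<forall>\<^sub>F s in at_right t. \<omega> s = \<omega> t"
proof (rule config_tendsto_eventually_eq)
  show "(\<omega> \<longlongrightarrow> \<omega> t) (at_right t)" "\<omega> t \<in> configs N"
    using assms by (auto simp: cadlag_paths_def)
  have "\<forall>\<^sub>F s in at_right t. s \<in> {t<..<T}"
    using assms(2) eventually_at_right_real[of t T] by simp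
  then show "\<forall>\<^sub>F s in at_right t. \<omega> s \<in> configs N"
    by eventually_elim (use assms in \<open>auto simp: cadlag_paths_def PiE_def Pi_def\<close>)
qed

lemma cadlag_configs_left:
  assumes "\<omega> \<in> cadlag_paths T (configs N)" "t \<in> {0<..T}"
  shows "\<exists>l\<in>configs N. \<forall>\<^sub>F s in at_left t. \<omega> s = l"
proof -
  obtain l where l: "l \<in> configs N" "(\<omega> \<longlongrightarrow> l) (at_left t)"
    using assms unfolding cadlag_paths_def by blast
  have "\<forall>\<^sub>F s in at_left t. s \<in> {0<..<t}"
    using assms(2) eventually_at_left_real[of 0 t] by simp
  then have "\<forall>\<^sub>F s in at_left t. \<omega> s \<in> configs N"
    by eventually_elim (use assms in \<open>auto simp: cadlag_paths_def PiE_def Pi_def\<close>)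
  from config_tendsto_eventually_eq[OF l(2) this l(1)] l(1) show ?thesis by blast
qed

text \<open>\<open>path_law\<close> merely asserts that a semigroup with the given generator exists.
  Hence \<open>super\<close> is required of every such semigroup, and the one belonging to the path
  measure is chosen inside the proof.\<close>

lemma path_grid_maximal_inequality:
  fixes X :: "real \<Rightarrow> config \<Rightarrow> real"
  assumes P: "path_law T c N \<mu> P" and T: "0 < T"
    and X: "\<And>t \<eta>. t \<in> {0..T} \<Longrightarrow> 0 \<le> X t \<eta> \<and> X t \<eta> \<le> B"
    and super: "\<And>K s t \<eta>. transition_semigroup N K \<Longrightarrow> has_generator N K (generator c N) \<Longrightarrow>
      0 \<le> s \<Longrightarrow> s \<le> t \<Longrightarrow> t \<le> T \<Longrightarrow> \<eta> \<in> configs N \<Longrightarrow> measure_pmf.expectation (K (t - s) \<eta>) (X t) \<le> X s \<eta>"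
    and n: "0 < n"
  shows "r * measure P {\<omega> \<in> space P. \<exists>j\<le>n. r \<le> X (T * real j / real n) (\<omega> (T * real j / real n))} \<le>
    measure_pmf.expectation \<mu> (X 0)"
proof -
  interpret prob_space P by (rule path_law_space(1)[OF P])
  note sp = path_law_space(2)[OF P]
  define \<tau> where "\<tau> j = T * real j / real n" for j
  have \<tau>: "\<tau> j \<in> {0..T}" if "j \<le> n" for j
    using that n T by (auto simp: \<tau>_def field_simps)
  have \<tau>mono: "\<tau> j \<le> \<tau> (Suc j)" for j
    using n T by (auto simp: \<tau>_def field_simps)
  obtain K where K: "transition_semigroup N K" "has_generator N K (generator c N)"
    "\<And>s t (f :: config \<Rightarrow> real) A. 0 \<le> s \<Longrightarrow> s \<le> t \<Longrightarrow> t \<le> T \<Longrightarrow> bounded (range f) \<Longrightarrow> A \<in> sets (past T N s) \<Longrightarrow>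
      (\<integral>\<omega>. indicator A \<omega> * f (\<omega> t) \<partial>P) = (\<integral>\<omega>. indicator A \<omega> * measure_pmf.expectation (K (t - s) (\<omega> s)) f \<partial>P)"
    by (rule markov_property[OF P]) (rule that)
  have meas: "(\<lambda>\<omega>. g (\<omega> u)) \<in> borel_measurable P" if "u \<in> {0..T}" for g :: "config \<Rightarrow> real" and u
    by (rule measurable_compose[OF measurable_evaluation[OF P that]]) simp
  have int: "integrable P (\<lambda>\<omega>. X u (\<omega> u))" if "u \<in> {0..T}" for u
  proof (rule integrable_const_bound[where B=B])
    show "AE \<omega> in P. norm (X u (\<omega> u)) \<le> B"
      using X[OF that] by (intro AE_I2) (simp add: abs_of_nonneg)
  qed (rule meas[OF that])
  have "r * prob {\<omega> \<in> space P. \<exists>j\<le>n. r \<le> X (\<tau> j) (\<omega> (\<tau> j))} \<le> expectation (\<lambda>\<omega>. X (\<tau> 0) (\<omega> (\<tau> 0)))"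
  proof (rule supermartingale_maximal_inequality[where F="\<lambda>j. past T N (\<tau> j)" and Z="\<lambda>j \<omega>. X (\<tau> j) (\<omega> (\<tau> j))"])
    fix k assume k: "k \<le> n"
    show "subalgebra P (past T N (\<tau> k))"
      using \<tau>[OF k] by (intro past_subalgebra[OF P]) auto
    show "(\<lambda>\<omega>. X (\<tau> k) (\<omega> (\<tau> k))) \<in> borel_measurable (past T N (\<tau> k))"
      using \<tau>[OF k] by (intro measurable_compose[OF measurable_past_evaluation[of "\<tau> k" "\<tau> k"]]) auto
    show "integrable P (\<lambda>\<omega>. X (\<tau> k) (\<omega> (\<tau> k)))" by (rule int[OF \<tau>[OF k]])
    show "0 \<le> X (\<tau> k) (\<omega> (\<tau> k))" for \<omega> using X[OF \<tau>[OF k]] by blast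
  next
    fix k assume k: "k < n"
    show "sets (past T N (\<tau> k)) \<subseteq> sets (past T N (\<tau> (Suc k)))" by (rule past_mono[OF \<tau>mono])
    fix A assume A: "A \<in> sets (past T N (\<tau> k))"
    have k1: "\<tau> k \<in> {0..T}" "\<tau> (Suc k) \<in> {0..T}" using \<tau>[of k] \<tau>[of "Suc k"] k by auto
    have AP: "A \<in> sets P"
      using A past_subalgebra[OF P, of "\<tau> k"] k1 by (auto simp: subalgebra_def)
    have Xb: "\<bar>X (\<tau> (Suc k)) \<eta>\<bar> \<le> B" for \<eta>
      using X[OF k1(2), of \<eta>] by simp
    then have "bounded (range (X (\<tau> (Suc k))))"
      by (auto simp: bounded_iff)
    then have "(\<integral>\<omega>. indicator A \<omega> * X (\<tau> (Suc k)) (\<omega> (\<tau> (Suc k))) \<partial>P) =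
        (\<integral>\<omega>. indicator A \<omega> * measure_pmf.expectation (K (\<tau> (Suc k) - \<tau> k) (\<omega> (\<tau> k))) (X (\<tau> (Suc k))) \<partial>P)"
      using k1 by (intro K(3) \<tau>mono A) auto
    also have "\<dots> \<le> (\<integral>\<omega>. indicator A \<omega> * X (\<tau> k) (\<omega> (\<tau> k)) \<partial>P)"
    proof (rule integral_mono)
      have "integrable P (\<lambda>\<omega>. measure_pmf.expectation (K (\<tau> (Suc k) - \<tau> k) (\<omega> (\<tau> k))) (X (\<tau> (Suc k))))"
      proof (rule integrable_const_bound[where B=B])
        show "(\<lambda>\<omega>. measure_pmf.expectation (K (\<tau> (Suc k) - \<tau> k) (\<omega> (\<tau> k))) (X (\<tau> (Suc k)))) \<in> borel_measurable P"
          by (rule meas[OF k1(1), of "\<lambda>\<eta>. measure_pmf.expectation (K (\<tau> (Suc k) - \<tau> k) \<eta>) (X (\<tau> (Suc k)))"])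
        show "AE \<omega> in P. norm (measure_pmf.expectation (K (\<tau> (Suc k) - \<tau> k) (\<omega> (\<tau> k))) (X (\<tau> (Suc k)))) \<le> B"
          unfolding real_norm_def by (intro AE_I2 expectation_bounded(2) Xb)
      qed
      from integrable_mult_indicator[OF AP this]
      show "integrable P (\<lambda>\<omega>. indicator A \<omega> * measure_pmf.expectation (K (\<tau> (Suc k) - \<tau> k) (\<omega> (\<tau> k))) (X (\<tau> (Suc k))))"
        by simp
      show "integrable P (\<lambda>\<omega>. indicator A \<omega> * X (\<tau> k) (\<omega> (\<tau> k)))"
        using integrable_mult_indicator[OF AP int[OF k1(1)]] by simp
      fix \<omega> assume \<omega>: "\<omega> \<in> space P"
      have "measure_pmf.expectation (K (\<tau> (Suc k) - \<tau> k) (\<omega> (\<tau> k))) (X (\<tau> (Suc k))) \<le> X (\<tau> k) (\<omega> (\<tau> k))"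
        using \<omega> k1 cadlag_paths_mem[OF _ k1(1), of \<omega>] by (intro super K \<tau>mono) (auto simp: sp)
      then show "indicator A \<omega> * measure_pmf.expectation (K (\<tau> (Suc k) - \<tau> k) (\<omega> (\<tau> k))) (X (\<tau> (Suc k))) \<le>
          indicator A \<omega> * X (\<tau> k) (\<omega> (\<tau> k))"
        by (intro mult_left_mono) auto
    qed
    finally show "(\<integral>\<omega>. indicator A \<omega> * X (\<tau> (Suc k)) (\<omega> (\<tau> (Suc k))) \<partial>P) \<le> (\<integral>\<omega>. indicator A \<omega> * X (\<tau> k) (\<omega> (\<tau> k)) \<partial>P)" .
  qed
  also have "expectation (\<lambda>\<omega>. X (\<tau> 0) (\<omega> (\<tau> 0))) = measure_pmf.expectation \<mu> (X 0)"
  proof -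
    have d: "distr P (count_space UNIV) (\<lambda>\<omega>. \<omega> 0) = measure_pmf \<mu>" using P by (simp add: path_law_def)
    have "(\<lambda>\<omega>. \<omega> 0) \<in> measurable P (count_space (configs N))"
      by (rule measurable_evaluation[OF P]) (use T in auto)
    from measurable_compose[OF this, of id "count_space UNIV"]
    have "(\<lambda>\<omega>. \<omega> 0) \<in> measurable P (count_space UNIV)" by simp
    then have "measure_pmf.expectation \<mu> (X 0) = expectation (\<lambda>\<omega>. X 0 (\<omega> 0))"
      unfolding d[symmetric] by (rule integral_distr) simp
    then show ?thesis by (simp add: \<tau>_def)
  qed
  finally show ?thesis by (simp add: \<tau>_def)
qed

text \<open>Dyadic grids are nested, so the crossing events increase and their probabilities
  converge to that of the union. Off the union the bound passes from dyadic times to every time,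
  because a path stays in its configuration for a while after each time and \<open>X\<close> is
  continuous in its time argument.\<close>

lemma path_maximal_inequality:
  fixes X :: "real \<Rightarrow> config \<Rightarrow> real"
  assumes P: "path_law T c N \<mu> P" and T: "0 < T"
    and X: "\<And>t \<eta>. t \<in> {0..T} \<Longrightarrow> 0 \<le> X t \<eta> \<and> X t \<eta> \<le> B"
    and super: "\<And>K s t \<eta>. transition_semigroup N K \<Longrightarrow> has_generator N K (generator c N) \<Longrightarrow>
      0 \<le> s \<Longrightarrow> s \<le> t \<Longrightarrow> t \<le> T \<Longrightarrow> \<eta> \<in> configs N \<Longrightarrow> measure_pmf.expectation (K (t - s) \<eta>) (X t) \<le> X s \<eta>"
    and cont: "\<And>\<eta>. continuous_on {0..T} (\<lambda>t. X t \<eta>)"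
  obtains U where "U \<in> sets P" "r * measure P U \<le> measure_pmf.expectation \<mu> (X 0)"
    "\<And>\<omega> t. \<omega> \<in> space P - U \<Longrightarrow> t \<in> {0..T} \<Longrightarrow> X t (\<omega> t) \<le> r"
proof -
  interpret prob_space P by (rule path_law_space(1)[OF P])
  note sp = path_law_space(2)[OF P]
  define \<tau> where "\<tau> n j = T * real j / 2 ^ n" for n j :: nat
  define U where "U n = {\<omega> \<in> space P. \<exists>j\<le>2 ^ n. r \<le> X (\<tau> n j) (\<omega> (\<tau> n j))}" for n :: nat
  have \<tau>: "\<tau> n j \<in> {0..T}" if "j \<le> 2 ^ n" for n j
  proof -
    have "real j \<le> 2 ^ n" using that by (metis of_nat_le_iff of_nat_numeral of_nat_power)
    then show ?thesis using T by (simp add: \<tau>_def field_simps)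
  qed
  have Um: "U n \<in> sets P" for n
  proof -
    have "{\<omega> \<in> space P. r \<le> X (\<tau> n j) (\<omega> (\<tau> n j))} \<in> sets P" if "j \<le> 2 ^ n" for j
    proof -
      have "(\<lambda>\<omega>. X (\<tau> n j) (\<omega> (\<tau> n j))) \<in> borel_measurable P"
        by (rule measurable_compose[OF measurable_evaluation[OF P \<tau>[OF that]]]) simp
      then show ?thesis by measurable
    qed
    moreover have "U n = (\<Union>j\<in>{..2 ^ n}. {\<omega> \<in> space P. r \<le> X (\<tau> n j) (\<omega> (\<tau> n j))})"
      by (auto simp: U_def)
    ultimately show ?thesis by auto
  qed
  have inc: "incseq U"
  proof (rule incseq_SucI)
    fix n
    have "\<tau> n j = \<tau> (Suc n) (2 * j)" for j by (simp add: \<tau>_def)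
    then show "U n \<subseteq> U (Suc n)" unfolding U_def
      by clarsimp (metis mult_le_mono2 power_Suc)
  qed
  have lim: "(\<lambda>n. r * prob (U n)) \<longlonglongrightarrow> r * prob (\<Union>n. U n)"
    by (intro tendsto_mult_left finite_Lim_measure_incseq inc) (use Um in auto)
  show thesis
  proof (rule that[of "\<Union>n. U n"])
    show "(\<Union>n. U n) \<in> sets P" using Um by auto
    have "r * prob (U n) \<le> measure_pmf.expectation \<mu> (X 0)" for n
    proof -
      have "r * prob {\<omega> \<in> space P. \<exists>j\<le>2 ^ n. r \<le> X (T * real j / real (2 ^ n)) (\<omega> (T * real j / real (2 ^ n)))}
          \<le> measure_pmf.expectation \<mu> (X 0)"
        by (rule path_grid_maximal_inequality[OF P T], rule X, assumption, rule super, assumption+, simp)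
      then show ?thesis by (simp add: U_def \<tau>_def)
    qed
    with lim show "r * prob (\<Union>n. U n) \<le> measure_pmf.expectation \<mu> (X 0)"
      by (intro LIMSEQ_le_const2[OF lim]) auto
  next
    fix \<omega> t assume \<omega>: "\<omega> \<in> space P - (\<Union>n. U n)" and t: "t \<in> {0..T}"
    have grid: "X (\<tau> n j) (\<omega> (\<tau> n j)) \<le> r" if "j \<le> 2 ^ n" for n j
      using \<omega> that by (force simp: U_def)
    show "X t (\<omega> t) \<le> r"
    proof (cases "t = T")
      case True
      \<comment> \<open>The final time cannot be approached from the right, but it belongs to the
        coarsest grid.\<close>
      then show ?thesis using grid[of 1 0] by (simp add: \<tau>_def)
    next
      case False
      with t have tT: "t \<in> {0..<T}" by auto
      \<comment> \<open>First dyadic index strictly to the right of \<open>t\<close>: the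
        \<open>+ 1\<close> makes the inequality strict, and t < T keeps the index inside the
        grid.\<close>
      define j where "j n = nat \<lfloor>t * 2 ^ n / T\<rfloor> + 1" for n :: nat
      have rj: "real (j n) = of_int \<lfloor>t * 2 ^ n / T\<rfloor> + 1" for n
        using t T by (simp add: j_def of_nat_nat zero_le_divide_iff zero_le_mult_iff)
      have j1: "j n \<le> 2 ^ n" for n
      proof -
        have "t * 2 ^ n / T < 2 ^ n" using tT T by (simp add: field_simps)
        then have "\<lfloor>t * 2 ^ n / T\<rfloor> < 2 ^ n" by (simp add: floor_less_iff)
        then show ?thesis using t T by (simp add: j_def nat_less_eq_zless Suc_le_eq nat_less_iff)
      qed
      have low: "t < \<tau> n (j n)" for n
      proof -
        have "t * 2 ^ n / T < real (j n)" unfolding rj by linarith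
        then show ?thesis using T by (simp add: \<tau>_def field_simps)
      qed
      have up: "\<tau> n (j n) \<le> t + T * (1 / 2) ^ n" for n
      proof -
        have "real (j n) \<le> t * 2 ^ n / T + 1" unfolding rj by linarith
        then have "T * real (j n) \<le> t * 2 ^ n + T" using T by (simp add: field_simps)
        then show ?thesis by (simp add: \<tau>_def field_simps power_one_over)
      qed
      have "(\<lambda>n. t + T * (1 / 2) ^ n) \<longlonglongrightarrow> t + T * 0"
        by (intro tendsto_intros LIMSEQ_power_zero) auto
      then have lim: "(\<lambda>n. \<tau> n (j n)) \<longlonglongrightarrow> t"
        using low[THEN less_imp_le] up by (intro real_tendsto_sandwich[OF _ _ tendsto_const, of t "\<lambda>n. \<tau> n (j n)" sequentially]) auto
      then have "filterlim (\<lambda>n. \<tau> n (j n)) (at_right t) sequentially"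
        using low by (auto simp: filterlim_at intro!: always_eventually)
      moreover have "\<forall>\<^sub>F s in at_right t. \<omega> s = \<omega> t"
        using \<omega> by (intro cadlag_configs_right[OF _ tT]) (auto simp: sp)
      ultimately have "\<forall>\<^sub>F n in sequentially. \<omega> (\<tau> n (j n)) = \<omega> t"
        by (rule eventually_compose_filterlim[rotated])
      then have "\<forall>\<^sub>F n in sequentially. X (\<tau> n (j n)) (\<omega> t) \<le> r"
        by eventually_elim (metis grid j1)
      moreover have "(\<lambda>n. X (\<tau> n (j n)) (\<omega> t)) \<longlonglongrightarrow> X t (\<omega> t)"
        using continuous_on_tendsto_compose[OF cont lim t] \<tau>[OF j1] by simp
      ultimately show ?thesis
        by (intro tendsto_upperbound[of _ "X t (\<omega> t)" sequentially]) auto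
    qed
  qed
qed

section \<open>Discretisation in the Skorokhod metric\<close>

definition grid_floor :: "real \<Rightarrow> nat \<Rightarrow> real \<Rightarrow> real" where
  "grid_floor T n t = T * of_int \<lfloor>t * real n / T\<rfloor> / real n"

definition grid_ceil :: "real \<Rightarrow> nat \<Rightarrow> real \<Rightarrow> real" where
  "grid_ceil T n t = T * of_int \<lceil>t * real n / T\<rceil> / real n"

text \<open>\<open>grid_ceil\<close> and \<open>grid_floor\<close> are adjoint: a time is at or
  after \<open>grid_ceil T n t\<close> exactly when its \<open>grid_floor\<close> is at or after
  \<open>t\<close>. This keeps intervals of constancy intact under discretisation.\<close>

lemma
  assumes "0 < T" "0 < n"
  shows grid_ceil_ge: "t \<le> grid_ceil T n t"
    and grid_ceil_le: "grid_ceil T n t \<le> t + T / real n"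
    and grid_floor_ge: "grid_ceil T n t \<le> s \<Longrightarrow> t \<le> grid_floor T n s"
    and grid_floor_less: "s < grid_ceil T n t \<Longrightarrow> grid_floor T n s < t"
    and grid_floor_ceil: "grid_floor T n (grid_ceil T n t) = grid_ceil T n t"
    and grid_ceil_T: "grid_ceil T n T = T"
    and grid_ceil_0: "grid_ceil T n 0 = 0"
proof -
  note [simp] = grid_ceil_def grid_floor_def
  have le: "x \<le> T * of_int i / real n \<longleftrightarrow> x * real n / T \<le> of_int i"
    and lt: "T * of_int i / real n < x \<longleftrightarrow> of_int i < x * real n / T"
    and le': "T * of_int i / real n \<le> x \<longleftrightarrow> of_int i \<le> x * real n / T"
    and lt': "x < T * of_int i / real n \<longleftrightarrow> x * real n / T < of_int i" for x i
    using assms by (simp_all add: field_simps)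
  show "t \<le> grid_ceil T n t" by (simp add: le)
  have "of_int \<lceil>t * real n / T\<rceil> \<le> (t + T / real n) * real n / T"
  proof -
    have "(t + T / real n) * real n / T = t * real n / T + 1" using assms by (simp add: field_simps)
    then show ?thesis by linarith
  qed
  then show "grid_ceil T n t \<le> t + T / real n" by (simp only: grid_ceil_def le')
  show "t \<le> grid_floor T n s" if "grid_ceil T n t \<le> s"
  proof -
    have "\<lceil>t * real n / T\<rceil> \<le> \<lfloor>s * real n / T\<rfloor>" using that by (simp add: le' le_floor_iff)
    then show ?thesis by (simp add: le ceiling_le_iff)
  qed
  show "grid_floor T n s < t" if "s < grid_ceil T n t"
  proof -
    have "\<lfloor>s * real n / T\<rfloor> < \<lceil>t * real n / T\<rceil>" using that by (simp add: lt' floor_less_iff)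
    then show ?thesis by (simp add: lt less_ceiling_iff)
  qed
  show "grid_floor T n (grid_ceil T n t) = grid_ceil T n t" using assms by simp
  show "grid_ceil T n T = T" "grid_ceil T n 0 = 0" using assms by simp_all
qed

lemma grid_floor_mem:
  assumes "0 < T" "0 < n" "t \<in> {0..T}"
  shows "grid_floor T n t \<in> {0..T}"
proof -
  have "0 \<le> t * real n / T" "t * real n / T \<le> real n"
    using assms by (simp_all add: field_simps)
  then have "0 \<le> \<lfloor>t * real n / T\<rfloor>" "real_of_int \<lfloor>t * real n / T\<rfloor> \<le> real n"
    by linarith+
  then show ?thesis
    using assms by (simp add: grid_floor_def pos_divide_le_eq)
qed

text \<open>Local constancy on either side of each time, rather than a finite list of jumps: this is
  what cadlag paths in a discrete space provide, and what an argument by bisection consumes.\<close>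

definition step_path :: "real \<Rightarrow> 'a set \<Rightarrow> (real \<Rightarrow> 'a) \<Rightarrow> bool" where
  "step_path T E f \<longleftrightarrow> (\<forall>t\<in>{0..T}. f t \<in> E) \<and>
     (\<forall>t\<in>{0..<T}. \<forall>\<^sub>F s in at_right t. f s = f t) \<and>
     (\<forall>t\<in>{0<..T}. \<exists>l\<in>E. \<forall>\<^sub>F s in at_left t. f s = l)"

lemma step_path_cadlag:
  assumes "step_path T E f"
  shows "restrict f {0..T} \<in> cadlag_paths T E"
  unfolding cadlag_paths_def
proof (intro CollectI conjI ballI)
  show "restrict f {0..T} \<in> {0..T} \<rightarrow>\<^sub>E E" using assms by (auto simp: step_path_def)
  fix t assume t: "t \<in> {0..<T}"
  have "\<forall>\<^sub>F s in at_right t. s \<in> {t<..<T}" using t eventually_at_right_real[of t T] by simp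
  moreover have "\<forall>\<^sub>F s in at_right t. f s = f t" using assms t by (simp add: step_path_def)
  ultimately have "\<forall>\<^sub>F s in at_right t. restrict f {0..T} s = restrict f {0..T} t"
    by eventually_elim (use t in auto)
  then show "(restrict f {0..T} \<longlongrightarrow> restrict f {0..T} t) (at_right t)" by (rule tendsto_eventually)
next
  fix t assume t: "t \<in> {0<..T}"
  have in0: "\<forall>\<^sub>F s in at_left t. s \<in> {0<..<t}" using t eventually_at_left_real[of 0 t] by simp
  obtain l where l: "l \<in> E" "\<forall>\<^sub>F s in at_left t. f s = l"
    using assms t unfolding step_path_def by blast
  from in0 l(2) have "\<forall>\<^sub>F s in at_left t. restrict f {0..T} s = l"
    by eventually_elim (use t in auto)
  then show "\<exists>l\<in>E. (restrict f {0..T} \<longlongrightarrow> l) (at_left t)" using l(1) tendsto_eventually by blast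
qed

lemma step_path_grid_floor:
  assumes f: "step_path T E f" and T: "0 < T" "0 < n"
  shows "step_path T E (\<lambda>t. f (grid_floor T n t))"
  unfolding step_path_def
proof (intro conjI ballI)
  fix t assume "t \<in> {0..T}"
  then show "f (grid_floor T n t) \<in> E" using grid_floor_mem[OF T] f by (simp add: step_path_def)
next
  fix t assume t: "t \<in> {0..<T}"
  define u where "u = T * (of_int \<lfloor>t * real n / T\<rfloor> + 1) / real n"
  have "t < u"
  proof -
    have "t * real n / T < of_int \<lfloor>t * real n / T\<rfloor> + 1" by linarith
    then show ?thesis using T by (simp add: u_def field_simps)
  qed
  then have "\<forall>\<^sub>F s in at_right t. s \<in> {t<..<u}" by (rule eventually_at_right_real)
  then show "\<forall>\<^sub>F s in at_right t. f (grid_floor T n s) = f (grid_floor T n t)"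
  proof eventually_elim
    case (elim s)
    have "\<lfloor>s * real n / T\<rfloor> = \<lfloor>t * real n / T\<rfloor>"
    proof (rule floor_unique)
      have "t * real n / T \<le> s * real n / T" using elim T by (simp add: divide_right_mono)
      then show "of_int \<lfloor>t * real n / T\<rfloor> \<le> s * real n / T" by linarith
      show "s * real n / T < of_int \<lfloor>t * real n / T\<rfloor> + 1" using elim T by (simp add: u_def field_simps)
    qed
    then show ?case by (simp add: grid_floor_def)
  qed
next
  fix t assume t: "t \<in> {0<..T}"
  \<comment> \<open>Last grid point strictly before \<open>t\<close>. Immediately to the left of
    \<open>t\<close> the floor equals the ceiling at \<open>t\<close> minus 1, also when
    \<open>t\<close> lies on the grid.\<close>
  define u where "u = T * (of_int \<lceil>t * real n / T\<rceil> - 1) / real n"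
  have "u < t"
  proof -
    have "of_int \<lceil>t * real n / T\<rceil> - 1 < t * real n / T" by linarith
    then show ?thesis using T by (simp add: u_def field_simps)
  qed
  then have "\<forall>\<^sub>F s in at_left t. s \<in> {u<..<t}" by (rule eventually_at_left_real)
  then have "\<forall>\<^sub>F s in at_left t. f (grid_floor T n s) = f u"
  proof eventually_elim
    case (elim s)
    have "\<lfloor>s * real n / T\<rfloor> = \<lceil>t * real n / T\<rceil> - 1"
    proof (rule floor_unique)
      show "of_int (\<lceil>t * real n / T\<rceil> - 1) \<le> s * real n / T" using elim T by (simp add: u_def field_simps)
      have "s * real n / T < t * real n / T" using elim T by (simp add: divide_strict_right_mono)
      then show "s * real n / T < of_int (\<lceil>t * real n / T\<rceil> - 1) + 1" using le_of_int_ceiling[of "t * real n / T"] by (simp del: le_of_int_ceiling)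
    qed
    then show ?case by (simp add: grid_floor_def u_def)
  qed
  moreover have "f u \<in> E"
  proof -
    have "0 < t * real n / T" using t T by simp
    then have "1 \<le> \<lceil>t * real n / T\<rceil>" by linarith
    then have "0 \<le> u" using T by (simp add: u_def)
    with \<open>u < t\<close> t f show ?thesis by (simp add: step_path_def)
  qed
  ultimately show "\<exists>l\<in>E. \<forall>\<^sub>F s in at_left t. f (grid_floor T n s) = l" by blast
qed

text \<open>A jump at time \<open>t\<close> of a step path appears in its discretisation at the next grid point; a time
  change moving each jump there is glued from affine pieces by bisection.\<close>

definition grid_time_change :: "real \<Rightarrow> (real \<Rightarrow> 'a) \<Rightarrow> nat \<Rightarrow> real \<Rightarrow> real \<Rightarrow> bool" where
  "grid_time_change T f n a b \<longleftrightarrow> (\<exists>\<theta>. strict_mono_on {a..b} \<theta> \<and>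
     \<theta> ` {a..b} = {grid_ceil T n a..grid_ceil T n b} \<and> \<theta> a = grid_ceil T n a \<and> \<theta> b = grid_ceil T n b \<and>
     (\<forall>t\<in>{a..b}. \<bar>\<theta> t - t\<bar> \<le> T / real n \<and> f (grid_floor T n (\<theta> t)) = f t))"

lemma grid_time_change_trans:
  assumes "grid_time_change T f n a b" "grid_time_change T f n b c" "a \<le> b" "b \<le> c"
  shows "grid_time_change T f n a c"
proof -
  from assms(1) obtain \<theta> where \<theta>: "strict_mono_on {a..b} \<theta>" "\<theta> ` {a..b} = {grid_ceil T n a..grid_ceil T n b}"
    "\<theta> a = grid_ceil T n a" "\<theta> b = grid_ceil T n b"
    "\<And>t. t \<in> {a..b} \<Longrightarrow> \<bar>\<theta> t - t\<bar> \<le> T / real n \<and> f (grid_floor T n (\<theta> t)) = f t"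
    unfolding grid_time_change_def by blast
  from assms(2) obtain \<kappa> where \<kappa>: "strict_mono_on {b..c} \<kappa>" "\<kappa> ` {b..c} = {grid_ceil T n b..grid_ceil T n c}"
    "\<kappa> b = grid_ceil T n b" "\<kappa> c = grid_ceil T n c"
    "\<And>t. t \<in> {b..c} \<Longrightarrow> \<bar>\<kappa> t - t\<bar> \<le> T / real n \<and> f (grid_floor T n (\<kappa> t)) = f t"
    unfolding grid_time_change_def by blast
  define \<psi> where "\<psi> t = (if t \<le> b then \<theta> t else \<kappa> t)" for t
  have \<psi>2: "\<psi> t = \<kappa> t" if "t \<ge> b" for t using that \<theta>(4) \<kappa>(3) by (auto simp: \<psi>_def)
  have le: "\<theta> t \<le> grid_ceil T n b" if "t \<in> {a..b}" for t using \<theta>(2) that by fastforce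
  have sm: "strict_mono_on {a..c} \<psi>"
  proof (rule strict_mono_onI)
    fix s t assume st: "s \<in> {a..c}" "t \<in> {a..c}" "s < t"
    consider "t \<le> b" | "b \<le> s" | "s < b" "b < t" by linarith
    then show "\<psi> s < \<psi> t"
    proof cases
      case 1
      then show ?thesis using st \<theta>(1) by (auto simp: \<psi>_def strict_mono_on_def)
    next
      case 2
      then show ?thesis using st \<kappa>(1) by (auto simp: \<psi>2 strict_mono_on_def)
    next
      case 3
      have "\<kappa> b < \<kappa> t" using \<kappa>(1) 3 st by (auto simp: strict_mono_on_def)
      with le[of s] 3 st \<kappa>(3) show ?thesis by (simp add: \<psi>_def)
    qed
  qed
  have "\<psi> ` {a..c} = \<psi> ` {a..b} \<union> \<psi> ` {b..c}"
    using assms(3,4) by (simp add: image_Un[symmetric] ivl_disj_un_two_touch(4))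
  also have "\<psi> ` {a..b} = \<theta> ` {a..b}" by (rule image_cong) (auto simp: \<psi>_def)
  also have "\<psi> ` {b..c} = \<kappa> ` {b..c}" by (rule image_cong) (auto simp: \<psi>2)
  also have "\<theta> ` {a..b} \<union> \<kappa> ` {b..c} = {grid_ceil T n a..grid_ceil T n c}"
  proof -
    have "a \<in> {a..b}" "c \<in> {b..c}" using assms(3,4) by auto
    then have "\<theta> a \<in> \<theta> ` {a..b}" "\<kappa> c \<in> \<kappa> ` {b..c}" by blast+
    then show ?thesis unfolding \<theta>(2) \<kappa>(2) \<theta>(3) \<kappa>(4) by (simp add: ivl_disj_un_two_touch(4))
  qed
  finally have im: "\<psi> ` {a..c} = {grid_ceil T n a..grid_ceil T n c}" .
  have "\<bar>\<psi> t - t\<bar> \<le> T / real n \<and> f (grid_floor T n (\<psi> t)) = f t" if "t \<in> {a..c}" for t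
    using \<theta>(5)[of t] \<kappa>(5)[of t] that by (auto simp: \<psi>_def)
  moreover have "\<psi> a = grid_ceil T n a" "\<psi> c = grid_ceil T n c"
    using assms(3,4) \<theta>(3) \<kappa>(4) \<psi>2[of c] by (auto simp: \<psi>_def)
  ultimately show ?thesis
    unfolding grid_time_change_def using sm im by blast
qed

text \<open>The affine map onto the interval between the two rounded end points works: before
  reaching the right end its values are rounded down into {a..<b}, where \<open>f\<close> is
  constant. The right end point may carry a jump and is treated by the last hypothesis.\<close>

lemma grid_time_change_constant:
  assumes T: "0 < T" "0 < n" and ab: "a \<le> b" "a < b \<Longrightarrow> grid_ceil T n a < grid_ceil T n b"
    and const: "\<And>s. s \<in> {a..<b} \<Longrightarrow> f s = y" and b: "f (grid_ceil T n b) = f b"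
  shows "grid_time_change T f n a b"
proof (cases "a = b")
  case True
  have "\<bar>grid_ceil T n b - b\<bar> \<le> T / real n"
    using grid_ceil_ge[OF T, of b] grid_ceil_le[OF T, of b] by simp
  then show ?thesis
    unfolding grid_time_change_def using True b
    by (intro exI[of _ "\<lambda>_. grid_ceil T n b"]) (auto simp: strict_mono_on_def grid_floor_ceil[OF T])
next
  case False
  with ab have lt: "a < b" and lt': "grid_ceil T n a < grid_ceil T n b" by auto
  define A B where "A = grid_ceil T n a" and "B = grid_ceil T n b"
  define \<theta> where "\<theta> t = A + (B - A) * ((t - a) / (b - a))" for t
  have AB: "A < B" using lt' by (simp add: A_def B_def)
  have ends: "\<theta> a = A" "\<theta> b = B" using lt by (simp_all add: \<theta>_def)
  have sm: "\<theta> s < \<theta> t" if "s < t" for s t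
    using that lt AB by (simp add: \<theta>_def divide_strict_right_mono)
  have im: "\<theta> ` {a..b} = {A..B}"
  proof (intro equalityI subsetI)
    fix y assume "y \<in> \<theta> ` {a..b}"
    then obtain t where "t \<in> {a..b}" "y = \<theta> t" by blast
    then show "y \<in> {A..B}"
      using sm[of a t] sm[of t b] ends by (cases "t = a"; cases "t = b") auto
  next
    fix y assume y: "y \<in> {A..B}"
    define t where "t = a + (b - a) * ((y - A) / (B - A))"
    have "\<theta> t = y" using lt AB by (simp add: \<theta>_def t_def)
    moreover have "t \<in> {a..b}"
    proof -
      have "0 \<le> (y - A) / (B - A)" "(y - A) / (B - A) \<le> 1" using y AB by auto
      then have "0 \<le> (b - a) * ((y - A) / (B - A))" "(b - a) * ((y - A) / (B - A)) \<le> (b - a) * 1"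
        using lt by (intro mult_nonneg_nonneg mult_left_mono; simp)+
      then show ?thesis by (simp add: t_def)
    qed
    ultimately show "y \<in> \<theta> ` {a..b}" by blast
  qed
  have close: "\<bar>\<theta> t - t\<bar> \<le> T / real n" if t: "t \<in> {a..b}" for t
  proof -
    define l where "l = (t - a) / (b - a)"
    have l: "0 \<le> l" "l \<le> 1" using t lt by (auto simp: l_def)
    have "t = a + (b - a) * l" using lt by (simp add: l_def)
    \<comment> \<open>The displacement is a convex combination of the displacements at the two ends,
      each between 0 and T / n.\<close>
    then have eq: "\<theta> t - t = (1 - l) * (A - a) + l * (B - b)"
      by (simp add: \<theta>_def l_def[symmetric] algebra_simps)
    have "0 \<le> A - a" "A - a \<le> T / real n" "0 \<le> B - b" "B - b \<le> T / real n"
      unfolding A_def B_def using grid_ceil_ge[OF T] grid_ceil_le[OF T, of a] grid_ceil_le[OF T, of b] by auto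
    then have "0 \<le> \<theta> t - t" "\<theta> t - t \<le> T / real n"
      unfolding eq using l by (auto intro: convex_bound_le)
    then show ?thesis by simp
  qed
  have val: "f (grid_floor T n (\<theta> t)) = f t" if t: "t \<in> {a..b}" for t
  proof (cases "t = b")
    case True
    then show ?thesis using ends b by (simp add: B_def grid_floor_ceil[OF T])
  next
    case False
    then have tb: "t < b" using t by auto
    have "A \<le> \<theta> t" using sm[of a t] ends t by (cases "t = a") auto
    moreover have "\<theta> t < B" using sm[OF tb] ends by simp
    ultimately have "grid_floor T n (\<theta> t) \<in> {a..<b}"
      using grid_floor_ge[OF T] grid_floor_less[OF T] by (auto simp: A_def B_def)
    then show ?thesis using const t tb by auto
  qed
  show ?thesis
    unfolding grid_time_change_def
    using sm im ends close val by (intro exI[of _ \<theta>]) (auto simp: A_def B_def strict_mono_on_def)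
qed

text \<open>Around each point \<open>x\<close> the path is constant on a short piece to the left of
  \<open>x\<close> and on one starting at \<open>x\<close>, so every short interval around
  \<open>x\<close> is split there into two pieces of constancy. Bisection glues finitely many of
  these, and the finitely many conditions on \<open>n\<close> hold eventually.\<close>

lemma step_path_grid_time_change:
  assumes f: "step_path T E f" and T: "0 < T"
  shows "\<forall>\<^sub>F n in sequentially. \<exists>\<theta>\<in>time_changes T. \<forall>t\<in>{0..T}.
    \<bar>\<theta> t - t\<bar> \<le> T / real n \<and> f (grid_floor T n (\<theta> t)) = f t"
proof -
  have small: "\<forall>\<^sub>F n in sequentially. 0 < n \<and> T / real n < d" if "0 < d" for d
  proof -
    have "\<forall>\<^sub>F n in sequentially. T / real n < d"
      using order_tendstoD(2)[OF lim_const_over_n[of T] that] .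
    with eventually_gt_at_top[of 0] show ?thesis by (rule eventually_conj)
  qed
  \<comment> \<open>For large \<open>n\<close> the next grid point after \<open>b\<close> is reached
    before the path leaves its value at \<open>b\<close>; at the end of the interval the grid point
    is \<open>T\<close> itself.\<close>
  have ceil: "\<forall>\<^sub>F n in sequentially. 0 < n \<and> f (grid_ceil T n b) = f b" if b: "b \<in> {0..T}" for b
  proof (cases "b = T")
    case True
    have "\<forall>\<^sub>F n in sequentially. 0 < (n::nat)" by (rule eventually_gt_at_top)
    then show ?thesis by eventually_elim (simp add: True grid_ceil_T[OF T])
  next
    case False
    with b f have "\<forall>\<^sub>F s in at_right b. f s = f b" by (simp add: step_path_def)
    then obtain u where u: "b < u" "\<And>s. b < s \<Longrightarrow> s < u \<Longrightarrow> f s = f b"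
      unfolding eventually_at_right_field by blast
    have "0 < u - b" using u by simp
    from small[OF this] show ?thesis
    proof eventually_elim
      case (elim n)
      then have "b \<le> grid_ceil T n b" "grid_ceil T n b < u"
        using grid_ceil_ge[OF T, of n b] grid_ceil_le[OF T, of n b] by auto
      then show ?case using u elim by (cases "grid_ceil T n b = b") auto
    qed
  qed
  have piece: "\<forall>\<^sub>F n in sequentially. grid_time_change T f n a b"
    if ab: "0 \<le> a" "a \<le> b" "b \<le> T" and const: "\<And>s. s \<in> {a..<b} \<Longrightarrow> f s = y" for a b y
  proof -
    have "\<forall>\<^sub>F n in sequentially. a < b \<longrightarrow> 0 < n \<and> T / real n < b - a"
      using small[of "b - a"] by (cases "a < b") auto
    moreover have "\<forall>\<^sub>F n in sequentially. 0 < n \<and> f (grid_ceil T n b) = f b"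
      using ab by (intro ceil) auto
    ultimately show ?thesis
    proof eventually_elim
      case (elim n)
      then have n: "0 < n" by simp
      have "grid_ceil T n a < grid_ceil T n b" if "a < b"
        using grid_ceil_le[OF T n, of a] grid_ceil_ge[OF T n, of b] elim that by linarith
      then show ?case
        using elim const ab by (intro grid_time_change_constant[OF T n]) auto
    qed
  qed
  define Q where "Q a b \<longleftrightarrow> (0 \<le> a \<and> b \<le> T \<longrightarrow> (\<forall>\<^sub>F n in sequentially. grid_time_change T f n a b))" for a b
  have "Q 0 T"
  proof (rule Bolzano)
    show "0 \<le> T" using T by simp
    fix a b c assume Q: "Q a b" "Q b c" "a \<le> b" "b \<le> c"
    show "Q a c"
      unfolding Q_def
    proof
      assume "0 \<le> a \<and> c \<le> T"
      then have "\<forall>\<^sub>F n in sequentially. grid_time_change T f n a b" "\<forall>\<^sub>F n in sequentially. grid_time_change T f n b c"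
        using Q by (simp_all add: Q_def)
      then show "\<forall>\<^sub>F n in sequentially. grid_time_change T f n a c"
        by eventually_elim (rule grid_time_change_trans[OF _ _ Q(3,4)])
    qed
  next
    fix x assume x: "0 \<le> x" "x \<le> T"
    obtain d1 where d1: "0 < d1" "\<And>s. s \<in> {x..<x + d1} \<Longrightarrow> s < T \<Longrightarrow> f s = f x"
    proof (cases "x < T")
      case True
      with x f have "\<forall>\<^sub>F s in at_right x. f s = f x" by (simp add: step_path_def)
      then obtain u where u: "x < u" "\<And>s. x < s \<Longrightarrow> s < u \<Longrightarrow> f s = f x"
        unfolding eventually_at_right_field by blast
      show thesis
      proof (rule that[of "u - x"])
        fix s assume "s \<in> {x..<x + (u - x)}"
        then show "f s = f x" using u(2)[of s] by (cases "s = x") auto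
      qed (use u in auto)
    next
      case False
      then show thesis by (intro that[of 1]) auto
    qed
    obtain d2 l where d2: "0 < d2" "\<And>s. s \<in> {x - d2<..<x} \<Longrightarrow> 0 \<le> s \<Longrightarrow> f s = l"
    proof (cases "0 < x")
      case True
      with x f obtain l where "\<forall>\<^sub>F s in at_left x. f s = l" unfolding step_path_def by fastforce
      then obtain u where u: "u < x" "\<And>s. u < s \<Longrightarrow> s < x \<Longrightarrow> f s = l"
        unfolding eventually_at_left_field by blast
      show thesis by (rule that[of "x - u" l]) (use u in auto)
    next
      case False
      then show thesis by (intro that[of 1]) auto
    qed
    show "\<exists>d>0. \<forall>a b. a \<le> x \<and> x \<le> b \<and> b - a < d \<longrightarrow> Q a b"
    proof (intro exI[of _ "min d1 d2"] conjI allI impI)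
      fix a b assume ab: "a \<le> x \<and> x \<le> b \<and> b - a < min d1 d2"
      show "Q a b" unfolding Q_def
      proof
        assume ab': "0 \<le> a \<and> b \<le> T"
        have "\<forall>\<^sub>F n in sequentially. grid_time_change T f n a x"
          by (rule piece[where y=l]) (use ab ab' x in \<open>auto intro!: d2(2)\<close>)
        moreover have "\<forall>\<^sub>F n in sequentially. grid_time_change T f n x b"
          by (rule piece[where y="f x"]) (use ab ab' x in \<open>auto intro!: d1(2)\<close>)
        ultimately show "\<forall>\<^sub>F n in sequentially. grid_time_change T f n a b"
          by eventually_elim (use ab in \<open>auto intro: grid_time_change_trans\<close>)
      qed
    qed (use d1 d2 in auto)
  qed
  then have "\<forall>\<^sub>F n in sequentially. grid_time_change T f n 0 T" using T by (simp add: Q_def)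
  with eventually_gt_at_top[of 0] show ?thesis
  proof eventually_elim
    case (elim n)
    then show ?case
      unfolding grid_time_change_def grid_ceil_T[OF T elim(1)] grid_ceil_0[OF T elim(1)] time_changes_def
      by blast
  qed
qed

lemma skorokhod_dist_le:
  assumes "f \<in> cadlag_paths T E" "g \<in> cadlag_paths T E" "0 < e" "\<theta> \<in> time_changes T"
    "\<And>t. t \<in> {0..T} \<Longrightarrow> \<bar>\<theta> t - t\<bar> \<le> e \<and> dist (f t) (g (\<theta> t)) \<le> e"
  shows "skorokhod_dist T E f g \<le> e"
proof -
  have "bdd_below {e. 0 < e \<and> (\<exists>\<theta>\<in>time_changes T. \<forall>t\<in>{0..T}. \<bar>\<theta> t - t\<bar> \<le> e \<and> dist (f t) (g (\<theta> t)) \<le> e)}"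
    by (rule bdd_belowI[of _ 0]) auto
  then show ?thesis
    unfolding skorokhod_dist_def using assms by (simp, intro cInf_lower) blast+
qed

text \<open>After the time change the values agree exactly, so only the displacement T / n
  contributes to the distance.\<close>

lemma skorokhod_dist_grid:
  fixes f :: "real \<Rightarrow> 'a::metric_space"
  assumes f: "step_path T E f" and T: "0 < T" and e: "0 < e"
  shows "\<forall>\<^sub>F n in sequentially.
    skorokhod_dist T E (restrict f {0..T}) (\<lambda>t\<in>{0..T}. f (grid_floor T n t)) \<le> e"
proof -
  have "\<forall>\<^sub>F n in sequentially. T / real n < e"
    using order_tendstoD(2)[OF lim_const_over_n[of T] e] .
  with step_path_grid_time_change[OF f T] eventually_gt_at_top[of 0] show ?thesis
  proof eventually_elim
    case (elim n)
    then obtain \<theta> where \<theta>: "\<theta> \<in> time_changes T" "\<And>t. t \<in> {0..T} \<Longrightarrow> \<bar>\<theta> t - t\<bar> \<le> T / real n \<and> f (grid_floor T n (\<theta> t)) = f t"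
      by blast
    have in\<theta>: "\<theta> t \<in> {0..T}" if "t \<in> {0..T}" for t using \<theta>(1) that by (auto simp: time_changes_def)
    show ?case
    proof (rule skorokhod_dist_le[OF _ _ e \<theta>(1)])
      show "restrict f {0..T} \<in> cadlag_paths T E" by (rule step_path_cadlag[OF f])
      show "(\<lambda>t\<in>{0..T}. f (grid_floor T n t)) \<in> cadlag_paths T E"
        by (rule step_path_cadlag[OF step_path_grid_floor[OF f T elim(2)]])
      fix t assume t: "t \<in> {0..T}"
      have "dist (restrict f {0..T} t) ((\<lambda>t\<in>{0..T}. f (grid_floor T n t)) (\<theta> t)) = 0"
        using \<theta>(2)[OF t] in\<theta>[OF t] t by simp
      then show "\<bar>\<theta> t - t\<bar> \<le> e \<and> dist (restrict f {0..T} t) ((\<lambda>t\<in>{0..T}. f (grid_floor T n t)) (\<theta> t)) \<le> e"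
        using \<theta>(2)[OF t] elim(3) e by linarith
    qed
  qed
qed


section \<open>Borel measurability of the magnetization path\<close>

lemma step_path_magnetization:
  assumes "\<omega> \<in> cadlag_paths T (configs N)"
  shows "step_path T {-1..1} (\<lambda>t. magnetization N (\<omega> t))"
  unfolding step_path_def
proof (intro conjI ballI)
  fix t assume "t \<in> {0..T}"
  show "magnetization N (\<omega> t) \<in> {-1..1}" by (rule magnetization_bounds)
next
  fix t assume "t \<in> {0..<T}"
  from cadlag_configs_right[OF assms this]
  show "\<forall>\<^sub>F s in at_right t. magnetization N (\<omega> s) = magnetization N (\<omega> t)"
    by eventually_elim simp
next
  fix t assume "t \<in> {0<..T}"
  from cadlag_configs_left[OF assms this] obtain l where "\<forall>\<^sub>F s in at_left t. \<omega> s = l" by blast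
  then have "\<forall>\<^sub>F s in at_left t. magnetization N (\<omega> s) = magnetization N l"
    by eventually_elim simp
  then show "\<exists>l\<in>{-1..1}. \<forall>\<^sub>F s in at_left t. magnetization N (\<omega> s) = l"
    using magnetization_bounds by blast
qed

lemma topspace_skorokhod: "topspace (skorokhod_topology T E) = cadlag_paths T E"
  unfolding skorokhod_topology_def by (rule Metric_space.topspace_mtopology[OF Metric_space_skorokhod])

text \<open>The discretised path factors through finitely many evaluations in a countable space, so it is
  measurable for every \<open>\<sigma>\<close>-algebra; it converges pointwise in the Skorokhod metric.\<close>

lemma measurable_magnetization_path:
  assumes P: "path_law T c N \<mu> P" and T: "0 < T"
  shows "(\<lambda>\<omega>. \<lambda>t\<in>{0..T}. magnetization N (\<omega> t)) \<in> measurable P (borel_algebra (skorokhod_topology T {-1..1}))"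
    (is "?\<Phi> \<in> _")
proof -
  note sp = path_law_space(2)[OF P]
  let ?D = "cadlag_paths T {-1..1::real}" and ?d = "skorokhod_dist T {-1..1::real}"
  interpret S: Metric_space ?D ?d by (rule Metric_space_skorokhod)
  have \<Phi>: "?\<Phi> \<omega> \<in> ?D" if "\<omega> \<in> space P" for \<omega>
    using step_path_cadlag[OF step_path_magnetization[of \<omega> T N]] that sp by simp
  define \<Psi> where "\<Psi> n \<omega> = (\<lambda>t\<in>{0..T}. magnetization N (\<omega> (grid_floor T n t)))" for n and \<omega> :: "real \<Rightarrow> config"
  have \<Psi>D: "\<Psi> n \<omega> \<in> ?D" if "\<omega> \<in> space P" "0 < n" for \<omega> n
    unfolding \<Psi>_def using step_path_cadlag[OF step_path_grid_floor[OF step_path_magnetization[of \<omega> T N] T that(2)]] that sp by simp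
  have lim: "\<forall>\<^sub>F n in sequentially. ?d (?\<Phi> \<omega>) (\<Psi> n \<omega>) \<le> e" if "\<omega> \<in> space P" "0 < e" for \<omega> e
    unfolding \<Psi>_def using skorokhod_dist_grid[OF step_path_magnetization[of \<omega> T N] T that(2)] that sp by simp
  have \<Psi>m: "{\<omega> \<in> space P. \<Psi> n \<omega> \<in> W} \<in> sets P" if n: "0 < n" for n W
  proof -
    \<comment> \<open>\<open>h\<close> reads off the n + 1 grid values. Its target is a finite
      product of countable discrete spaces, hence discrete, so preimages are measurable whatever
      \<open>W\<close> is.\<close>
    define h where "h \<omega> = (\<lambda>j\<in>{..n}. \<omega> (T * real j / real n))" for \<omega> :: "real \<Rightarrow> config"
    define H where "H v = (\<lambda>t\<in>{0..T}. magnetization N (v (nat \<lfloor>t * real n / T\<rfloor>)))" for v :: "nat \<Rightarrow> config"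
    have "h \<in> measurable P (PiM {..n} (\<lambda>_. count_space (configs N)))"
      unfolding h_def
    proof (rule measurable_restrict)
      fix j assume "j \<in> {..n}"
      then show "(\<lambda>\<omega>. \<omega> (T * real j / real n)) \<in> measurable P (count_space (configs N))"
        using T n by (intro measurable_evaluation[OF P]) (simp add: field_simps)
    qed
    also have "PiM {..n} (\<lambda>_. count_space (configs N)) = count_space (PiE {..n} (\<lambda>_. configs N))"
      by (rule count_space_PiM_finite) (auto simp: countable_configs)
    finally have h: "h \<in> measurable P (count_space (PiE {..n} (\<lambda>_. configs N)))" .
    have eq: "\<Psi> n \<omega> = H (h \<omega>)" for \<omega>
      unfolding \<Psi>_def H_def
    proof (intro restrict_ext)
      fix t assume t: "t \<in> {0..T}"
      have b: "0 \<le> t * real n / T" "t * real n / T \<le> real n" using t T n by (simp_all add: field_simps)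
      then have "0 \<le> \<lfloor>t * real n / T\<rfloor>" "\<lfloor>t * real n / T\<rfloor> \<le> int n" by (simp, linarith)
      then show "magnetization N (\<omega> (grid_floor T n t)) = magnetization N (h \<omega> (nat \<lfloor>t * real n / T\<rfloor>))"
        by (simp add: h_def grid_floor_def nat_le_iff)
    qed
    have "h -` {v \<in> PiE {..n} (\<lambda>_. configs N). H v \<in> W} \<inter> space P \<in> sets P"
      by (rule measurable_sets[OF h]) auto
    moreover have "h -` {v \<in> PiE {..n} (\<lambda>_. configs N). H v \<in> W} \<inter> space P = {\<omega> \<in> space P. \<Psi> n \<omega> \<in> W}"
      using measurable_space[OF h] by (auto simp: eq)
    ultimately show ?thesis by simp
  qed
  have "?\<Phi> \<in> measurable P (sigma ?D {U. openin S.mtopology U})"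
  proof (rule measurable_measure_of)
    show "{U. openin S.mtopology U} \<subseteq> Pow ?D" using openin_subset[of S.mtopology] by auto
    show "?\<Phi> \<in> space P \<rightarrow> ?D" using \<Phi> by auto
    fix U assume "U \<in> {U. openin S.mtopology U}"
    then have U: "U \<subseteq> ?D" "\<And>x. x \<in> U \<Longrightarrow> \<exists>r>0. S.mball x r \<subseteq> U"
      by (auto simp: S.openin_mtopology)
    \<comment> \<open>Membership in \<open>U\<close> alone would not pass to the limit of the
      discretisations. \<open>W k\<close> asks for a margin 1 / (k + 1) around them, and the path
      lies in \<open>U\<close> exactly when for some \<open>k\<close> the discretisations eventually
      lie in \<open>W k\<close>.\<close>
    define W where "W k = {h. \<forall>g\<in>?D. ?d g h < 1 / real (Suc k) \<longrightarrow> g \<in> U}" for k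
    have "?\<Phi> -` U \<inter> space P = (\<Union>k n0. \<Inter>n\<in>{n0..}. {\<omega> \<in> space P. \<Psi> (Suc n) \<omega> \<in> W k})"
    proof (intro equalityI subsetI)
      fix \<omega> assume "\<omega> \<in> ?\<Phi> -` U \<inter> space P"
      then have \<omega>: "\<omega> \<in> space P" "?\<Phi> \<omega> \<in> U" by auto
      from U(2)[OF \<omega>(2)] obtain r where r: "0 < r" "S.mball (?\<Phi> \<omega>) r \<subseteq> U" by blast
      obtain k where k: "1 / real (Suc k) < r / 2" using nat_approx_posE[of "r / 2"] r by auto
      from lim[OF \<omega>(1), of "r / 2"] r obtain n0 where n0: "\<And>n. n \<ge> n0 \<Longrightarrow> ?d (?\<Phi> \<omega>) (\<Psi> n \<omega>) \<le> r / 2"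
        by (auto simp: eventually_sequentially)
      have "\<Psi> (Suc n) \<omega> \<in> W k" if "n \<ge> n0" for n
        unfolding W_def
      proof (intro CollectI ballI impI)
        fix g assume g: "g \<in> ?D" "?d g (\<Psi> (Suc n) \<omega>) < 1 / real (Suc k)"
        have "?d (?\<Phi> \<omega>) g \<le> ?d (?\<Phi> \<omega>) (\<Psi> (Suc n) \<omega>) + ?d (\<Psi> (Suc n) \<omega>) g"
          by (intro S.triangle \<Phi> \<Psi>D \<omega> g) simp
        also have "\<dots> < r"
          using n0[of "Suc n"] that g k by (simp add: S.commute)
        finally show "g \<in> U" using r(2) \<Phi>[OF \<omega>(1)] g(1) by (auto simp: S.in_mball)
      qed
      then show "\<omega> \<in> (\<Union>k n0. \<Inter>n\<in>{n0..}. {\<omega> \<in> space P. \<Psi> (Suc n) \<omega> \<in> W k})"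
        using \<omega> by blast
    next
      fix \<omega> assume "\<omega> \<in> (\<Union>k n0. \<Inter>n\<in>{n0..}. {\<omega> \<in> space P. \<Psi> (Suc n) \<omega> \<in> W k})"
      then obtain k n0 where kn: "\<And>n. n \<ge> n0 \<Longrightarrow> \<omega> \<in> space P \<and> \<Psi> (Suc n) \<omega> \<in> W k" by auto
      then have \<omega>: "\<omega> \<in> space P" by blast
      from lim[OF \<omega>, of "1 / real (Suc k) / 2"] obtain n1 where n1: "\<And>n. n \<ge> n1 \<Longrightarrow> ?d (?\<Phi> \<omega>) (\<Psi> n \<omega>) \<le> 1 / real (Suc k) / 2"
        by (auto simp: eventually_sequentially)
      define n where "n = max n0 n1"
      have half: "x / 2 < x" if "0 < x" for x :: real using that by simp
      have "1 / real (Suc k) / 2 < 1 / real (Suc k)" by (rule half) simp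
      moreover have "?d (?\<Phi> \<omega>) (\<Psi> (Suc n) \<omega>) \<le> 1 / real (Suc k) / 2"
        by (rule n1) (simp add: n_def)
      ultimately have "?d (?\<Phi> \<omega>) (\<Psi> (Suc n) \<omega>) < 1 / real (Suc k)" by (rule le_less_trans[rotated])
      then show "\<omega> \<in> ?\<Phi> -` U \<inter> space P"
        using kn[of n] \<Phi>[OF \<omega>] \<omega> by (auto simp: W_def n_def)
    qed
    then show "?\<Phi> -` U \<inter> space P \<in> sets P"
      using \<Psi>m by (auto intro!: sets.countable_INT')
  qed
  then show ?thesis
    unfolding borel_algebra_def topspace_skorokhod unfolding skorokhod_topology_def .
qed

section \<open>Poisson initial distribution\<close>

text \<open>The relation \<open>p (Suc k) * real (Suc k) = r * p k\<close> reduces each moment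
  series to the previous one after an index shift, the term at 0 being zero.\<close>

lemma Pois_moments:
  assumes "0 \<le> r"
  shows "integrable (measure_pmf (Pois r)) (\<lambda>k. real k ^ 2)" "integrable (measure_pmf (Pois r)) real"
    and "measure_pmf.expectation (Pois r) real = r"
    and "measure_pmf.variance (Pois r) real = r"
proof -
  have "integrable (measure_pmf (Pois r)) (\<lambda>k. real k ^ 2) \<and> integrable (measure_pmf (Pois r)) real \<and>
      measure_pmf.expectation (Pois r) real = r \<and> measure_pmf.expectation (Pois r) (\<lambda>k. (real k)\<^sup>2) = r\<^sup>2 + r"
  proof (cases "r = 0")
    case True
    then show ?thesis by (auto simp: Pois_def integrable_measure_pmf_finite)
  next
    case False
    with assms have r: "0 < r" by simp
    define p where "p k = r ^ k / fact k * exp (- r)" for k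
    have p: "pmf (Pois r) k = p k" for k using r by (simp add: Pois_def p_def)
    have p0: "0 \<le> p k" for k using r by (simp add: p_def)
    have s: "p sums 1"
    proof -
      have "(\<lambda>k. r ^ k / fact k) sums exp r" using exp_converges[of r] by (simp add: divide_inverse mult.commute)
      from sums_mult2[OF this, of "exp (- r)"] show ?thesis by (simp add: p_def[abs_def] exp_minus_inverse)
    qed
    have rec: "p (Suc k) * real (Suc k) = r * p k" for k
    proof -
      have "(fact (Suc k) :: real) = real (Suc k) * fact k" by (rule fact_Suc)
      then show ?thesis by (simp add: p_def del: fact_Suc)
    qed
    have s1: "(\<lambda>k. p k * real k) sums r"
    proof -
      have "(\<lambda>k. p (Suc k) * real (Suc k)) sums (r * 1)" unfolding rec by (rule sums_mult[OF s])
      then show ?thesis by (subst (asm) sums_Suc_iff) simp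
    qed
    have s2: "(\<lambda>k. p k * (real k)\<^sup>2) sums (r\<^sup>2 + r)"
    proof -
      have "(\<lambda>k. r * (p k * real k) + r * p k) sums (r * r + r * 1)"
        by (intro sums_add sums_mult s s1)
      moreover have "p (Suc k) * (real (Suc k))\<^sup>2 = r * (p k * real k) + r * p k" for k
        using arg_cong[OF rec[of k], of "\<lambda>x. x * real (Suc k)"] by (simp add: power2_eq_square algebra_simps)
      ultimately have "(\<lambda>k. p (Suc k) * (real (Suc k))\<^sup>2) sums (r\<^sup>2 + r)" by (simp add: power2_eq_square)
      then show ?thesis by (subst (asm) sums_Suc_iff) simp
    qed
    have conv: "integrable (measure_pmf (Pois r)) g \<and> measure_pmf.expectation (Pois r) g = S"
      if "(\<lambda>k. p k * g k) sums S" "\<And>k. 0 \<le> g k" for g :: "nat \<Rightarrow> real" and S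
    proof -
      have "integrable (count_space UNIV) (\<lambda>k. p k * g k)"
        using that p0 by (subst integrable_count_space_nat_iff) (auto simp: sums_iff)
      moreover have "(\<integral>k. p k * g k \<partial>count_space UNIV) = S"
        using sums_unique[OF that(1)] by (subst integral_count_space_nat) (use calculation in auto)
      ultimately show ?thesis
        by (simp add: measure_pmf_eq_density integrable_density integral_density p[symmetric])
    qed
    from conv[OF s1] conv[OF s2] show ?thesis by simp
  qed
  then show "integrable (measure_pmf (Pois r)) (\<lambda>k. real k ^ 2)" "integrable (measure_pmf (Pois r)) real"
    "measure_pmf.expectation (Pois r) real = r" "measure_pmf.variance (Pois r) real = r"
    by (simp, simp, simp, subst measure_pmf.variance_eq, simp_all)
qed

text \<open>Squared bias plus variance: distinct coordinates are uncorrelated, and a Poisson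
  variable has variance equal to its mean.\<close>

lemma Pi_Pois_second_moment:
  fixes w r :: "'a \<Rightarrow> real"
  assumes I: "finite I" and r: "\<And>i. i \<in> I \<Longrightarrow> 0 \<le> r i"
  defines "p \<equiv> Pi_pmf I 0 (\<lambda>i. Pois (r i))"
  shows "integrable (measure_pmf p) (\<lambda>\<eta>. ((\<Sum>i\<in>I. w i * real (\<eta> i)) - a)\<^sup>2)"
    and "measure_pmf.expectation p (\<lambda>\<eta>. ((\<Sum>i\<in>I. w i * real (\<eta> i)) - a)\<^sup>2) =
      ((\<Sum>i\<in>I. w i * r i) - a)\<^sup>2 + (\<Sum>i\<in>I. (w i)\<^sup>2 * r i)"
proof -
  have comp: "measure_pmf.expectation p (\<lambda>\<eta>. g (\<eta> i)) = measure_pmf.expectation (Pois (r i)) g"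
    "integrable (measure_pmf p) (\<lambda>\<eta>. g (\<eta> i)) \<longleftrightarrow> integrable (measure_pmf (Pois (r i))) g"
    if "i \<in> I" for g :: "nat \<Rightarrow> real" and i
  proof -
    have m: "map_pmf (\<lambda>\<eta>. \<eta> i) p = Pois (r i)" using Pi_pmf_component[OF I, of i 0 "\<lambda>i. Pois (r i)"] that by (simp add: p_def)
    show "measure_pmf.expectation p (\<lambda>\<eta>. g (\<eta> i)) = measure_pmf.expectation (Pois (r i)) g"
      "integrable (measure_pmf p) (\<lambda>\<eta>. g (\<eta> i)) \<longleftrightarrow> integrable (measure_pmf (Pois (r i))) g"
      unfolding m[symmetric] by simp_all
  qed
  have uncorr: "integrable (measure_pmf p) (\<lambda>\<eta>. (w i * (real (\<eta> i) - r i)) * (w j * (real (\<eta> j) - r j))) \<and>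
      measure_pmf.expectation p (\<lambda>\<eta>. (w i * (real (\<eta> i) - r i)) * (w j * (real (\<eta> j) - r j))) = 0"
    if ij: "i \<in> I" "j \<in> I" "i \<noteq> j" for i j
  proof -
    \<comment> \<open>Equal to 1 off the two chosen coordinates, so the product formula over all
      coordinates collapses to the expectation of a product of two.\<close>
    define f where "f x k = (if x \<in> {i, j} then real k else 1)" for x k
    have int: "integrable (measure_pmf (Pois (r x))) (f x)" if "x \<in> I" for x
      using Pois_moments(2)[OF r[OF that]] unfolding f_def[abs_def] by (cases "x \<in> {i, j}") simp_all
    have prod2: "(\<Prod>x\<in>I. if x \<in> {i, j} then h x else 1) = h i * h j" for h :: "'a \<Rightarrow> real"
    proof -
      have "(\<Prod>x\<in>I. if x \<in> {i, j} then h x else 1) = prod h (I \<inter> {i, j})"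
        by (rule prod.inter_restrict[OF I, symmetric])
      also have "I \<inter> {i, j} = {i, j}" using ij by auto
      finally show ?thesis using ij by simp
    qed
    have pr: "(\<Prod>x\<in>I. f x (\<eta> x)) = real (\<eta> i) * real (\<eta> j)" for \<eta>
      unfolding f_def by (rule prod2)
    have i2: "integrable (measure_pmf p) (\<lambda>\<eta>. real (\<eta> i) * real (\<eta> j))"
      unfolding pr[symmetric] p_def by (rule integrable_prod_Pi_pmf[OF I int])
    have "measure_pmf.expectation p (\<lambda>\<eta>. \<Prod>x\<in>I. f x (\<eta> x)) = (\<Prod>x\<in>I. measure_pmf.expectation (Pois (r x)) (f x))"
      unfolding p_def by (rule expectation_prod_Pi_pmf[OF I int]) (auto simp: f_def)
    also have "\<dots> = (\<Prod>x\<in>I. if x \<in> {i, j} then r x else 1)"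
      using Pois_moments(3)[OF r] by (intro prod.cong refl) (auto simp: f_def[abs_def])
    finally have e2: "measure_pmf.expectation p (\<lambda>\<eta>. real (\<eta> i) * real (\<eta> j)) = r i * r j"
      unfolding pr prod2 .
    have i1: "integrable (measure_pmf p) (\<lambda>\<eta>. real (\<eta> x))" "measure_pmf.expectation p (\<lambda>\<eta>. real (\<eta> x)) = r x" if "x \<in> I" for x
      using comp[OF that, of real] Pois_moments(2,3)[OF r[OF that]] by auto
    have "(w i * (real (\<eta> i) - r i)) * (w j * (real (\<eta> j) - r j)) =
        w i * w j * (real (\<eta> i) * real (\<eta> j) - r j * real (\<eta> i) - r i * real (\<eta> j) + r i * r j)" for \<eta>
      by (simp add: algebra_simps)
    note eq = this
    show ?thesis unfolding eq using i1[OF ij(1)] i1[OF ij(2)] i2 e2 by simp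
  qed
  have i2: "integrable (measure_pmf p) (\<lambda>\<eta>. (w i * real (\<eta> i))\<^sup>2)" "integrable (measure_pmf p) (\<lambda>\<eta>. w i * real (\<eta> i))" if "i \<in> I" for i
    using comp(2)[OF that, of "\<lambda>k. (real k)\<^sup>2"] comp(2)[OF that, of real] Pois_moments(1,2)[OF r[OF that]]
    by (auto simp: power_mult_distrib)
  define S where "S \<eta> = (\<Sum>i\<in>I. w i * real (\<eta> i))" for \<eta> :: "'a \<Rightarrow> nat"
  have iS: "integrable (measure_pmf p) S" unfolding S_def using i2 by auto
  \<comment> \<open>Square integrability of the sum comes from the Cauchy-Schwarz inequality for
    finitely many terms.\<close>
  have iS2: "integrable (measure_pmf p) (\<lambda>\<eta>. (S \<eta>)\<^sup>2)"
  proof (rule Bochner_Integration.integrable_bound)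
    show "integrable (measure_pmf p) (\<lambda>\<eta>. real (card I) * (\<Sum>i\<in>I. (w i * real (\<eta> i))\<^sup>2))" using i2 by auto
    show "AE \<eta> in measure_pmf p. norm ((S \<eta>)\<^sup>2) \<le> norm (real (card I) * (\<Sum>i\<in>I. (w i * real (\<eta> i))\<^sup>2))"
    proof (intro AE_I2)
      fix \<eta>
      have "(S \<eta>)\<^sup>2 \<le> real (card I) * (\<Sum>i\<in>I. (w i * real (\<eta> i))\<^sup>2)"
        unfolding S_def by (subst mult.commute) (rule sum_squared_le_sum_of_squares)
      then show "norm ((S \<eta>)\<^sup>2) \<le> norm (real (card I) * (\<Sum>i\<in>I. (w i * real (\<eta> i))\<^sup>2))"
        by (simp add: sum_nonneg)
    qed
  qed simp
  have E: "measure_pmf.expectation p S = (\<Sum>i\<in>I. w i * r i)"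
  proof -
    have "measure_pmf.expectation p S = (\<Sum>i\<in>I. measure_pmf.expectation p (\<lambda>\<eta>. w i * real (\<eta> i)))"
      unfolding S_def by (rule Bochner_Integration.integral_sum) (rule i2)
    also have "\<dots> = (\<Sum>i\<in>I. w i * r i)"
      using comp(1)[of _ real] Pois_moments(3)[OF r] by (intro sum.cong) auto
    finally show ?thesis .
  qed
  have V: "measure_pmf.variance p S = (\<Sum>i\<in>I. (w i)\<^sup>2 * r i)"
  proof -
    define Y where "Y i \<eta> = w i * (real (\<eta> i) - r i)" for i and \<eta> :: "'a \<Rightarrow> nat"
    have sq: "integrable (measure_pmf p) (\<lambda>\<eta>. Y i \<eta> * Y i \<eta>) \<and> measure_pmf.expectation p (\<lambda>\<eta>. Y i \<eta> * Y i \<eta>) = (w i)\<^sup>2 * r i"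
      if i: "i \<in> I" for i
    proof -
      have eq: "Y i \<eta> * Y i \<eta> = (w i)\<^sup>2 * (real (\<eta> i) - r i)\<^sup>2" for \<eta>
        by (simp add: Y_def power2_eq_square)
      have "integrable (measure_pmf (Pois (r i))) (\<lambda>k. (real k - r i)\<^sup>2)"
        using Pois_moments(1,2)[OF r[OF i]] by (simp add: power2_diff)
      then show ?thesis
        unfolding eq using comp[OF i, of "\<lambda>k. (real k - r i)\<^sup>2"] Pois_moments(3,4)[OF r[OF i]] by simp
    qed
    have int: "integrable (measure_pmf p) (\<lambda>\<eta>. Y i \<eta> * Y j \<eta>)"
      and ex: "measure_pmf.expectation p (\<lambda>\<eta>. Y i \<eta> * Y j \<eta>) = (if i = j then (w i)\<^sup>2 * r i else 0)"
      if "i \<in> I" "j \<in> I" for i j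
      using sq[of i] uncorr[of i j] that by (auto simp: Y_def)
    have "(S \<eta> - (\<Sum>i\<in>I. w i * r i))\<^sup>2 = (\<Sum>i\<in>I. \<Sum>j\<in>I. Y i \<eta> * Y j \<eta>)" for \<eta>
      unfolding S_def Y_def sum_product[symmetric] power2_eq_square
      by (simp add: right_diff_distrib sum_subtractf)
    then have "measure_pmf.variance p S = measure_pmf.expectation p (\<lambda>\<eta>. \<Sum>i\<in>I. \<Sum>j\<in>I. Y i \<eta> * Y j \<eta>)"
      by (simp add: E)
    also have "\<dots> = (\<Sum>i\<in>I. \<Sum>j\<in>I. measure_pmf.expectation p (\<lambda>\<eta>. Y i \<eta> * Y j \<eta>))"
      using int by (subst Bochner_Integration.integral_sum; (intro sum.cong refl Bochner_Integration.integral_sum Bochner_Integration.integrable_sum)?) auto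
    also have "\<dots> = (\<Sum>i\<in>I. (w i)\<^sup>2 * r i)"
      using I by (simp add: ex sum.delta' cong: sum.cong)
    finally show ?thesis .
  qed
  have eq: "(\<lambda>\<eta>. (S \<eta> - a)\<^sup>2) = (\<lambda>\<eta>. (S \<eta>)\<^sup>2 - 2 * a * S \<eta> + a\<^sup>2)"
    by (auto simp: power2_diff algebra_simps)
  show "integrable (measure_pmf p) (\<lambda>\<eta>. ((\<Sum>i\<in>I. w i * real (\<eta> i)) - a)\<^sup>2)"
    using iS iS2 unfolding S_def[symmetric] eq by simp
  have "measure_pmf.expectation p (\<lambda>\<eta>. (S \<eta> - a)\<^sup>2) =
      measure_pmf.expectation p (\<lambda>\<eta>. (S \<eta>)\<^sup>2) - 2 * a * measure_pmf.expectation p S + a\<^sup>2"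
    unfolding eq using iS iS2 by simp
  also have "\<dots> = (measure_pmf.expectation p S - a)\<^sup>2 + measure_pmf.variance p S"
    using measure_pmf.variance_eq[OF iS iS2] by (simp add: power2_diff algebra_simps)
  finally show "measure_pmf.expectation p (\<lambda>\<eta>. ((\<Sum>i\<in>I. w i * real (\<eta> i)) - a)\<^sup>2) =
      ((\<Sum>i\<in>I. w i * r i) - a)\<^sup>2 + (\<Sum>i\<in>I. (w i)\<^sup>2 * r i)"
    unfolding V unfolding E S_def .
qed


section \<open>Riemann sums and the initial expectation of the Lyapunov function\<close>

lemma LBINT_eq_integral:
  fixes f :: "real \<Rightarrow> real"
  assumes "continuous_on {a..b} f"
  shows "(LBINT x:{a..b}. f x) = integral {a..b} f"
  using set_borel_integral_eq_integral(2)[OF borel_integrable_atLeastAtMost'[OF assms]] .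

lemma riemann_sum_tendsto:
  fixes f :: "real \<Rightarrow> real"
  assumes f: "continuous_on {0..1} f"
  shows "(\<lambda>N. (\<Sum>x\<in>{0..<int N}. f (real_of_int x / real N)) / real N) \<longlonglongrightarrow> integral {0..1} f"
proof (rule LIMSEQ_I)
  fix e :: real assume e: "0 < e"
  have "uniformly_continuous_on {0..1} f" by (rule compact_uniformly_continuous[OF f]) simp
  then obtain d where d: "0 < d" "\<And>x y. x \<in> {0..1} \<Longrightarrow> y \<in> {0..1} \<Longrightarrow> \<bar>y - x\<bar> < d \<Longrightarrow> \<bar>f y - f x\<bar> < e / 2"
    unfolding uniformly_continuous_on_def dist_real_def using e by (metis half_gt_zero)
  obtain N0 :: nat where N0: "1 / d < real N0" using reals_Archimedean2 by blast
  show "\<exists>N0. \<forall>N\<ge>N0. norm ((\<Sum>x\<in>{0..<int N}. f (real_of_int x / real N)) / real N - integral {0..1} f) < e"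
  proof (intro exI[of _ "Suc N0"] allI impI)
    fix N assume N: "Suc N0 \<le> N"
    then have N1: "0 < real N" "1 / real N < d"
      using N0 d by (auto simp: field_simps) (smt (verit) N d(1) mult_less_cancel_left_pos of_nat_Suc of_nat_le_iff)
    \<comment> \<open>Induction on the number of cells: by uniform continuity each cell of length 1
      / N adds an error of at most e / 2 / N.\<close>
    have "\<bar>(\<Sum>k<n. f (real k / real N) / real N) - integral {0..real n / real N} f\<bar> \<le> real n * (e / 2 / real N)"
      if "n \<le> N" for n
      using that
    proof (induction n)
      case 0
      then show ?case by simp
    next
      case (Suc n)
      let ?a = "real n / real N" and ?b = "real (Suc n) / real N"
      have ab: "0 \<le> ?a" "?a \<le> ?b" "?b \<le> 1" "?b - ?a = 1 / real N"
        using Suc.prems N1 by (auto simp: field_simps)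
      have "{?a..?b} \<subseteq> {0..1}" "{0..?b} \<subseteq> {0..1}" using ab(1,3) unfolding atLeastatMost_subset_iff by auto
      then have c: "continuous_on {?a..?b} f" "continuous_on {0..?b} f"
        using continuous_on_subset[OF f] by blast+
      have i: "integral {0..?a} f + integral {?a..?b} f = integral {0..?b} f"
        by (rule Henstock_Kurzweil_Integration.integral_combine[OF ab(1,2) integrable_continuous_real[OF c(2)]])
      have "\<bar>integral {?a..?b} (\<lambda>y. f y - f ?a)\<bar> \<le> e / 2 * (?b - ?a)"
      proof (rule integral_bound[where 'a=real, unfolded real_norm_def])
        show "?a \<le> ?b" by (rule ab)
        show "continuous_on {?a..?b} (\<lambda>y. f y - f ?a)" by (intro continuous_intros c)
        fix y assume y: "y \<in> {?a..?b}"
        then have "y \<in> {0..1}" "?a \<in> {0..1}" "\<bar>y - ?a\<bar> < d"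
          using ab N1 unfolding atLeastAtMost_iff by linarith+
        then show "\<bar>f y - f ?a\<bar> \<le> e / 2" using d(2)[of ?a y] by simp
      qed
      moreover have "integral {?a..?b} (\<lambda>y. f y - f ?a) = integral {?a..?b} f - f ?a * (?b - ?a)"
        using ab by (subst integral_diff) (auto intro!: integrable_continuous_real c simp: mult.commute simp del: of_nat_Suc)
      ultimately have "\<bar>f ?a / real N - integral {?a..?b} f\<bar> \<le> e / 2 / real N"
        unfolding ab(4) by (simp add: abs_minus_commute)
      moreover have "\<bar>(\<Sum>k<n. f (real k / real N) / real N) - integral {0..?a} f\<bar> \<le> real n * (e / 2 / real N)"
        using Suc by simp
      moreover have "real (Suc n) * (e / 2 / real N) = real n * (e / 2 / real N) + e / 2 / real N"
        by (simp add: distrib_right add_divide_distrib)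
      ultimately show ?case unfolding i[symmetric] sum.lessThan_Suc by linarith
    qed
    from this[of N] have "\<bar>(\<Sum>k<N. f (real k / real N) / real N) - integral {0..1} f\<bar> \<le> e / 2"
      using N1 by simp
    moreover have "(\<Sum>k<N. f (real k / real N) / real N) = (\<Sum>x\<in>{0..<int N}. f (real_of_int x / real N)) / real N"
      unfolding sum_divide_distrib by (rule sum.reindex_bij_witness[of _ nat int]) auto
    ultimately show "norm ((\<Sum>x\<in>{0..<int N}. f (real_of_int x / real N)) / real N - integral {0..1} f) < e"
      using e by simp
  qed
qed

lemma smooth_on_V_continuous:
  assumes "smooth_on_V \<rho>" "\<sigma> \<in> spins"
  shows "continuous_on S (\<lambda>x. \<rho> x \<sigma>)"
proof -
  have "(\<lambda>y. \<rho> y \<sigma>) differentiable (at x)" for x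
    using assms unfolding smooth_on_V_def by (metis funpow_0)
  then show ?thesis
    by (meson continuous_at_imp_continuous_on differentiable_imp_continuous_within)
qed

text \<open>\<Lambda> is the mean particle number. If n is at least \<Lambda> / 2, it may be
  replaced by \<Lambda> / 2 in the denominators; otherwise the trivial bound 4 + \<kappa> is used,
  weighted as in Chebyshev's inequality. Both cases are dominated by one quadratic expression, whose
  expectation is explicit.\<close>

lemma initial_lyapunov_bound:
  fixes m :: "real \<Rightarrow> real"
  assumes \<rho>: "\<forall>x. \<forall>\<sigma>\<in>spins. \<rho> x \<sigma> \<ge> 0"
    and m: "m 0 \<in> {-1..1}" and \<kappa>: "0 \<le> \<kappa>"
    and \<Lambda>: "\<Lambda> = (\<Sum>v\<in>sites N. \<rho> (real_of_int (fst v) / real N) (snd v))" "0 < \<Lambda>"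
    and D: "D = (\<Sum>v\<in>sites N. real_of_int (snd v) * \<rho> (real_of_int (fst v) / real N) (snd v))"
  shows "measure_pmf.expectation (initial_law N \<rho>) (lyapunov C \<kappa> N m 0) \<le>
    4 * (D / \<Lambda> - m 0)\<^sup>2 + (32 + 6 * \<kappa>) / \<Lambda>"
proof -
  define r where "r v = \<rho> (real_of_int (fst v) / real N) (snd v)" for v :: "int \<times> int"
  have r0: "0 \<le> r v" if "v \<in> sites N" for v
    using that \<rho> by (auto simp: r_def sites_def)
  have law: "initial_law N \<rho> = Pi_pmf (sites N) 0 (\<lambda>v. Pois (r v))"
    unfolding initial_law_def r_def by (simp only: case_prod_beta')
  define S where "S \<eta> = ((\<Sum>v\<in>sites N. (real_of_int (snd v) - m 0) * real (\<eta> v)) - 0)\<^sup>2" for \<eta> :: config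
  define U where "U \<eta> = ((\<Sum>v\<in>sites N. 1 * real (\<eta> v)) - \<Lambda>)\<^sup>2" for \<eta> :: config
  note mom = Pi_Pois_second_moment[where r=r, OF finite_sites[of N] r0, folded law]
  have S: "integrable (initial_law N \<rho>) S"
    "measure_pmf.expectation (initial_law N \<rho>) S = (\<Sum>v\<in>sites N. (real_of_int (snd v) - m 0) * r v)\<^sup>2 + (\<Sum>v\<in>sites N. (real_of_int (snd v) - m 0)\<^sup>2 * r v)"
    using mom[where w="\<lambda>v. real_of_int (snd v) - m 0" and a=0]
    unfolding S_def by simp_all
  have U: "integrable (initial_law N \<rho>) U" "measure_pmf.expectation (initial_law N \<rho>) U = \<Lambda>"
    using mom[where w="\<lambda>_. 1" and a=\<Lambda>] unfolding U_def by (simp_all add: \<Lambda>(1) r_def)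
  have pt: "lyapunov C \<kappa> N m 0 \<eta> \<le> 4 / \<Lambda>\<^sup>2 * S \<eta> + (4 + \<kappa>) * (4 / \<Lambda>\<^sup>2) * U \<eta> + 2 * \<kappa> / \<Lambda>" for \<eta>
  proof -
    define n where "n = real (num_particles N \<eta>)"
    have n: "n = (\<Sum>v\<in>sites N. 1 * real (\<eta> v))" by (simp add: n_def num_particles_def)
    have S0: "0 \<le> S \<eta>" and U0: "0 \<le> U \<eta>" by (simp_all add: S_def U_def)
    show ?thesis
    proof (cases "\<Lambda> / 2 \<le> n")
      case True
      then have n0: "0 < n" using \<Lambda>(2) by simp
      \<comment> \<open>Centring the weights at \<open>m 0\<close> writes the deviation as a linear
        statistic divided by n.\<close>
      have "magnetization N \<eta> - m 0 = (\<Sum>v\<in>sites N. (real_of_int (snd v) - m 0) * real (\<eta> v)) / n"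
        using n0 unfolding magnetization_altdef n_def[symmetric]
        by (simp add: left_diff_distrib sum_subtractf diff_divide_distrib n flip: sum_distrib_left)
      then have "(magnetization N \<eta> - m 0)\<^sup>2 = S \<eta> / n\<^sup>2" by (simp add: S_def power_divide)
      also have "\<dots> \<le> S \<eta> / (\<Lambda> / 2)\<^sup>2"
        using True \<Lambda>(2) S0 by (intro divide_left_mono power_mono mult_pos_pos) auto
      also have "\<dots> = 4 / \<Lambda>\<^sup>2 * S \<eta>" by (simp add: power_divide)
      finally have 1: "(magnetization N \<eta> - m 0)\<^sup>2 \<le> 4 / \<Lambda>\<^sup>2 * S \<eta>" .
      have "\<kappa> / (n + 1) \<le> \<kappa> / (\<Lambda> / 2)"
        using True \<Lambda>(2) \<kappa> by (intro divide_left_mono) auto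
      then have 2: "\<kappa> / (n + 1) \<le> 2 * \<kappa> / \<Lambda>" by (simp add: mult.commute)
      have 3: "0 \<le> (4 + \<kappa>) * (4 / \<Lambda>\<^sup>2) * U \<eta>" using \<kappa> U0 by simp
      show ?thesis using 1 2 3 by (simp add: lyapunov_def n_def)
    next
      case False
      \<comment> \<open>With too few particles U is at least \<Lambda>^2 / 4, so the term containing
        it already exceeds 4 + \<kappa>.\<close>
      then have "(\<Lambda> / 2)\<^sup>2 \<le> (\<Lambda> - n)\<^sup>2" using \<Lambda>(2) by (intro power_mono) auto
      then have "\<Lambda>\<^sup>2 / 4 \<le> U \<eta>" by (simp add: U_def n power2_commute power_divide)
      then have "1 \<le> 4 / \<Lambda>\<^sup>2 * U \<eta>" using \<Lambda>(2) by (simp add: field_simps)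
      then have "(4 + \<kappa>) * 1 \<le> (4 + \<kappa>) * (4 / \<Lambda>\<^sup>2 * U \<eta>)" using \<kappa> by (intro mult_left_mono) auto
      moreover have "lyapunov C \<kappa> N m 0 \<eta> \<le> 4 + \<kappa>"
        using lyapunov_bounds(2)[of m 0 \<kappa> 0 N \<eta>] m \<kappa> by (simp add: lyapunov_def)
      moreover have "0 \<le> 4 / \<Lambda>\<^sup>2 * S \<eta>" "0 \<le> 2 * \<kappa> / \<Lambda>" using S0 \<kappa> \<Lambda>(2) by auto
      moreover have "x \<le> s + u + k" if "a \<le> u" "x \<le> a" "0 \<le> s" "0 \<le> k" for x s u k a :: real
        using that by linarith
      ultimately show ?thesis unfolding mult.assoc mult_1_right by blast
    qed
  qed
  have "integrable (initial_law N \<rho>) (lyapunov C \<kappa> N m 0)"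
  proof (rule expectation_bounded(1)[where B="4 + \<kappa>"])
    fix \<eta>
    show "\<bar>lyapunov C \<kappa> N m 0 \<eta>\<bar> \<le> 4 + \<kappa>"
      using lyapunov_bounds[of m 0 \<kappa> 0 N \<eta>] m \<kappa> by (simp add: lyapunov_def)
  qed
  then have "measure_pmf.expectation (initial_law N \<rho>) (lyapunov C \<kappa> N m 0) \<le>
      measure_pmf.expectation (initial_law N \<rho>) (\<lambda>\<eta>. 4 / \<Lambda>\<^sup>2 * S \<eta> + (4 + \<kappa>) * (4 / \<Lambda>\<^sup>2) * U \<eta> + 2 * \<kappa> / \<Lambda>)"
    using S U by (intro integral_mono pt) auto
  also have "\<dots> = 4 / \<Lambda>\<^sup>2 * ((\<Sum>v\<in>sites N. (real_of_int (snd v) - m 0) * r v)\<^sup>2 + (\<Sum>v\<in>sites N. (real_of_int (snd v) - m 0)\<^sup>2 * r v))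
      + (4 + \<kappa>) * (4 / \<Lambda>\<^sup>2) * \<Lambda> + 2 * \<kappa> / \<Lambda>"
    using S U by simp
  also have "(\<Sum>v\<in>sites N. (real_of_int (snd v) - m 0) * r v) = D - m 0 * \<Lambda>"
    by (simp add: D \<Lambda>(1) r_def left_diff_distrib sum_subtractf sum_distrib_left)
  also have "(\<Sum>v\<in>sites N. (real_of_int (snd v) - m 0)\<^sup>2 * r v) \<le> (\<Sum>v\<in>sites N. 4 * r v)"
  proof (intro sum_mono mult_right_mono r0)
    fix v assume "v \<in> sites N"
    then have "\<bar>real_of_int (snd v) - m 0\<bar> \<le> 2" using m by (auto simp: sites_def spins_def)
    then show "(real_of_int (snd v) - m 0)\<^sup>2 \<le> 4" using power2_le_iff_abs_le[of 2 "real_of_int (snd v) - m 0"] by simp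
  qed
  also have "(\<Sum>v\<in>sites N. 4 * r v) = 4 * \<Lambda>" by (simp add: \<Lambda>(1) r_def sum_distrib_left)
  \<comment> \<open>The terms of order 1 / \<Lambda> are 16 from the variance, 4 (4 + \<kappa>) from
    the particle number and 2 \<kappa> from the correction, in all 32 + 6 \<kappa>.\<close>
  also have "4 / \<Lambda>\<^sup>2 * ((D - m 0 * \<Lambda>)\<^sup>2 + 4 * \<Lambda>) + (4 + \<kappa>) * (4 / \<Lambda>\<^sup>2) * \<Lambda> + 2 * \<kappa> / \<Lambda> =
      4 * ((D - m 0 * \<Lambda>) / \<Lambda>)\<^sup>2 + (32 + 6 * \<kappa>) / \<Lambda>"
    using \<Lambda>(2) by (simp add: power_divide power2_eq_square field_simps)
  also have "(D - m 0 * \<Lambda>) / \<Lambda> = D / \<Lambda> - m 0" using \<Lambda>(2) by (simp add: field_simps)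
  finally show ?thesis by (simp add: divide_right_mono mult_left_mono add_mono)
qed

text \<open>Divided by \<open>N\<close>, both \<Lambda> and \<open>D\<close> are Riemann sums. Their
  quotient converges to the magnetization of the density, and \<Lambda> grows like \<open>N\<close>
  because the total mass is positive.\<close>

lemma initial_lyapunov_tendsto:
  fixes m :: "real \<Rightarrow> real"
  assumes sm: "smooth_on_V \<rho>" and \<rho>: "\<forall>x. \<forall>\<sigma>\<in>spins. \<rho> x \<sigma> \<ge> 0" and Z: "L2_inner \<rho> (\<lambda>x \<sigma>. 1) > 0"
    and m: "m 0 \<in> {-1..1}" "m 0 = density_magnetization \<rho>" and \<kappa>: "0 \<le> \<kappa>"
  shows "(\<lambda>N. measure_pmf.expectation (initial_law N \<rho>) (lyapunov C \<kappa> N m 0)) \<longlonglongrightarrow> 0"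
proof -
  define I where "I \<sigma> = integral {0..1} (\<lambda>x. \<rho> x \<sigma>)" for \<sigma>
  have c: "continuous_on {0..1} (\<lambda>x. \<rho> x \<sigma>)" if "\<sigma> \<in> spins" for \<sigma>
    by (rule smooth_on_V_continuous[OF sm that])
  have s: "(1::int) \<in> spins" "(-1::int) \<in> spins" by (auto simp: spins_def)
  have inner: "L2_inner \<rho> (\<lambda>x. g) = g 1 * I 1 + g (-1) * I (-1)" for g
  proof -
    have "(LBINT x:{0..1}. \<rho> x \<sigma> * g \<sigma>) = g \<sigma> * I \<sigma>" if "\<sigma> \<in> spins" for \<sigma>
      using LBINT_eq_integral[OF c[OF that]] by (simp add: I_def mult.commute)
    then have "L2_inner \<rho> (\<lambda>x. g) = (\<Sum>\<sigma>\<in>spins. g \<sigma> * I \<sigma>)"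
      unfolding L2_inner_def by (intro sum.cong refl)
    then show ?thesis by (simp add: spins_def)
  qed
  have Zp: "0 < I 1 + I (-1)" using Z inner[of "\<lambda>_. 1"] by simp
  have m0: "m 0 = (I 1 - I (-1)) / (I 1 + I (-1))"
    unfolding m(2) density_magnetization_def using inner[of "\<lambda>_. 1"] inner[of "\<lambda>\<sigma>. (if \<sigma> = 1 then 1 else 0) - (if \<sigma> = - 1 then 1 else 0)"] by simp
  define \<Lambda> where "\<Lambda> N = (\<Sum>v\<in>sites N. \<rho> (real_of_int (fst v) / real N) (snd v))" for N
  define D where "D N = (\<Sum>v\<in>sites N. real_of_int (snd v) * \<rho> (real_of_int (fst v) / real N) (snd v))" for N
  have \<Lambda>: "(\<lambda>N. \<Lambda> N / real N) \<longlonglongrightarrow> I 1 + I (-1)"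
    unfolding \<Lambda>_def sum_sites I_def add_divide_distrib fst_conv snd_conv
    by (intro tendsto_add riemann_sum_tendsto c s)
  have D: "(\<lambda>N. D N / real N) \<longlonglongrightarrow> I 1 - I (-1)"
  proof -
    have "(\<lambda>N. (\<Sum>x\<in>{0..<int N}. \<rho> (real_of_int x / real N) 1) / real N - (\<Sum>x\<in>{0..<int N}. \<rho> (real_of_int x / real N) (-1)) / real N) \<longlonglongrightarrow> I 1 - I (-1)"
      unfolding I_def by (intro tendsto_diff riemann_sum_tendsto c s)
    then show ?thesis unfolding D_def sum_sites by (simp add: sum_negf diff_divide_distrib)
  qed
  have pos: "\<forall>\<^sub>F N in sequentially. 0 < \<Lambda> N"
    using order_tendstoD(1)[OF \<Lambda> Zp] by eventually_elim (simp add: zero_less_divide_iff)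
  have Npos: "\<forall>\<^sub>F N in sequentially. 0 < real N" using eventually_gt_at_top[of 0] by eventually_elim simp
  have "(\<lambda>N. (D N / real N) / (\<Lambda> N / real N)) \<longlonglongrightarrow> m 0"
    unfolding m0 using Zp by (intro tendsto_divide D \<Lambda>) auto
  moreover have "\<forall>\<^sub>F N in sequentially. (D N / real N) / (\<Lambda> N / real N) = D N / \<Lambda> N"
    using Npos by eventually_elim simp
  ultimately have q: "(\<lambda>N. D N / \<Lambda> N) \<longlonglongrightarrow> m 0" by (rule Lim_transform_eventually)
  have inv: "(\<lambda>N. (32 + 6 * \<kappa>) / \<Lambda> N) \<longlonglongrightarrow> 0"
  proof -
    have "(\<lambda>N. ((32 + 6 * \<kappa>) / real N) / (\<Lambda> N / real N)) \<longlonglongrightarrow> 0 / (I 1 + I (-1))"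
      using Zp by (intro tendsto_divide lim_const_over_n \<Lambda>) auto
    then have "(\<lambda>N. ((32 + 6 * \<kappa>) / real N) / (\<Lambda> N / real N)) \<longlonglongrightarrow> 0" by (simp only: div_0)
    moreover have "\<forall>\<^sub>F N in sequentially. ((32 + 6 * \<kappa>) / real N) / (\<Lambda> N / real N) = (32 + 6 * \<kappa>) / \<Lambda> N"
      using Npos by eventually_elim simp
    ultimately show ?thesis by (rule Lim_transform_eventually)
  qed
  have "(\<lambda>N. 4 * (D N / \<Lambda> N - m 0)\<^sup>2 + (32 + 6 * \<kappa>) / \<Lambda> N) \<longlonglongrightarrow> 4 * (m 0 - m 0)\<^sup>2 + 0"
    by (intro tendsto_intros q inv)
  then have lim: "(\<lambda>N. 4 * (D N / \<Lambda> N - m 0)\<^sup>2 + (32 + 6 * \<kappa>) / \<Lambda> N) \<longlonglongrightarrow> 0" by simp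
  show ?thesis
  proof (rule tendsto_sandwich[OF _ _ tendsto_const lim])
    show "\<forall>\<^sub>F N in sequentially. 0 \<le> measure_pmf.expectation (initial_law N \<rho>) (lyapunov C \<kappa> N m 0)"
      using \<kappa> by (intro always_eventually allI integral_nonneg_AE AE_I2) (simp add: lyapunov_def)
    show "\<forall>\<^sub>F N in sequentially. measure_pmf.expectation (initial_law N \<rho>) (lyapunov C \<kappa> N m 0) \<le> 4 * (D N / \<Lambda> N - m 0)\<^sup>2 + (32 + 6 * \<kappa>) / \<Lambda> N"
      using pos by eventually_elim (rule initial_lyapunov_bound[where m=m, OF \<rho> m(1) \<kappa> \<Lambda>_def _ D_def])
  qed
qed

section \<open>The magnetization of a weak solution\<close>

lemma smooth_on_time_V_const: "smooth_on_time_V T (\<lambda>t x. g)"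
  unfolding smooth_on_time_V_def
proof (intro ballI conjI)
  fix \<sigma>
  define D where "D i j t x = (if i = 0 \<and> j = 0 then g \<sigma> else 0)" for i j :: nat and t x :: real
  show "\<exists>D :: nat \<Rightarrow> nat \<Rightarrow> real \<Rightarrow> real \<Rightarrow> real.
      (\<forall>t\<in>{0..T}. \<forall>x. D 0 0 t x = g \<sigma>) \<and>
      (\<forall>i j. continuous_on ({0..T} \<times> UNIV) (\<lambda>(t, x). D i j t x) \<and>
        (\<forall>t\<in>{0..T}. \<forall>x.
          ((\<lambda>s. D i j s x) has_real_derivative D (Suc i) j t x) (at t within {0..T}) \<and>
          ((\<lambda>y. D i j t y) has_real_derivative D i (Suc j) t x) (at x)))"
    by (intro exI[of _ D]) (auto simp: D_def case_prod_beta)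
qed simp

lemma weak_integrand_const:
  assumes "0 < T" "s \<in> {0..T}"
  shows "weak_integrand T c (\<lambda>t x. g) m s x \<sigma> = c \<sigma> m * (g (-\<sigma>) - g \<sigma>)"
proof -
  have "vector_derivative (\<lambda>u. g \<sigma>) (at s within {0..T}) = 0"
    by (rule vector_derivative_within_closed_interval[OF assms]) simp
  then show ?thesis by (simp add: weak_integrand_def)
qed

definition spin_mass :: "(real \<Rightarrow> int \<Rightarrow> real) \<Rightarrow> int \<Rightarrow> real" where
  "spin_mass q \<sigma> = (LBINT x:{0..1}. q x \<sigma>)"

lemma L2_inner_const: "L2_inner q (\<lambda>x. g) = spin_mass q 1 * g 1 + spin_mass q (-1) * g (-1)"
  by (simp add: L2_inner_def spins_def spin_mass_def)

lemma density_magnetization_altdef: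
  "density_magnetization q = (spin_mass q 1 - spin_mass q (-1)) / (spin_mass q 1 + spin_mass q (-1))"
  using L2_inner_const[of q "\<lambda>\<sigma>. (if \<sigma> = 1 then 1 else 0) - (if \<sigma> = - 1 then 1 else 0)"]
    L2_inner_const[of q "\<lambda>_. 1"]
  unfolding density_magnetization_def by simp

text \<open>Bootstrapping: an indefinite integral is continuous, which makes its integrand
  continuous and the integral differentiable.\<close>

lemma integral_equation_imp_ode:
  fixes m :: "real \<Rightarrow> real"
  assumes T: "0 < T"
    and F: "\<And>x. x \<in> {-1..1} \<Longrightarrow> \<bar>F x\<bar> \<le> B" "continuous_on {-1..1} F"
    and m: "\<And>t. t \<in> {0..T} \<Longrightarrow> m t \<in> {-1..1}"
    and int: "set_integrable lborel {0..T} (\<lambda>s. F (m s))"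
    and eq: "\<And>t. t \<in> {0..T} \<Longrightarrow> m t = m 0 + (LBINT s:{0..t}. F (m s))"
    and t: "t \<in> {0..T}"
  shows "(m has_real_derivative F (m t)) (at t within {0..T})"
proof -
  have i: "(\<lambda>s. F (m s)) integrable_on {0..T}"
    using set_borel_integral_eq_integral(1)[OF int] .
  have eq': "m u = m 0 + integral {0..u} (\<lambda>s. F (m s))" if "u \<in> {0..T}" for u
  proof -
    have "set_integrable lborel {0..u} (\<lambda>s. F (m s))"
      by (rule set_integrable_subset[OF int]) (use that in auto)
    from set_borel_integral_eq_integral(2)[OF this] eq[OF that] show ?thesis by simp
  qed
  have "continuous_on {0..T} (\<lambda>u. m 0 + integral {0..u} (\<lambda>s. F (m s)))"
    by (intro continuous_intros indefinite_integral_continuous_1 i)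
  then have cm: "continuous_on {0..T} m"
    by (rule continuous_on_eq) (rule eq'[symmetric])
  have "continuous_on {0..T} (\<lambda>s. F (m s))"
    by (rule continuous_on_compose2[OF F(2) cm]) (use m in auto)
  from integral_has_real_derivative[OF this t]
  have "((\<lambda>u. m 0 + integral {0..u} (\<lambda>s. F (m s))) has_real_derivative 0 + F (m t)) (at t within {0..T})"
    by (intro DERIV_add DERIV_const)
  then have "((\<lambda>u. m 0 + integral {0..u} (\<lambda>s. F (m s))) has_real_derivative F (m t)) (at t within {0..T})"
    by simp
  then show ?thesis
    by (rule has_field_derivative_transform_within[OF _ zero_less_one t]) (rule eq'[symmetric])
qed

text \<open>Test functions of the spin alone have vanishing time and space derivatives. The
  transport term drops out of the weak form and a closed system for the masses of the two spins
  remains.\<close>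

lemma
  assumes r: "weak_solution T c \<rho> r" and T: "0 < T" and sm: "smooth_on_V \<rho>" and Z: "L2_inner \<rho> (\<lambda>x \<sigma>. 1) > 0"
    and b: "\<And>\<sigma> m. \<sigma> \<in> spins \<Longrightarrow> m \<in> {-1..1} \<Longrightarrow> 0 \<le> c \<sigma> m \<and> c \<sigma> m \<le> b"
    and L: "\<And>\<sigma> m m'. \<sigma> \<in> spins \<Longrightarrow> m \<in> {-1..1} \<Longrightarrow> m' \<in> {-1..1} \<Longrightarrow> \<bar>c \<sigma> m - c \<sigma> m'\<bar> \<le> L * \<bar>m - m'\<bar>"
  shows weak_solution_magnetization_0: "density_magnetization (r 0) = density_magnetization \<rho>"
    and weak_solution_magnetization_bounds: "t \<in> {0..T} \<Longrightarrow> density_magnetization (r t) \<in> {-1..1}"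
    and weak_solution_magnetization_ode: "t \<in> {0..T} \<Longrightarrow>
      ((\<lambda>s. density_magnetization (r s)) has_real_derivative drift c (density_magnetization (r t)))
        (at t within {0..T})"
proof -
  let ?m = "\<lambda>t. density_magnetization (r t)"
  note r' = r[unfolded weak_solution_def]
  note r1 = conjunct1[OF r'] and r2 = conjunct1[OF conjunct2[OF r']] and r3 = conjunct2[OF conjunct2[OF r']]
  have s: "(1::int) \<in> spins" "(-1::int) \<in> spins" by (auto simp: spins_def)
  have sm0: "spin_mass (r 0) \<sigma> = spin_mass \<rho> \<sigma>" if "\<sigma> \<in> spins" for \<sigma>
    unfolding spin_mass_def set_lebesgue_integral_def
  proof (rule integral_cong_AE)
    have ae: "AE x in lborel. x \<in> {0..1} \<longrightarrow> r 0 x \<sigma> = \<rho> x \<sigma>" by (rule bspec[OF r2 that])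
    show ae': "AE x in lborel. indicat_real {0..1} x *\<^sub>R r 0 x \<sigma> = indicat_real {0..1} x *\<^sub>R \<rho> x \<sigma>"
      using ae by eventually_elim (auto split: split_indicator)
    have "set_integrable lborel {0..1} (\<lambda>x. r 0 x \<sigma>)" using bspec[OF bspec[OF r1, of 0] that] T by auto
    then show "(\<lambda>x. indicat_real {0..1} x *\<^sub>R r 0 x \<sigma>) \<in> borel_measurable lborel"
      by (simp add: set_integrable_def borel_measurable_integrable)
    show "(\<lambda>x. indicat_real {0..1} x *\<^sub>R \<rho> x \<sigma>) \<in> borel_measurable lborel"
      using borel_measurable_continuous_onI[OF smooth_on_V_continuous[OF sm that]] by simp
  qed
  then show m0: "?m 0 = density_magnetization \<rho>"
    using s by (simp add: density_magnetization_altdef)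
  have nn: "0 \<le> spin_mass (r t) \<sigma>" if "t \<in> {0..T}" "\<sigma> \<in> spins" for t \<sigma>
    unfolding spin_mass_def set_lebesgue_integral_def
    using bspec[OF bspec[OF r1 that(1)] that(2)] by (intro Bochner_Integration.integral_nonneg_AE AE_I2) (auto split: split_indicator)
  have weak: "set_integrable lborel {0..T} (\<lambda>s. L2_inner (r s) (\<lambda>x \<sigma>. c \<sigma> (?m s) * (g (-\<sigma>) - g \<sigma>)))"
    "t \<in> {0..T} \<Longrightarrow> L2_inner (r t) (\<lambda>x. g) = L2_inner (r 0) (\<lambda>x. g) +
      (LBINT s:{0..t}. L2_inner (r s) (\<lambda>x \<sigma>. c \<sigma> (?m s) * (g (-\<sigma>) - g \<sigma>)))" for g t
  proof -
    have G: "set_integrable lborel {0..T} (\<lambda>s. L2_inner (r s) (weak_integrand T c (\<lambda>t x. g) (?m s) s))"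
      "\<forall>t\<in>{0..T}. L2_inner (r t) (\<lambda>x. g) - L2_inner (r 0) (\<lambda>x. g) -
           (LBINT s:{0..t}. L2_inner (r s) (weak_integrand T c (\<lambda>t x. g) (?m s) s)) = 0"
      using mp[OF spec[OF r3] smooth_on_time_V_const[of T g]] by auto
    have eq: "L2_inner (r s) (weak_integrand T c (\<lambda>t x. g) (?m s) s) = L2_inner (r s) (\<lambda>x \<sigma>. c \<sigma> (?m s) * (g (-\<sigma>) - g \<sigma>))"
      if "s \<in> {0..T}" for s
      by (simp add: weak_integrand_const[OF T that] L2_inner_def)
    show "set_integrable lborel {0..T} (\<lambda>s. L2_inner (r s) (\<lambda>x \<sigma>. c \<sigma> (?m s) * (g (-\<sigma>) - g \<sigma>)))"
    proof -
      have "set_integrable lborel {0..T} (\<lambda>s. L2_inner (r s) (weak_integrand T c (\<lambda>t x. g) (?m s) s)) \<longleftrightarrow>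
          set_integrable lborel {0..T} (\<lambda>s. L2_inner (r s) (\<lambda>x \<sigma>. c \<sigma> (?m s) * (g (-\<sigma>) - g \<sigma>)))"
        by (rule set_integrable_cong[OF refl refl eq])
      with G(1) show ?thesis by blast
    qed
    assume t: "t \<in> {0..T}"
    have "(LBINT s:{0..t}. L2_inner (r s) (weak_integrand T c (\<lambda>t x. g) (?m s) s)) =
        (LBINT s:{0..t}. L2_inner (r s) (\<lambda>x \<sigma>. c \<sigma> (?m s) * (g (-\<sigma>) - g \<sigma>)))"
    proof (rule set_lebesgue_integral_cong)
      show "\<forall>s. s \<in> {0..t} \<longrightarrow> L2_inner (r s) (weak_integrand T c (\<lambda>t x. g) (?m s) s) =
          L2_inner (r s) (\<lambda>x \<sigma>. c \<sigma> (?m s) * (g (-\<sigma>) - g \<sigma>))"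
        using t by (intro allI impI eq) simp
    qed simp
    then show "L2_inner (r t) (\<lambda>x. g) = L2_inner (r 0) (\<lambda>x. g) +
      (LBINT s:{0..t}. L2_inner (r s) (\<lambda>x \<sigma>. c \<sigma> (?m s) * (g (-\<sigma>) - g \<sigma>)))"
      using bspec[OF G(2) t] by linarith
  qed
  define Z0 where "Z0 = L2_inner \<rho> (\<lambda>x \<sigma>. 1)"
  \<comment> \<open>The test function 1 makes the exchange term vanish, so the denominator of the
    magnetization is constant in time.\<close>
  have mass: "spin_mass (r t) 1 + spin_mass (r t) (-1) = Z0" if "t \<in> {0..T}" for t
  proof -
    have "L2_inner (r t) (\<lambda>x \<sigma>. 1) = L2_inner (r 0) (\<lambda>x \<sigma>. 1)"
      using weak(2)[OF that, of "\<lambda>_. 1"] L2_inner_const[of _ "\<lambda>_. 0"] by simp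
    then show ?thesis
      using L2_inner_const[of _ "\<lambda>_. 1"] sm0 s by (simp add: Z0_def)
  qed
  have Zp: "0 < Z0" using Z by (simp add: Z0_def)
  have mt: "?m t = (spin_mass (r t) 1 - spin_mass (r t) (-1)) / Z0" if "t \<in> {0..T}" for t
    by (simp add: density_magnetization_altdef mass[OF that])
  have sp: "spin_mass (r t) 1 = Z0 * (1 + ?m t) / 2" "spin_mass (r t) (-1) = Z0 * (1 - ?m t) / 2" if "t \<in> {0..T}" for t
  proof -
    have "Z0 * ?m t = spin_mass (r t) 1 - spin_mass (r t) (-1)" using mt[OF that] Zp by simp
    with mass[OF that] show "spin_mass (r t) 1 = Z0 * (1 + ?m t) / 2" "spin_mass (r t) (-1) = Z0 * (1 - ?m t) / 2"
      by (simp_all add: distrib_left right_diff_distrib)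
  qed
  show bounds: "?m t \<in> {-1..1}" if "t \<in> {0..T}" for t
    using nn[OF that s(1)] nn[OF that s(2)] unfolding sp[OF that] using Zp by (auto simp: zero_le_mult_iff)
  \<comment> \<open>For the spin as test function the exchange term is -2 \<sigma> c(\<sigma>, m);
    weighted with the masses Z0 (1 + m) / 2 and Z0 (1 - m) / 2 it becomes Z0 times the
    drift.\<close>
  define g :: "int \<Rightarrow> real" where "g = (\<lambda>\<sigma>. real_of_int \<sigma>)"
  have flow: "L2_inner (r t) (\<lambda>x \<sigma>. c \<sigma> (?m t) * (g (-\<sigma>) - g \<sigma>)) = Z0 * drift c (?m t)" if "t \<in> {0..T}" for t
    unfolding L2_inner_const sp[OF that] by (simp add: g_def drift_def field_simps)
  have lhs: "L2_inner (r t) (\<lambda>x. g) = Z0 * ?m t" if "t \<in> {0..T}" for t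
    unfolding L2_inner_const sp[OF that] by (simp add: g_def field_simps)
  have int: "set_integrable lborel {0..T} (\<lambda>s. drift c (?m s))"
  proof -
    have "set_integrable lborel {0..T} (\<lambda>s. Z0 * drift c (?m s))"
    proof -
      have "set_integrable lborel {0..T} (\<lambda>s. L2_inner (r s) (\<lambda>x \<sigma>. c \<sigma> (?m s) * (g (-\<sigma>) - g \<sigma>))) \<longleftrightarrow>
          set_integrable lborel {0..T} (\<lambda>s. Z0 * drift c (?m s))"
        by (rule set_integrable_cong[OF refl refl flow])
      with weak(1)[of g] show ?thesis by blast
    qed
    then show ?thesis using Zp by (simp add: set_integrable_mult_right_iff)
  qed
  have eq: "?m t = ?m 0 + (LBINT s:{0..t}. drift c (?m s))" if t: "t \<in> {0..T}" for t
  proof -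
    have "(LBINT s:{0..t}. L2_inner (r s) (\<lambda>x \<sigma>. c \<sigma> (?m s) * (g (-\<sigma>) - g \<sigma>))) = (LBINT s:{0..t}. Z0 * drift c (?m s))"
    proof (rule set_lebesgue_integral_cong)
      show "\<forall>s. s \<in> {0..t} \<longrightarrow> L2_inner (r s) (\<lambda>x \<sigma>. c \<sigma> (?m s) * (g (-\<sigma>) - g \<sigma>)) = Z0 * drift c (?m s)"
        using t by (intro allI impI flow) simp
    qed simp
    then have "Z0 * ?m t = Z0 * ?m 0 + Z0 * (LBINT s:{0..t}. drift c (?m s))"
      using weak(2)[OF t, of g] lhs[OF t] lhs[of 0] T by simp
    then have "Z0 * ?m t = Z0 * (?m 0 + (LBINT s:{0..t}. drift c (?m s)))" by (simp add: distrib_left)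
    then show ?thesis using Zp by simp
  qed
  show "(?m has_real_derivative drift c (?m t)) (at t within {0..T})" if t: "t \<in> {0..T}"
  proof (rule integral_equation_imp_ode[OF T _ _ bounds int eq t])
    fix x :: real assume x: "x \<in> {-1..1}"
    show "\<bar>drift c x\<bar> \<le> 2 * b" by (rule drift_bounded[OF b L x x])
  next
    show "continuous_on {-1..1} (drift c)"
    proof (rule lipschitz_on_continuous_on[OF lipschitz_onI])
      have "0 \<le> b" using b[of 1 0] by (force simp: spins_def)
      moreover have "0 \<le> L" using L[of 1 0 1] by (simp add: spins_def)
      ultimately show "0 \<le> 4 * L + 2 * b" by simp
    qed (use drift_lipschitz[OF b L] in \<open>simp add: dist_real_def\<close>)
  qed
qed

section \<open>Existence of weak solutions\<close>

text \<open>One Picard step: integration raises the power and the factorial together, which makes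
  the iteration converge for every length of the time interval.\<close>

lemma integral_power_bound:
  fixes g :: "real \<Rightarrow> real"
  assumes "0 \<le> t" "continuous_on {0..t} g" "\<And>s. s \<in> {0..t} \<Longrightarrow> \<bar>g s\<bar> \<le> A * s ^ n / fact n"
  shows "\<bar>integral {0..t} g\<bar> \<le> A * t ^ Suc n / fact (Suc n)"
proof -
  have "((\<lambda>s. A * s ^ n / fact n) has_integral A * t ^ Suc n / fact (Suc n) - A * 0 ^ Suc n / fact (Suc n)) {0..t}"
  proof (rule fundamental_theorem_of_calculus[OF assms(1)])
    fix s
    have "((\<lambda>s. A * s ^ Suc n / fact (Suc n)) has_real_derivative A * s ^ n / fact n) (at s within {0..t})"
    proof -
      have "A * (real (Suc n) * s ^ n) / fact (Suc n) = A * s ^ n / fact n"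
        by (simp add: field_simps del: of_nat_Suc)
      with DERIV_cdivide[OF DERIV_cmult[OF DERIV_pow[of "Suc n" s "{0..t}"], of A], of "fact (Suc n)"]
      show ?thesis by (simp only: diff_Suc_Suc diff_zero)
    qed
    then show "((\<lambda>s. A * s ^ Suc n / fact (Suc n)) has_vector_derivative A * s ^ n / fact n) (at s within {0..t})"
      by (simp add: has_real_derivative_iff_has_vector_derivative)
  qed
  then have i: "((\<lambda>s. A * s ^ n / fact n) has_integral A * t ^ Suc n / fact (Suc n)) {0..t}" by simp
  have "norm (integral {0..t} g) \<le> integral {0..t} (\<lambda>s. A * s ^ n / fact n)"
    by (rule integral_norm_bound_integral)
      (use assms i in \<open>auto intro: integrable_continuous_real has_integral_integrable\<close>)
  also have "\<dots> = A * t ^ Suc n / fact (Suc n)" by (rule integral_unique[OF i])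
  finally show ?thesis by simp
qed

text \<open>The increments telescope and are dominated by an exponential series.\<close>

lemma uniform_limit_of_factorial_increments:
  fixes u :: "nat \<Rightarrow> 'a \<Rightarrow> real"
  assumes "\<And>n z. z \<in> X \<Longrightarrow> \<bar>u (Suc n) z - u n z\<bar> \<le> B * K ^ n / fact n"
  obtains l where "uniform_limit X u l sequentially"
proof -
  have "uniform_limit X (\<lambda>n z. \<Sum>i<n. u (Suc i) z - u i z) (\<lambda>z. \<Sum>i. u (Suc i) z - u i z) sequentially"
  proof (rule Weierstrass_m_test)
    show "summable (\<lambda>n. B * K ^ n / fact n)"
      using summable_mult[OF summable_exp[of K], of B] by (simp add: divide_inverse mult_ac)
  qed (use assms in auto)
  then have "uniform_limit X (\<lambda>n z. u 0 z + (\<Sum>i<n. u (Suc i) z - u i z)) (\<lambda>z. u 0 z + (\<Sum>i. u (Suc i) z - u i z)) sequentially"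
    by (intro uniform_limit_intros)
  moreover have "(\<lambda>n z. u 0 z + (\<Sum>i<n. u (Suc i) z - u i z)) = u"
  proof (intro ext)
    fix n z show "u 0 z + (\<Sum>i<n. u (Suc i) z - u i z) = u n z"
      using sum_lessThan_telescope[of "\<lambda>i. u i z" n] by simp
  qed
  ultimately have "uniform_limit X u (\<lambda>z. u 0 z + (\<Sum>i. u (Suc i) z - u i z)) sequentially"
    by simp
  then show thesis by (rule that)
qed

text \<open>Picard iteration for a Volterra equation along curves \<open>s \<mapsto> \<gamma> z s\<close>: it covers both the ordinary
  differential equation of the magnetization and the transport equation along characteristics.
  The class \<open>C\<close> records whatever regularity makes the integrals meaningful.\<close>

lemma volterra_fixed_point:
  fixes g :: "'z \<Rightarrow> real" and \<tau> :: "'z \<Rightarrow> real" and \<gamma> :: "'z \<Rightarrow> real \<Rightarrow> 'z"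
    and H :: "'z \<Rightarrow> real \<Rightarrow> real \<Rightarrow> real"
  defines "\<Phi> \<equiv> \<lambda>u z. g z + integral {0..\<tau> z} (\<lambda>s. H z s (u (\<gamma> z s)))"
  assumes \<tau>: "\<And>z. z \<in> X \<Longrightarrow> 0 \<le> \<tau> z \<and> \<tau> z \<le> T"
    and \<gamma>: "\<And>z s. z \<in> X \<Longrightarrow> s \<in> {0..\<tau> z} \<Longrightarrow> \<gamma> z s \<in> X \<and> \<tau> (\<gamma> z s) = s"
    and K: "0 \<le> K" "\<And>z s y y'. z \<in> X \<Longrightarrow> s \<in> {0..\<tau> z} \<Longrightarrow> \<bar>H z s y - H z s y'\<bar> \<le> K * \<bar>y - y'\<bar>"
    and B: "\<And>z s. z \<in> X \<Longrightarrow> s \<in> {0..\<tau> z} \<Longrightarrow> \<bar>H z s (g (\<gamma> z s))\<bar> \<le> B"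
    and C: "C g" "\<And>u. C u \<Longrightarrow> C (\<Phi> u)"
      "\<And>u z. C u \<Longrightarrow> z \<in> X \<Longrightarrow> continuous_on {0..\<tau> z} (\<lambda>s. H z s (u (\<gamma> z s)))"
      "\<And>v l. (\<And>n. C (v n)) \<Longrightarrow> uniform_limit X v l sequentially \<Longrightarrow> C l"
  obtains u where "C u" "\<And>z. z \<in> X \<Longrightarrow> u z = g z + integral {0..\<tau> z} (\<lambda>s. H z s (u (\<gamma> z s)))"
proof -
  define u where "u n = (\<Phi> ^^ n) g" for n
  have u0: "u 0 = g" and uS: "u (Suc n) = \<Phi> (u n)" for n by (simp_all add: u_def)
  have Cu: "C (u n)" for n by (induction n) (simp_all add: u0 uS C)
  have diff: "\<Phi> v z - \<Phi> w z = integral {0..\<tau> z} (\<lambda>s. H z s (v (\<gamma> z s)) - H z s (w (\<gamma> z s)))"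
    if "C v" "C w" "z \<in> X" for v w z
    unfolding \<Phi>_def using C(3)[OF that(1,3)] C(3)[OF that(2,3)]
    by (simp add: integral_diff integrable_continuous_real)
  \<comment> \<open>By \<tau> (\<gamma> z s) = s, the bound for the previous iterate at \<gamma> z s
    is a power of \<open>s\<close>, ready to be integrated once more.\<close>
  have inc: "\<bar>u (Suc n) z - u n z\<bar> \<le> B * K ^ n * \<tau> z ^ Suc n / fact (Suc n)" if "z \<in> X" for n z
    using that
  proof (induction n arbitrary: z)
    case 0
    have "\<bar>integral {0..\<tau> z} (\<lambda>s. H z s (g (\<gamma> z s)))\<bar> \<le> B * \<tau> z ^ Suc 0 / fact (Suc 0)"
      by (rule integral_power_bound) (use \<tau> 0 B C in auto)
    then show ?case by (simp add: uS u0 \<Phi>_def)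
  next
    case (Suc n)
    have "\<bar>integral {0..\<tau> z} (\<lambda>s. H z s (u (Suc n) (\<gamma> z s)) - H z s (u n (\<gamma> z s)))\<bar> \<le> B * K ^ Suc n * \<tau> z ^ Suc (Suc n) / fact (Suc (Suc n))"
    proof (rule integral_power_bound)
      show "0 \<le> \<tau> z" using \<tau> Suc by auto
      show "continuous_on {0..\<tau> z} (\<lambda>s. H z s (u (Suc n) (\<gamma> z s)) - H z s (u n (\<gamma> z s)))"
        by (intro continuous_on_diff C(3) Cu Suc)
      fix s assume s: "s \<in> {0..\<tau> z}"
      have "\<bar>H z s (u (Suc n) (\<gamma> z s)) - H z s (u n (\<gamma> z s))\<bar> \<le> K * \<bar>u (Suc n) (\<gamma> z s) - u n (\<gamma> z s)\<bar>"
        by (rule K(2)[OF Suc(2) s])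
      also have "\<dots> \<le> K * (B * K ^ n * \<tau> (\<gamma> z s) ^ Suc n / fact (Suc n))"
        using \<gamma>[OF Suc(2) s] by (intro mult_left_mono Suc.IH K) auto
      also have "\<tau> (\<gamma> z s) = s" using \<gamma>[OF Suc(2) s] by simp
      finally show "\<bar>H z s (u (Suc n) (\<gamma> z s)) - H z s (u n (\<gamma> z s))\<bar> \<le> B * K ^ Suc n * s ^ Suc n / fact (Suc n)"
        by (simp add: mult_ac)
    qed
    then show ?case using diff[OF Cu[of "Suc n"] Cu[of n] Suc(2)] by (simp only: uS[of "Suc n"] uS[of n, symmetric])
  qed
  \<comment> \<open>The dependence on \<open>z\<close> is removed. Absolute values are taken because
    the signs of \<open>B\<close> and \<open>T\<close> are known only through the elements of
    \<open>X\<close>.\<close>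
  have "\<bar>u (Suc n) z - u n z\<bar> \<le> \<bar>B\<bar> * \<bar>T\<bar> * (K * \<bar>T\<bar>) ^ n / fact n" if z: "z \<in> X" for n z
  proof -
    have t: "0 \<le> \<tau> z" "\<tau> z \<le> \<bar>T\<bar>" using \<tau>[OF z] by auto
    have "\<bar>u (Suc n) z - u n z\<bar> \<le> B * K ^ n * \<tau> z ^ Suc n / fact (Suc n)" by (rule inc[OF z])
    also have "\<dots> \<le> \<bar>B\<bar> * K ^ n * \<bar>T\<bar> ^ Suc n / fact n"
    proof (rule frac_le)
      have "B * (K ^ n * \<tau> z ^ Suc n) \<le> \<bar>B\<bar> * (K ^ n * \<bar>T\<bar> ^ Suc n)"
        using t K by (intro mult_mono power_mono) auto
      then show "B * K ^ n * \<tau> z ^ Suc n \<le> \<bar>B\<bar> * K ^ n * \<bar>T\<bar> ^ Suc n" by (simp add: mult.assoc)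
      show "0 \<le> \<bar>B\<bar> * K ^ n * \<bar>T\<bar> ^ Suc n" using K by simp
      show "(fact n :: real) \<le> fact (Suc n)" by (rule fact_mono) simp
    qed simp
    finally show ?thesis by (simp add: power_mult_distrib mult_ac)
  qed
  then obtain l where l: "uniform_limit X u l sequentially"
    by (rule uniform_limit_of_factorial_increments)
  have Cl: "C l" by (rule C(4)[OF Cu l])
  have "l z = \<Phi> l z" if z: "z \<in> X" for z
  proof -
    have "(\<lambda>n. \<Phi> (u n) z) \<longlonglongrightarrow> \<Phi> l z"
    proof (rule LIMSEQ_I)
      fix e :: real assume e: "0 < e"
      \<comment> \<open>The \<open>+ 1\<close> covers the case K \<bar>T\<bar> = 0 and makes K d
        \<bar>T\<bar> strictly smaller than \<open>e\<close>.\<close>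
      define d where "d = e / (K * \<bar>T\<bar> + 1)"
      have KT: "0 \<le> K * \<bar>T\<bar>" using K by simp
      have d: "0 < d" using e KT by (simp add: d_def)
      from uniform_limitD[OF l d] obtain n0 where n0: "\<And>n z. n \<ge> n0 \<Longrightarrow> z \<in> X \<Longrightarrow> dist (u n z) (l z) < d"
        by (auto simp: eventually_sequentially)
      have "\<bar>\<Phi> (u n) z - \<Phi> l z\<bar> < e" if n: "n \<ge> n0" for n
      proof -
        have "\<bar>integral {0..\<tau> z} (\<lambda>s. H z s (u n (\<gamma> z s)) - H z s (l (\<gamma> z s)))\<bar> \<le> (K * d) * \<tau> z ^ Suc 0 / fact (Suc 0)"
        proof (rule integral_power_bound)
          show "0 \<le> \<tau> z" using \<tau> z by auto
          show "continuous_on {0..\<tau> z} (\<lambda>s. H z s (u n (\<gamma> z s)) - H z s (l (\<gamma> z s)))"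
            by (intro continuous_on_diff C(3) Cu Cl z)
          fix s assume s: "s \<in> {0..\<tau> z}"
          have "\<bar>H z s (u n (\<gamma> z s)) - H z s (l (\<gamma> z s))\<bar> \<le> K * \<bar>u n (\<gamma> z s) - l (\<gamma> z s)\<bar>"
            by (rule K(2)[OF z s])
          also have "\<dots> \<le> K * d"
            using n0[OF n, of "\<gamma> z s"] \<gamma>[OF z s] by (intro mult_left_mono K) (auto simp: dist_real_def)
          finally show "\<bar>H z s (u n (\<gamma> z s)) - H z s (l (\<gamma> z s))\<bar> \<le> K * d * s ^ 0 / fact 0" by simp
        qed
        then have "\<bar>\<Phi> (u n) z - \<Phi> l z\<bar> \<le> K * d * \<tau> z" using diff[OF Cu Cl z] by simp
        also have "\<dots> \<le> K * d * \<bar>T\<bar>" using \<tau>[OF z] K d by (intro mult_left_mono) auto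
        also have "\<dots> < e"
        proof -
          have "K * d * \<bar>T\<bar> = e * (K * \<bar>T\<bar>) / (K * \<bar>T\<bar> + 1)" by (simp add: d_def mult_ac)
          then show ?thesis using e KT by (simp add: divide_less_eq add_nonneg_pos distrib_left)
        qed
        finally show ?thesis .
      qed
      then show "\<exists>n0. \<forall>n\<ge>n0. norm (\<Phi> (u n) z - \<Phi> l z) < e" by auto
    qed
    then have "(\<lambda>n. u (Suc n) z) \<longlonglongrightarrow> \<Phi> l z" by (simp add: uS)
    moreover have "(\<lambda>n. u (Suc n) z) \<longlonglongrightarrow> l z"
      by (rule LIMSEQ_Suc[OF tendsto_uniform_limitI[OF l z]])
    ultimately show ?thesis by (rule LIMSEQ_unique[symmetric])
  qed
  then show thesis using Cl that unfolding \<Phi>_def by blast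
qed

lemma ode_existence:
  fixes F :: "real \<Rightarrow> real"
  assumes K: "0 \<le> K" "\<And>x y. \<bar>F x - F y\<bar> \<le> K * \<bar>x - y\<bar>"
  obtains m where "m 0 = m0" "\<And>t. t \<in> {0..T} \<Longrightarrow> (m has_real_derivative F (m t)) (at t within {0..T})"
proof -
  have cF: "continuous_on UNIV F"
    by (rule lipschitz_on_continuous_on[OF lipschitz_onI[where L=K]]) (use K in \<open>auto simp: dist_real_def\<close>)
  have cc: "continuous_on S (\<lambda>s. F (u s))" if "continuous_on S u" for S and u :: "real \<Rightarrow> real"
    by (rule continuous_on_compose2[OF cF that]) simp
  obtain m where m: "continuous_on {0..T} m" "\<And>t. t \<in> {0..T} \<Longrightarrow> m t = m0 + integral {0..t} (\<lambda>s. F (m s))"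
  proof (rule volterra_fixed_point[where X="{0..T}" and \<tau>="\<lambda>t. t" and \<gamma>="\<lambda>t s. s" and H="\<lambda>t s. F" and g="\<lambda>_. m0"
        and C="continuous_on {0..T}" and K=K and B="\<bar>F m0\<bar>" and T=T])
    fix u :: "real \<Rightarrow> real" assume u: "continuous_on {0..T} u"
    show "continuous_on {0..T} (\<lambda>t. m0 + integral {0..t} (\<lambda>s. F (u s)))"
      by (intro continuous_intros indefinite_integral_continuous_1 integrable_continuous_real cc u)
    fix t assume "t \<in> {0..T}"
    then show "continuous_on {0..t} (\<lambda>s. F (u s))"
      by (intro cc continuous_on_subset[OF u]) auto
  next
    fix v :: "nat \<Rightarrow> real \<Rightarrow> real" and l
    assume "\<And>n. continuous_on {0..T} (v n)" "uniform_limit {0..T} v l sequentially"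
    then show "continuous_on {0..T} l"
      by (intro uniform_limit_theorem[where f=v and F=sequentially]) auto
  qed (use K in auto)
  show thesis
  proof (cases "0 \<le> T")
    case True
    show thesis
    proof (rule that)
      show "m 0 = m0" using m(2)[of 0] True by simp
      fix t assume t: "t \<in> {0..T}"
      have "((\<lambda>t. m0 + integral {0..t} (\<lambda>s. F (m s))) has_real_derivative 0 + F (m t)) (at t within {0..T})"
        by (intro DERIV_add DERIV_const integral_has_real_derivative cc m t)
      then have "((\<lambda>t. m0 + integral {0..t} (\<lambda>s. F (m s))) has_real_derivative F (m t)) (at t within {0..T})" by simp
      then show "(m has_real_derivative F (m t)) (at t within {0..T})"
        by (rule has_field_derivative_transform_within[OF _ zero_less_one t]) (rule m(2)[symmetric])
    qed
  next
    case False
    then show thesis by (intro that[of "\<lambda>_. m0"]) auto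
  qed
qed

text \<open>The substitution s = t \<theta> turns the variable upper limit into a parameter of the
  integrand over [0, 1]. At t = 0 the scaling breaks down, but both sides vanish.\<close>

lemma continuous_on_indefinite_integral_param:
  fixes h :: "real \<Rightarrow> 'a::topological_space \<Rightarrow> real"
  assumes h: "continuous_on ({0..T} \<times> UNIV) (\<lambda>(s, x). h s x)"
  shows "continuous_on ({0..T} \<times> UNIV) (\<lambda>(t, x). integral {0..t} (\<lambda>s. h s x))"
proof -
  have "continuous_on (({0..T} \<times> (UNIV :: 'a set)) \<times> cbox 0 1) (\<lambda>(p, \<theta>::real). h (fst p * \<theta>) (snd p))"
    unfolding case_prod_beta
  proof (rule continuous_on_compose2[OF h[unfolded case_prod_beta], of _ "\<lambda>q. (fst (fst q) * snd q, snd (fst q))", unfolded fst_conv snd_conv])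
    show "continuous_on (({0..T} \<times> UNIV) \<times> cbox 0 1) (\<lambda>q :: (real \<times> 'a) \<times> real. (fst (fst q) * snd q, snd (fst q)))"
      by (intro continuous_intros)
    show "(\<lambda>q :: (real \<times> 'a) \<times> real. (fst (fst q) * snd q, snd (fst q))) ` (({0..T} \<times> UNIV) \<times> cbox 0 1) \<subseteq> {0..T} \<times> UNIV"
      by (auto intro: order_trans[OF mult_left_le])
  qed
  from integral_continuous_on_param[OF this]
  have "continuous_on ({0..T} \<times> UNIV) (\<lambda>p. fst p * integral {0..1} (\<lambda>\<theta>. h (fst p * \<theta>) (snd p)))"
    by (intro continuous_intros) simp
  then show ?thesis
  proof (rule continuous_on_eq)
    fix p :: "real \<times> 'a" assume p: "p \<in> {0..T} \<times> UNIV"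
    obtain t x where tx: "p = (t, x)" by force
    with p have t: "t \<in> {0..T}" by simp
    show "fst p * integral {0..1} (\<lambda>\<theta>. h (fst p * \<theta>) (snd p)) = (case p of (t, x) \<Rightarrow> integral {0..t} (\<lambda>s. h s x))"
    proof (cases "t = 0")
      case True
      then show ?thesis by (simp add: tx)
    next
      case False
      with t have t0: "0 < t" by simp
      have "continuous_on {0..t} (\<lambda>s. h s x)"
        using t by (intro continuous_on_compose2[OF h[unfolded case_prod_beta], of _ "\<lambda>s. (s, x)", unfolded fst_conv snd_conv] continuous_intros) auto
      then have "((\<lambda>s. h s x) has_integral integral {0..t} (\<lambda>s. h s x)) {0..t}"
        by (intro integrable_integral integrable_continuous_real)
      from has_integral_stretch_real[OF this, of t] t0
      have "((\<lambda>\<theta>. h (t * \<theta>) x) has_integral integral {0..t} (\<lambda>s. h s x) / t) {0..1}"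
        by (simp add: image_divide_atLeastAtMost)
      then show ?thesis using t0 by (simp add: tx integral_unique)
    qed
  qed
qed


section \<open>Periodic functions and linear transport along characteristics\<close>

lemma periodic_int_shift:
  fixes f :: "real \<Rightarrow> 'a"
  assumes "\<And>x. f (x + 1) = f x"
  shows "f (x + of_int n) = f x"
proof (induction n rule: int_induct[where k=0])
  case base
  then show ?case by simp
next
  case (step1 i)
  then show ?case using assms[of "x + of_int i"] by (simp add: add.assoc)
next
  case (step2 i)
  then show ?case using assms[of "x + of_int (i - 1)"] by (simp add: add.assoc)
qed

text \<open>Only the fractional part \<open>d\<close> of the shift matters, and the overhang {1..1 +
  d} is moved back to {0..d}.\<close>

lemma integral_periodic_shift:
  fixes f :: "real \<Rightarrow> real"
  assumes f: "continuous_on UNIV f" and per: "\<And>x. f (x + 1) = f x"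
  shows "integral {0..1} (\<lambda>x. f (x + c)) = integral {0..1} f"
proof -
  define d where "d = frac c"
  have d: "0 \<le> d" "d < 1" by (simp_all add: d_def frac_lt_1)
  have "f (x + c) = f (x + d)" for x
    using periodic_int_shift[of f "x + d" "\<lfloor>c\<rfloor>", OF per] by (simp add: d_def frac_def)
  then have "integral {0..1} (\<lambda>x. f (x + c)) = integral {0..1} (f \<circ> ((+) d))"
    by (simp add: comp_def add.commute)
  also have "\<dots> = integral {d..1 + d} f" by (simp only: integral_shift_Icc_real add_0)
  also have "\<dots> = integral {d..1} f + integral {1..1 + d} f"
    using d by (intro Henstock_Kurzweil_Integration.integral_combine[symmetric] integrable_continuous_real continuous_on_subset[OF f]) auto
  also have "integral {1..1 + d} f = integral {0..d} (f \<circ> ((+) 1))"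
    using integral_shift_Icc_real[of 0 d f 1] by (simp add: add.commute)
  also have "f \<circ> ((+) 1) = f" using per by (auto simp: fun_eq_iff add.commute)
  also have "integral {d..1} f + integral {0..d} f = integral {0..1} f"
    using d by (subst add.commute, intro Henstock_Kurzweil_Integration.integral_combine integrable_continuous_real continuous_on_subset[OF f]) auto
  finally show ?thesis .
qed

lemma periodic_continuous_bounded:
  fixes f :: "real \<Rightarrow> real"
  assumes f: "continuous_on UNIV f" and per: "\<And>x. f (x + 1) = f x"
  obtains R where "\<And>x. \<bar>f x\<bar> \<le> R"
proof -
  have "compact (f ` {0..1})" by (intro compact_continuous_image continuous_on_subset[OF f]) auto
  then obtain R where R: "\<And>y. y \<in> f ` {0..1} \<Longrightarrow> norm y \<le> R"
    using compact_imp_bounded bounded_iff by metis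
  have "\<bar>f x\<bar> \<le> R" for x
  proof -
    have "f x = f (frac x)"
      using periodic_int_shift[of f "frac x" "\<lfloor>x\<rfloor>", OF per] by (simp add: frac_def)
    moreover have "frac x \<in> {0..1}" using frac_lt_1[of x] by (simp add: less_imp_le)
    ultimately show ?thesis using R[of "f x"] by simp
  qed
  then show thesis by (rule that)
qed

lemma neg_spins: "\<sigma> \<in> spins \<Longrightarrow> - \<sigma> \<in> spins"
  by (auto simp: spins_def)

text \<open>In the frame moving with the particles the transport equation becomes an ordinary differential
  equation at each point, and after the substitution \<open>w = exp A * v\<close> its integral form has a
  nonnegative kernel.\<close>

lemma linear_transport:
  fixes a :: "int \<Rightarrow> real \<Rightarrow> real" and \<rho> :: "real \<Rightarrow> int \<Rightarrow> real"
  assumes a: "\<And>\<sigma>. \<sigma> \<in> spins \<Longrightarrow> continuous_on {0..T} (a \<sigma>)" "\<And>\<sigma> t. \<sigma> \<in> spins \<Longrightarrow> t \<in> {0..T} \<Longrightarrow> 0 \<le> a \<sigma> t"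
    and \<rho>: "\<And>\<sigma>. \<sigma> \<in> spins \<Longrightarrow> continuous_on UNIV (\<lambda>x. \<rho> x \<sigma>)" "\<And>\<sigma> x. \<sigma> \<in> spins \<Longrightarrow> 0 \<le> \<rho> x \<sigma>"
      "\<And>\<sigma> x. \<sigma> \<in> spins \<Longrightarrow> \<rho> (x + 1) \<sigma> = \<rho> x \<sigma>"
    and T: "0 \<le> T"
  obtains v :: "real \<Rightarrow> real \<Rightarrow> int \<Rightarrow> real" where
    "\<And>\<sigma>. \<sigma> \<in> spins \<Longrightarrow> continuous_on ({0..T} \<times> UNIV) (\<lambda>(t, x). v t x \<sigma>)"
    "\<And>\<sigma> t x. \<sigma> \<in> spins \<Longrightarrow> t \<in> {0..T} \<Longrightarrow> 0 \<le> v t x \<sigma>"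
    "\<And>\<sigma> t x. \<sigma> \<in> spins \<Longrightarrow> t \<in> {0..T} \<Longrightarrow> v t (x + 1) \<sigma> = v t x \<sigma>"
    "\<And>\<sigma> x. \<sigma> \<in> spins \<Longrightarrow> v 0 x \<sigma> = \<rho> x \<sigma>"
    "\<And>\<sigma> t x. \<sigma> \<in> spins \<Longrightarrow> t \<in> {0..T} \<Longrightarrow> ((\<lambda>t. v t x \<sigma>) has_real_derivative
       a (-\<sigma>) t * v t (x + 2 * of_int \<sigma> * t) (-\<sigma>) - a \<sigma> t * v t x \<sigma>) (at t within {0..T})"
proof -
  define A where "A \<sigma> t = integral {0..t} (a \<sigma>)" for \<sigma> t
  have dA: "(A \<sigma> has_real_derivative a \<sigma> t) (at t within {0..T})" if "\<sigma> \<in> spins" "t \<in> {0..T}" for \<sigma> t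
    unfolding A_def by (rule integral_has_real_derivative[OF a(1)[OF that(1)] that(2)])
  have cA: "continuous_on {0..T} (A \<sigma>)" if "\<sigma> \<in> spins" for \<sigma>
    using dA[OF that] by (meson DERIV_continuous continuous_on_eq_continuous_within)
  \<comment> \<open>Differentiating \<open>exp A * v\<close> cancels the loss term, and the gain
    from the opposite spin is rescaled by the ratio of the two exponentials.\<close>
  define k where "k \<sigma> t = exp (A \<sigma> t - A (-\<sigma>) t) * a (-\<sigma>) t" for \<sigma> t
  have ck: "continuous_on {0..T} (k \<sigma>)" if "\<sigma> \<in> spins" for \<sigma>
    unfolding k_def by (intro continuous_intros cA a(1) that neg_spins)
  have k0: "0 \<le> k \<sigma> t" if "\<sigma> \<in> spins" "t \<in> {0..T}" for \<sigma> t
    unfolding k_def using a(2)[OF neg_spins[OF that(1)] that(2)] by simp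
  have "\<exists>K. \<forall>t\<in>{0..T}. k \<sigma> t \<le> K" if "\<sigma> \<in> spins" for \<sigma>
  proof -
    have "compact (k \<sigma> ` {0..T})" by (intro compact_continuous_image ck that) auto
    then obtain K where K: "\<And>y. y \<in> k \<sigma> ` {0..T} \<Longrightarrow> norm y \<le> K"
      using compact_imp_bounded bounded_iff by metis
    have "k \<sigma> t \<le> K" if "t \<in> {0..T}" for t using K[of "k \<sigma> t"] that by auto
    then show ?thesis by blast
  qed
  then obtain K1 where K1: "\<And>\<sigma> t. \<sigma> \<in> spins \<Longrightarrow> t \<in> {0..T} \<Longrightarrow> k \<sigma> t \<le> K1 \<sigma>" by metis
  define K where "K = max (K1 1) (K1 (-1))"
  have K: "k \<sigma> t \<le> K" if "\<sigma> \<in> spins" "t \<in> {0..T}" for \<sigma> t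
    using K1[OF that] that(1) by (auto simp: K_def spins_def)
  have K0: "0 \<le> K" using k0[of 1 0] K[of 1 0] T by (simp add: spins_def)
  obtain R1 where R1: "\<And>x. \<bar>\<rho> x 1\<bar> \<le> R1"
    using periodic_continuous_bounded[of "\<lambda>x. \<rho> x 1"] \<rho>(1,3) by (metis insertCI spins_def)
  obtain R2 where R2: "\<And>x. \<bar>\<rho> x (-1)\<bar> \<le> R2"
    using periodic_continuous_bounded[of "\<lambda>x. \<rho> x (-1)"] \<rho>(1,3) by (metis insertCI spins_def)
  define R where "R = max R1 R2"
  have R: "\<bar>\<rho> x \<sigma>\<bar> \<le> R" if "\<sigma> \<in> spins" for \<sigma> x
    using R1[of x] R2[of x] that by (auto simp: R_def spins_def)
  have R0: "0 \<le> R" using R[of 1 0] by (force simp: spins_def)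
  define X where "X = {0..T} \<times> (UNIV :: real set) \<times> spins"
  \<comment> \<open>Each spin is described in its own moving frame: at time \<open>s\<close> the
    point with coordinate \<open>x\<close> for spin \<sigma> has coordinate x + 2 \<sigma> s for the
    opposite spin.\<close>
  define \<gamma> where "\<gamma> z s = (s, fst (snd z) + 2 * of_int (snd (snd z)) * s, - snd (snd z))"
    for z :: "real \<times> real \<times> int" and s :: real
  define H where "H z s y = k (snd (snd z)) s * y" for z :: "real \<times> real \<times> int" and s y :: real
  \<comment> \<open>Besides continuity the class records positivity and periodicity. Both survive an
    iteration and a uniform limit, so the solution inherits them.\<close>
  define C where "C u \<longleftrightarrow> (\<forall>\<sigma>\<in>spins. continuous_on ({0..T} \<times> UNIV) (\<lambda>(t, x). u (t, x, \<sigma>)) \<and>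
      (\<forall>t\<in>{0..T}. \<forall>x. 0 \<le> u (t, x, \<sigma>) \<and> u (t, x + 1, \<sigma>) = u (t, x, \<sigma>)))" for u :: "real \<times> real \<times> int \<Rightarrow> real"
  define h where "h u \<sigma> s x = k \<sigma> s * u (s, x + 2 * of_int \<sigma> * s, -\<sigma>)" for u and \<sigma> :: int and s x :: real
  have ch: "continuous_on ({0..T} \<times> UNIV) (\<lambda>(s, x). h u \<sigma> s x)" if u: "C u" and \<sigma>: "\<sigma> \<in> spins" for u \<sigma>
  proof -
    have cu: "continuous_on ({0..T} \<times> UNIV) (\<lambda>p. u (fst p, snd p, -\<sigma>))"
      using u neg_spins[OF \<sigma>] by (auto simp: C_def case_prod_beta)
    have "continuous_on ({0..T} \<times> UNIV) (\<lambda>p :: real \<times> real. (fst p, snd p + 2 * of_int \<sigma> * fst p))"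
      by (intro continuous_intros)
    moreover have "(\<lambda>p :: real \<times> real. (fst p, snd p + 2 * of_int \<sigma> * fst p)) ` ({0..T} \<times> UNIV) \<subseteq> {0..T} \<times> UNIV"
      by auto
    ultimately have "continuous_on ({0..T} \<times> UNIV) (\<lambda>p. u (fst p, snd p + 2 * of_int \<sigma> * fst p, -\<sigma>))"
      using continuous_on_compose2[OF cu] by fastforce
    moreover have "continuous_on ({0..T} \<times> UNIV) (\<lambda>p :: real \<times> real. k \<sigma> (fst p))"
      by (rule continuous_on_compose2[OF ck[OF \<sigma>]]) (auto intro!: continuous_intros)
    ultimately show ?thesis
      unfolding h_def case_prod_beta by (intro continuous_on_mult)
  qed
  have ch1: "continuous_on {0..t} (\<lambda>s. h u \<sigma> s x)" if "C u" "\<sigma> \<in> spins" "t \<le> T" for u \<sigma> t x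
    using that(3) by (intro continuous_on_compose2[OF ch[OF that(1,2), unfolded case_prod_beta], of _ "\<lambda>s. (s, x)", unfolded fst_conv snd_conv] continuous_intros) auto
  obtain w where w: "C w" "\<And>z. z \<in> X \<Longrightarrow> w z = \<rho> (fst (snd z)) (snd (snd z)) + integral {0..fst z} (\<lambda>s. H z s (w (\<gamma> z s)))"
  proof (rule volterra_fixed_point[where X=X and \<tau>=fst and \<gamma>=\<gamma> and H=H and g="\<lambda>z. \<rho> (fst (snd z)) (snd (snd z))"
        and C=C and K=K and B="K * R" and T=T])
    fix z assume z: "z \<in> X"
    then show "0 \<le> fst z \<and> fst z \<le> T" by (auto simp: X_def)
    fix s assume s: "s \<in> {0..fst z}"
    then show "\<gamma> z s \<in> X \<and> fst (\<gamma> z s) = s" using z by (auto simp: X_def \<gamma>_def neg_spins)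
    have ks: "0 \<le> k (snd (snd z)) s" "k (snd (snd z)) s \<le> K"
      using z s by (auto simp: X_def intro!: k0 K)
    show "\<bar>H z s y - H z s y'\<bar> \<le> K * \<bar>y - y'\<bar>" for y y'
      unfolding H_def right_diff_distrib[symmetric] abs_mult using ks by (intro mult_right_mono) auto
    have "\<bar>\<rho> (fst (snd (\<gamma> z s))) (snd (snd (\<gamma> z s)))\<bar> \<le> R"
      using z by (intro R) (auto simp: X_def \<gamma>_def neg_spins)
    then show "\<bar>H z s (\<rho> (fst (snd (\<gamma> z s))) (snd (snd (\<gamma> z s))))\<bar> \<le> K * R"
      unfolding H_def abs_mult using ks K0 by (intro mult_mono) auto
  next
    show "0 \<le> K" by (rule K0)
    show "C (\<lambda>z. \<rho> (fst (snd z)) (snd (snd z)))"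
      unfolding C_def using \<rho> by (auto simp: case_prod_beta intro!: continuous_on_compose2[OF \<rho>(1)] continuous_intros)
  next
    fix u assume u: "C u"
    show "C (\<lambda>z. \<rho> (fst (snd z)) (snd (snd z)) + integral {0..fst z} (\<lambda>s. H z s (u (\<gamma> z s))))"
      unfolding C_def
    proof (intro ballI conjI allI)
      fix \<sigma> assume \<sigma>: "\<sigma> \<in> spins"
      have "continuous_on ({0..T} \<times> UNIV) (\<lambda>(t, x). integral {0..t} (\<lambda>s. h u \<sigma> s x))"
        by (rule continuous_on_indefinite_integral_param[OF ch[OF u \<sigma>]])
      then show "continuous_on ({0..T} \<times> UNIV) (\<lambda>(t, x). \<rho> (fst (snd (t, x, \<sigma>))) (snd (snd (t, x, \<sigma>))) +
          integral {0..fst (t, x, \<sigma>)} (\<lambda>s. H (t, x, \<sigma>) s (u (\<gamma> (t, x, \<sigma>) s))))"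
        by (auto simp: case_prod_beta H_def \<gamma>_def h_def \<sigma> intro!: continuous_intros continuous_on_compose2[OF \<rho>(1)])
      fix t x assume t: "t \<in> {0..T}"
      have "0 \<le> integral {0..t} (\<lambda>s. h u \<sigma> s x)"
      proof (rule integral_nonneg)
        show "(\<lambda>s. h u \<sigma> s x) integrable_on {0..t}"
          using t by (intro integrable_continuous_real ch1 u \<sigma>) auto
        fix s assume "s \<in> {0..t}"
        then show "0 \<le> h u \<sigma> s x"
          unfolding h_def using t u k0[OF \<sigma>, of s] neg_spins[OF \<sigma>] by (auto simp: C_def)
      qed
      then show "0 \<le> \<rho> (fst (snd (t, x, \<sigma>))) (snd (snd (t, x, \<sigma>))) +
          integral {0..fst (t, x, \<sigma>)} (\<lambda>s. H (t, x, \<sigma>) s (u (\<gamma> (t, x, \<sigma>) s)))"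
        using \<rho>(2)[OF \<sigma>, of x] by (simp add: H_def \<gamma>_def h_def)
      have "integral {0..t} (\<lambda>s. h u \<sigma> s (x + 1)) = integral {0..t} (\<lambda>s. h u \<sigma> s x)"
      proof (rule integral_cong)
        fix s assume "s \<in> {0..t}"
        then have "u (s, (x + 2 * of_int \<sigma> * s) + 1, -\<sigma>) = u (s, x + 2 * of_int \<sigma> * s, -\<sigma>)"
          using t u neg_spins[OF \<sigma>] by (auto simp: C_def)
        then show "h u \<sigma> s (x + 1) = h u \<sigma> s x"
          unfolding h_def by (simp add: add.assoc add.commute add.left_commute)
      qed
      then show "\<rho> (fst (snd (t, x + 1, \<sigma>))) (snd (snd (t, x + 1, \<sigma>))) +
          integral {0..fst (t, x + 1, \<sigma>)} (\<lambda>s. H (t, x + 1, \<sigma>) s (u (\<gamma> (t, x + 1, \<sigma>) s))) =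
          \<rho> (fst (snd (t, x, \<sigma>))) (snd (snd (t, x, \<sigma>))) +
          integral {0..fst (t, x, \<sigma>)} (\<lambda>s. H (t, x, \<sigma>) s (u (\<gamma> (t, x, \<sigma>) s)))"
        using \<rho>(3)[OF \<sigma>, of x] by (simp add: H_def \<gamma>_def h_def)
    qed
    fix z assume z: "z \<in> X"
    then show "continuous_on {0..fst z} (\<lambda>s. H z s (u (\<gamma> z s)))"
      using ch1[OF u, of "snd (snd z)" "fst z" "fst (snd z)"] by (auto simp: H_def \<gamma>_def h_def X_def)
  next
    fix v :: "nat \<Rightarrow> real \<times> real \<times> int \<Rightarrow> real" and l
    assume v: "\<And>n. C (v n)" and l: "uniform_limit X v l sequentially"
    show "C l"
      unfolding C_def
    proof (intro ballI conjI allI)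
      fix \<sigma> assume \<sigma>: "\<sigma> \<in> spins"
      show "continuous_on ({0..T} \<times> UNIV) (\<lambda>(t, x). l (t, x, \<sigma>))"
      proof (rule uniform_limit_theorem)
        show "\<forall>\<^sub>F n in sequentially. continuous_on ({0..T} \<times> UNIV) (\<lambda>(t, x). v n (t, x, \<sigma>))"
          using v \<sigma> by (simp add: C_def)
        show "uniform_limit ({0..T} \<times> UNIV) (\<lambda>n (t, x). v n (t, x, \<sigma>)) (\<lambda>(t, x). l (t, x, \<sigma>)) sequentially"
        proof (rule uniform_limitI)
          fix e :: real assume "0 < e"
          from uniform_limitD[OF l this]
          show "\<forall>\<^sub>F n in sequentially. \<forall>p\<in>{0..T} \<times> UNIV. dist (case p of (t, x) \<Rightarrow> v n (t, x, \<sigma>)) (case p of (t, x) \<Rightarrow> l (t, x, \<sigma>)) < e"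
            by eventually_elim (use \<sigma> in \<open>auto simp: X_def\<close>)
        qed
      qed simp
      fix t x assume t: "t \<in> {0..T}"
      have lim: "(\<lambda>n. v n (t, x, \<sigma>)) \<longlonglongrightarrow> l (t, x, \<sigma>)" for x
        by (rule tendsto_uniform_limitI[OF l]) (use t \<sigma> in \<open>auto simp: X_def\<close>)
      show "0 \<le> l (t, x, \<sigma>)"
        by (rule LIMSEQ_le_const[OF lim]) (use v t \<sigma> in \<open>auto simp: C_def\<close>)
      have "v n (t, x + 1, \<sigma>) = v n (t, x, \<sigma>)" for n using v t \<sigma> by (auto simp: C_def)
      then show "l (t, x + 1, \<sigma>) = l (t, x, \<sigma>)"
        using LIMSEQ_unique[OF lim[of "x + 1"]] lim[of x] by simp
    qed
  next
    fix u
    assume "C u" "\<And>z. z \<in> X \<Longrightarrow> u z = \<rho> (fst (snd z)) (snd (snd z)) + integral {0..fst z} (\<lambda>s. H z s (u (\<gamma> z s)))"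
    then show thesis by (rule that)
  qed
  have weq: "w (t, x, \<sigma>) = \<rho> x \<sigma> + integral {0..t} (\<lambda>s. h w \<sigma> s x)" if "\<sigma> \<in> spins" "t \<in> {0..T}" for t x \<sigma>
    using w(2)[of "(t, x, \<sigma>)"] that by (simp add: X_def H_def \<gamma>_def h_def)
  define v where "v t x \<sigma> = exp (- A \<sigma> t) * w (t, x, \<sigma>)" for t x \<sigma>
  show thesis
  proof (rule that[of v])
    fix \<sigma> assume \<sigma>: "\<sigma> \<in> spins"
    have "continuous_on ({0..T} \<times> UNIV) (\<lambda>p :: real \<times> real. A \<sigma> (fst p))"
      by (rule continuous_on_compose2[OF cA[OF \<sigma>]]) (auto intro!: continuous_intros)
    then show "continuous_on ({0..T} \<times> UNIV) (\<lambda>(t, x). v t x \<sigma>)"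
      using w(1) \<sigma> unfolding v_def C_def case_prod_beta by (intro continuous_intros) auto
    fix x
    show "v 0 x \<sigma> = \<rho> x \<sigma>" using weq[OF \<sigma>, of 0 x] T by (simp add: v_def A_def)
    fix t assume t: "t \<in> {0..T}"
    show "0 \<le> v t x \<sigma>" "v t (x + 1) \<sigma> = v t x \<sigma>" using w(1) \<sigma> t by (auto simp: v_def C_def)
    have "((\<lambda>t. \<rho> x \<sigma> + integral {0..t} (\<lambda>s. h w \<sigma> s x)) has_real_derivative 0 + h w \<sigma> t x) (at t within {0..T})"
      by (intro DERIV_add DERIV_const integral_has_real_derivative ch1 w \<sigma> t order_refl)
    then have dw: "((\<lambda>t. w (t, x, \<sigma>)) has_real_derivative 0 + h w \<sigma> t x) (at t within {0..T})"
      by (rule has_field_derivative_transform_within[OF _ zero_less_one t]) (rule weq[OF \<sigma>, symmetric])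
    have "((\<lambda>t. v t x \<sigma>) has_real_derivative exp (- A \<sigma> t) * h w \<sigma> t x - a \<sigma> t * v t x \<sigma>) (at t within {0..T})"
      unfolding v_def by (rule derivative_eq_intros dw dA \<sigma> t refl | simp add: algebra_simps)+
    moreover have "exp (- A \<sigma> t) * h w \<sigma> t x = a (-\<sigma>) t * v t (x + 2 * of_int \<sigma> * t) (-\<sigma>)"
      by (simp add: h_def k_def v_def exp_diff exp_minus field_simps)
    ultimately show "((\<lambda>t. v t x \<sigma>) has_real_derivative
       a (-\<sigma>) t * v t (x + 2 * of_int \<sigma> * t) (-\<sigma>) - a \<sigma> t * v t x \<sigma>) (at t within {0..T})" by simp
  qed
qed


text \<open>The time derivative is one-sided at the end points, so the chain rule is taken within
  {0..T} \<times> UNIV. Joint differentiability there follows from the partial derivatives because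
  the spatial one is jointly continuous.\<close>

lemma has_real_derivative_along_line:
  fixes f ft fx :: "real \<Rightarrow> real \<Rightarrow> real"
  assumes ft: "\<And>x. ((\<lambda>s. f s x) has_real_derivative ft t x) (at t within {0..T})"
    and fx: "\<And>s x. s \<in> {0..T} \<Longrightarrow> ((\<lambda>y. f s y) has_real_derivative fx s x) (at x)"
    and cont: "continuous_on ({0..T} \<times> UNIV) (\<lambda>(s, x). fx s x)" and t: "t \<in> {0..T}"
  shows "((\<lambda>s. f s (x + b * s)) has_real_derivative ft t (x + b * t) + b * fx t (x + b * t)) (at t within {0..T})"
proof -
  define y where "y = x + b * t"
  have D: "((\<lambda>(s, x). f s x) has_derivative (\<lambda>(h, k). ft t y * h + blinfun_apply (fx t y *\<^sub>R id_blinfun) k)) (at (t, y) within {0..T} \<times> UNIV)"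
  proof (rule has_derivative_partialsI)
    show "((\<lambda>s. f s y) has_derivative (\<lambda>h. ft t y * h)) (at t within {0..T})"
      using ft[of y] by (simp add: has_field_derivative_def)
    show "((\<lambda>y. f s y) has_derivative blinfun_apply (fx s z *\<^sub>R id_blinfun)) (at z within UNIV)" if "s \<in> {0..T}" for s z
    proof -
      have "blinfun_apply (fx s z *\<^sub>R id_blinfun) = (*) (fx s z)"
        by (auto simp: fun_eq_iff blinfun.scaleR_left)
      then show ?thesis using fx[OF that, of z] by (simp add: has_field_derivative_def)
    qed
    have "continuous_on ({0..T} \<times> UNIV) (\<lambda>(s, x). fx s x *\<^sub>R (id_blinfun :: real \<Rightarrow>\<^sub>L real))"
      using cont unfolding case_prod_beta by (intro continuous_intros)
    then show "continuous (at (t, y) within {0..T} \<times> UNIV) (\<lambda>(s, x). fx s x *\<^sub>R (id_blinfun :: real \<Rightarrow>\<^sub>L real))"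
      using t by (auto simp: continuous_on_eq_continuous_within)
  qed auto
  have L: "((\<lambda>s. (s, x + b * s)) has_derivative (\<lambda>h. (h, b * h))) (at t within {0..T})"
    by (auto intro!: derivative_eq_intros)
  have "((\<lambda>s. f s (x + b * s)) has_derivative (\<lambda>h. ft t y * h + fx t y * (b * h))) (at t within {0..T})"
  proof -
    have "((\<lambda>(s, x). f s x) has_derivative (\<lambda>(h, k). ft t y * h + blinfun_apply (fx t y *\<^sub>R id_blinfun) k))
        (at (t, x + b * t) within (\<lambda>s. (s, x + b * s)) ` {0..T})"
      using D unfolding y_def by (rule has_derivative_subset) auto
    from has_derivative_in_compose[OF L this] show ?thesis
      by (simp add: blinfun.scaleR_left y_def)
  qed
  moreover have "(\<lambda>h. ft t y * h + fx t y * (b * h)) = (*) (ft t y + b * fx t y)"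
    by (auto simp: fun_eq_iff algebra_simps)
  ultimately show ?thesis
    by (simp add: has_field_derivative_def y_def)
qed

text \<open>The fundamental theorem of calculus is applied along each characteristic to the product
  of solution and test function. Integrating over the torus, exchanging the integrals and shifting
  back by periodicity gives an identity whose exchange term \<open>U\<close> acts on the density;
  summing over the spins transfers it to the test function.\<close>

lemma transport_weak_form:
  fixes v :: "real \<Rightarrow> real \<Rightarrow> int \<Rightarrow> real" and a :: "int \<Rightarrow> real \<Rightarrow> real"
  assumes T: "0 < T"
    and a: "\<And>\<sigma>. \<sigma> \<in> spins \<Longrightarrow> continuous_on {0..T} (a \<sigma>)"
    and v: "\<And>\<sigma>. \<sigma> \<in> spins \<Longrightarrow> continuous_on ({0..T} \<times> UNIV) (\<lambda>(t, x). v t x \<sigma>)"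
      "\<And>\<sigma> t x. \<sigma> \<in> spins \<Longrightarrow> t \<in> {0..T} \<Longrightarrow> v t (x + 1) \<sigma> = v t x \<sigma>"
      "\<And>\<sigma> t x. \<sigma> \<in> spins \<Longrightarrow> t \<in> {0..T} \<Longrightarrow> ((\<lambda>t. v t x \<sigma>) has_real_derivative
         a (-\<sigma>) t * v t (x + 2 * of_int \<sigma> * t) (-\<sigma>) - a \<sigma> t * v t x \<sigma>) (at t within {0..T})"
    and G: "smooth_on_time_V T G"
  defines "r \<equiv> \<lambda>t x \<sigma>. v t (x - of_int \<sigma> * t) \<sigma>"
  defines "W \<equiv> \<lambda>\<sigma> s x. r s x \<sigma> * (vector_derivative (\<lambda>u. G u x \<sigma>) (at s within {0..T}) +
      of_int \<sigma> * deriv (\<lambda>y. G s y \<sigma>) x + a \<sigma> s * (G s x (-\<sigma>) - G s x \<sigma>))"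
  shows "\<And>\<sigma>. \<sigma> \<in> spins \<Longrightarrow> continuous_on ({0..T} \<times> UNIV) (\<lambda>(s, x). W \<sigma> s x)"
    and "\<And>t. t \<in> {0..T} \<Longrightarrow> (\<Sum>\<sigma>\<in>spins. integral {0..1} (\<lambda>x. r t x \<sigma> * G t x \<sigma>)) -
       (\<Sum>\<sigma>\<in>spins. integral {0..1} (\<lambda>x. r 0 x \<sigma> * G 0 x \<sigma>)) =
       integral {0..t} (\<lambda>s. \<Sum>\<sigma>\<in>spins. integral {0..1} (W \<sigma> s))"
    and "\<And>\<sigma>. \<sigma> \<in> spins \<Longrightarrow> continuous_on ({0..T} \<times> UNIV) (\<lambda>(s, x). r s x \<sigma>)"
    and "\<And>\<sigma>. \<sigma> \<in> spins \<Longrightarrow> continuous_on ({0..T} \<times> UNIV) (\<lambda>(s, x). G s x \<sigma>)"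
proof -
  have per: "G t (x + 1) \<sigma> = G t x \<sigma>" if "\<sigma> \<in> spins" "t \<in> {0..T}" for t x \<sigma>
    using G that unfolding smooth_on_time_V_def by blast
  have "\<forall>\<sigma>\<in>spins. \<exists>D :: nat \<Rightarrow> nat \<Rightarrow> real \<Rightarrow> real \<Rightarrow> real.
        (\<forall>t\<in>{0..T}. \<forall>x. D 0 0 t x = G t x \<sigma>) \<and>
        (\<forall>i j. continuous_on ({0..T} \<times> UNIV) (\<lambda>(t, x). D i j t x) \<and>
           (\<forall>t\<in>{0..T}. \<forall>x.
              ((\<lambda>s. D i j s x) has_real_derivative D (Suc i) j t x) (at t within {0..T}) \<and>
              ((\<lambda>y. D i j t y) has_real_derivative D i (Suc j) t x) (at x)))"
    using G unfolding smooth_on_time_V_def by blast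
  from bchoice[OF this] obtain D :: "int \<Rightarrow> nat \<Rightarrow> nat \<Rightarrow> real \<Rightarrow> real \<Rightarrow> real" where
    D: "\<forall>\<sigma>\<in>spins. (\<forall>t\<in>{0..T}. \<forall>x. D \<sigma> 0 0 t x = G t x \<sigma>) \<and>
        (\<forall>i j. continuous_on ({0..T} \<times> UNIV) (\<lambda>(t, x). D \<sigma> i j t x) \<and>
           (\<forall>t\<in>{0..T}. \<forall>x.
              ((\<lambda>s. D \<sigma> i j s x) has_real_derivative D \<sigma> (Suc i) j t x) (at t within {0..T}) \<and>
              ((\<lambda>y. D \<sigma> i j t y) has_real_derivative D \<sigma> i (Suc j) t x) (at x)))"
    by blast
  have D0: "D \<sigma> 0 0 t x = G t x \<sigma>" if "\<sigma> \<in> spins" "t \<in> {0..T}" for t x \<sigma>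
    using D that by blast
  have Dc: "continuous_on ({0..T} \<times> UNIV) (\<lambda>(t, x). D \<sigma> i j t x)" if "\<sigma> \<in> spins" for \<sigma> i j
    using D that by blast
  have Dt: "((\<lambda>s. D \<sigma> 0 0 s x) has_real_derivative D \<sigma> 1 0 t x) (at t within {0..T})" if "\<sigma> \<in> spins" "t \<in> {0..T}" for t x \<sigma>
    using D that by (metis One_nat_def)
  have Dx: "((\<lambda>y. D \<sigma> 0 0 t y) has_real_derivative D \<sigma> 0 1 t x) (at x)" if "\<sigma> \<in> spins" "t \<in> {0..T}" for t x \<sigma>
    using D that by (metis One_nat_def)
  have Gt: "((\<lambda>s. G s x \<sigma>) has_real_derivative D \<sigma> 1 0 t x) (at t within {0..T})" if \<sigma>: "\<sigma> \<in> spins" and t: "t \<in> {0..T}" for t x \<sigma>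
    using Dt[OF \<sigma> t] by (rule has_field_derivative_transform_within[OF _ zero_less_one t]) (rule D0[OF \<sigma>])
  have Gx: "((\<lambda>y. G t y \<sigma>) has_real_derivative D \<sigma> 0 1 t x) (at x)" if \<sigma>: "\<sigma> \<in> spins" and t: "t \<in> {0..T}" for t x \<sigma>
    using Dx[OF \<sigma> t, of x] by (simp add: D0[OF \<sigma> t])
  have vd: "vector_derivative (\<lambda>u. G u x \<sigma>) (at t within {0..T}) = D \<sigma> 1 0 t x" if "\<sigma> \<in> spins" "t \<in> {0..T}" for t x \<sigma>
    using Gt[OF that] by (intro vector_derivative_within_closed_interval[OF T that(2)]) (simp add: has_real_derivative_iff_has_vector_derivative)
  have dv: "deriv (\<lambda>y. G t y \<sigma>) x = D \<sigma> 0 1 t x" if "\<sigma> \<in> spins" "t \<in> {0..T}" for t x \<sigma>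
    by (rule DERIV_imp_deriv[OF Gx[OF that]])
  \<comment> \<open>The derivatives of a periodic function are periodic. This has to be carried over
    to the witnesses \<open>D\<close>, since \<open>U\<close> contains them and is shifted along the
    torus.\<close>
  have per10: "D \<sigma> 1 0 t (x + 1) = D \<sigma> 1 0 t x" if \<sigma>: "\<sigma> \<in> spins" and t: "t \<in> {0..T}" for t x \<sigma>
  proof -
    have "((\<lambda>s. G s x \<sigma>) has_real_derivative D \<sigma> 1 0 t (x + 1)) (at t within {0..T})"
      using Gt[OF \<sigma> t, of "x + 1"] by (rule has_field_derivative_transform_within[OF _ zero_less_one t]) (rule per[OF \<sigma>])
    from vector_derivative_within_closed_interval[OF T t this[unfolded has_real_derivative_iff_has_vector_derivative]]
    show ?thesis using vd[OF \<sigma> t, of x] by simp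
  qed
  have per01: "D \<sigma> 0 1 t (x + 1) = D \<sigma> 0 1 t x" if \<sigma>: "\<sigma> \<in> spins" and t: "t \<in> {0..T}" for t x \<sigma>
  proof -
    have "((\<lambda>y. G t (y + 1) \<sigma>) has_real_derivative D \<sigma> 0 1 t (x + 1)) (at x)"
      using Gx[OF \<sigma> t, of "x + 1"] by (simp add: DERIV_shift)
    then have "((\<lambda>y. G t y \<sigma>) has_real_derivative D \<sigma> 0 1 t (x + 1)) (at x)"
      by (simp add: per[OF \<sigma> t])
    then show ?thesis using Gx[OF \<sigma> t, of x] DERIV_unique by blast
  qed
  have Gc: "continuous_on ({0..T} \<times> UNIV) (\<lambda>(t, x). G t x \<sigma>)" if "\<sigma> \<in> spins" for \<sigma>
    by (rule continuous_on_eq[OF Dc[OF that, of 0 0]]) (auto simp: D0[OF that])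
  have shift: "continuous_on ({0..T} \<times> UNIV) (\<lambda>(t, x). f t (x + b * t))"
    if f: "continuous_on ({0..T} \<times> UNIV) (\<lambda>(t, x). f t x)" for f :: "real \<Rightarrow> real \<Rightarrow> real" and b
  proof -
    have "continuous_on ({0..T} \<times> UNIV) (\<lambda>p :: real \<times> real. (fst p, snd p + b * fst p))"
      by (intro continuous_intros)
    moreover have "(\<lambda>p :: real \<times> real. (fst p, snd p + b * fst p)) ` ({0..T} \<times> UNIV) \<subseteq> {0..T} \<times> UNIV" by auto
    ultimately show ?thesis
      using continuous_on_compose2[OF f] by (fastforce simp: case_prod_beta)
  qed
  have rc: "continuous_on ({0..T} \<times> UNIV) (\<lambda>(t, x). r t x \<sigma>)" if "\<sigma> \<in> spins" for \<sigma>
    using shift[OF v(1)[OF that], of "- of_int \<sigma>"] by (simp add: r_def)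
  have ac: "continuous_on ({0..T} \<times> UNIV) (\<lambda>p :: real \<times> real. a \<sigma> (fst p))" if "\<sigma> \<in> spins" for \<sigma>
    by (rule continuous_on_compose2[OF a[OF that]]) (auto intro!: continuous_intros)
  define U where "U \<sigma> s y = (a (-\<sigma>) s * r s y (-\<sigma>) - a \<sigma> s * r s y \<sigma>) * G s y \<sigma> + r s y \<sigma> * (D \<sigma> 1 0 s y + of_int \<sigma> * D \<sigma> 0 1 s y)"
    for \<sigma> and s y :: real
  have Uc: "continuous_on ({0..T} \<times> UNIV) (\<lambda>(s, y). U \<sigma> s y)" if \<sigma>: "\<sigma> \<in> spins" for \<sigma>
    using rc[OF \<sigma>] rc[OF neg_spins[OF \<sigma>]] ac[OF \<sigma>] ac[OF neg_spins[OF \<sigma>]] Gc[OF \<sigma>] Dc[OF \<sigma>, of 1 0] Dc[OF \<sigma>, of 0 1]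
    unfolding U_def case_prod_beta by (intro continuous_intros)
  have slice: "continuous_on S (f s)" if "continuous_on ({0..T} \<times> UNIV) (\<lambda>(s, y). f s y)" "s \<in> {0..T}"
    for f :: "real \<Rightarrow> real \<Rightarrow> real" and s S
    by (rule continuous_on_compose2[OF that(1), of S "\<lambda>y. (s, y)", simplified]) (use that(2) in \<open>auto intro!: continuous_intros\<close>)
  have rper: "r t (x + 1) \<sigma> = r t x \<sigma>" if "\<sigma> \<in> spins" "t \<in> {0..T}" for t x \<sigma>
    using v(2)[OF that, of "x - of_int \<sigma> * t"] by (simp add: r_def algebra_simps)
  have Uper: "U \<sigma> s (y + 1) = U \<sigma> s y" if "\<sigma> \<in> spins" "s \<in> {0..T}" for \<sigma> s y
    by (simp only: U_def rper[OF that] rper[OF neg_spins[OF that(1)] that(2)] per[OF that] per10[OF that] per01[OF that])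
  have each: "integral {0..1} (\<lambda>x. r t x \<sigma> * G t x \<sigma>) - integral {0..1} (\<lambda>x. r 0 x \<sigma> * G 0 x \<sigma>) =
      integral {0..t} (\<lambda>s. integral {0..1} (U \<sigma> s))" if \<sigma>: "\<sigma> \<in> spins" and t: "t \<in> {0..T}" for \<sigma> t
  proof -
    define \<phi> where "\<phi> s x = v s x \<sigma> * D \<sigma> 0 0 s (x + of_int \<sigma> * s)" for s x
    have d\<phi>: "((\<lambda>s. \<phi> s x) has_real_derivative U \<sigma> s (x + of_int \<sigma> * s)) (at s within {0..T})" if s: "s \<in> {0..T}" for s x
    proof -
      have "((\<lambda>s. D \<sigma> 0 0 s (x + of_int \<sigma> * s)) has_real_derivative
          D \<sigma> 1 0 s (x + of_int \<sigma> * s) + of_int \<sigma> * D \<sigma> 0 1 s (x + of_int \<sigma> * s)) (at s within {0..T})"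
        by (rule has_real_derivative_along_line[where f="D \<sigma> 0 0" and ft="D \<sigma> 1 0" and fx="D \<sigma> 0 1", OF Dt[OF \<sigma> s] Dx[OF \<sigma>] Dc[OF \<sigma>] s])
      from DERIV_mult[OF v(3)[OF \<sigma> s] this]
      have "((\<lambda>s. \<phi> s x) has_real_derivative
          (a (-\<sigma>) s * v s (x + 2 * of_int \<sigma> * s) (-\<sigma>) - a \<sigma> s * v s x \<sigma>) * D \<sigma> 0 0 s (x + of_int \<sigma> * s) +
          (D \<sigma> 1 0 s (x + of_int \<sigma> * s) + of_int \<sigma> * D \<sigma> 0 1 s (x + of_int \<sigma> * s)) * v s x \<sigma>) (at s within {0..T})"
        unfolding \<phi>_def .
      moreover have "U \<sigma> s (x + of_int \<sigma> * s) =
          (a (-\<sigma>) s * v s (x + 2 * of_int \<sigma> * s) (-\<sigma>) - a \<sigma> s * v s x \<sigma>) * D \<sigma> 0 0 s (x + of_int \<sigma> * s) +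
          (D \<sigma> 1 0 s (x + of_int \<sigma> * s) + of_int \<sigma> * D \<sigma> 0 1 s (x + of_int \<sigma> * s)) * v s x \<sigma>"
      proof -
        have p: "x + of_int \<sigma> * s - of_int (-\<sigma>) * s = x + 2 * of_int \<sigma> * s" "x + of_int \<sigma> * s - of_int \<sigma> * s = x"
          by (simp_all add: algebra_simps)
        show ?thesis
          unfolding U_def r_def p D0[OF \<sigma> s] by (rule arg_cong2[where f="(+)", OF refl mult.commute])
      qed
      ultimately show ?thesis by simp
    qed
    have ftc: "integral {0..t} (\<lambda>s. U \<sigma> s (x + of_int \<sigma> * s)) = \<phi> t x - \<phi> 0 x" for x
    proof (rule integral_unique, rule fundamental_theorem_of_calculus)
      show "0 \<le> t" using t by simp
      fix s assume s: "s \<in> {0..t}"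
      then have "((\<lambda>s. \<phi> s x) has_real_derivative U \<sigma> s (x + of_int \<sigma> * s)) (at s within {0..t})"
        using t by (intro DERIV_subset[OF d\<phi>]) auto
      then show "((\<lambda>s. \<phi> s x) has_vector_derivative U \<sigma> s (x + of_int \<sigma> * s)) (at s within {0..t})"
        by (simp add: has_real_derivative_iff_has_vector_derivative)
    qed
    have ph: "integral {0..1} (\<phi> s) = integral {0..1} (\<lambda>x. r s x \<sigma> * G s x \<sigma>)" and phi: "\<phi> s integrable_on {0..1}" if s: "s \<in> {0..T}" for s
    proof -
      have c: "continuous_on UNIV (\<lambda>x. r s x \<sigma> * G s x \<sigma>)"
        by (intro continuous_intros slice[OF rc[OF \<sigma>] s] slice[OF Gc[OF \<sigma>] s])
      have eq: "\<phi> s = (\<lambda>x. r s (x + of_int \<sigma> * s) \<sigma> * G s (x + of_int \<sigma> * s) \<sigma>)"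
        by (auto simp: \<phi>_def r_def D0[OF \<sigma> s])
      show "integral {0..1} (\<phi> s) = integral {0..1} (\<lambda>x. r s x \<sigma> * G s x \<sigma>)"
        unfolding eq by (rule integral_periodic_shift[OF c]) (simp add: rper[OF \<sigma> s] per[OF \<sigma> s])
      show "\<phi> s integrable_on {0..1}"
        unfolding eq by (intro integrable_continuous_real continuous_on_compose2[OF c] continuous_intros) auto
    qed
    have z: "0 \<in> {0..T}" using T by simp
    have "integral {0..1} (\<lambda>x. r t x \<sigma> * G t x \<sigma>) - integral {0..1} (\<lambda>x. r 0 x \<sigma> * G 0 x \<sigma>) = integral {0..1} (\<lambda>x. \<phi> t x - \<phi> 0 x)"
      unfolding ph[OF t, symmetric] ph[OF z, symmetric] by (rule integral_diff[symmetric, OF phi[OF t] phi[OF z]])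
    also have "\<dots> = integral {0..1} (\<lambda>x. integral {0..t} (\<lambda>s. U \<sigma> s (x + of_int \<sigma> * s)))"
      by (simp add: ftc)
    also have "\<dots> = integral {0..t} (\<lambda>s. integral {0..1} (\<lambda>x. U \<sigma> s (x + of_int \<sigma> * s)))"
    proof -
      have "continuous_on (cbox (0, 0) (1, t)) (\<lambda>p. (snd p, fst p))" by (intro continuous_intros)
      moreover have "(\<lambda>p. (snd p, fst p)) ` cbox (0, 0) (1, t) \<subseteq> {0..T} \<times> UNIV"
        using t by (auto simp: cbox_Pair_eq)
      ultimately have "continuous_on (cbox (0, 0) (1, t)) (\<lambda>(x, s). U \<sigma> s (x + of_int \<sigma> * s))"
        using continuous_on_compose2[OF shift[OF Uc[OF \<sigma>], of "of_int \<sigma>"], of "cbox (0, 0) (1, t)" "\<lambda>p. (snd p, fst p)"]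
        by (simp add: case_prod_beta)
      from integral_swap_continuous[OF this] show ?thesis by simp
    qed
    also have "\<dots> = integral {0..t} (\<lambda>s. integral {0..1} (U \<sigma> s))"
    proof (rule integral_cong)
      fix s assume "s \<in> {0..t}"
      then have s: "s \<in> {0..T}" using t by auto
      show "integral {0..1} (\<lambda>x. U \<sigma> s (x + of_int \<sigma> * s)) = integral {0..1} (U \<sigma> s)"
        by (rule integral_periodic_shift[OF slice[OF Uc[OF \<sigma>] s] Uper[OF \<sigma> s]])
    qed
    finally show ?thesis .
  qed
  have W: "W \<sigma> s x = r s x \<sigma> * (D \<sigma> 1 0 s x + of_int \<sigma> * D \<sigma> 0 1 s x + a \<sigma> s * (G s x (-\<sigma>) - G s x \<sigma>))"
    if "\<sigma> \<in> spins" "s \<in> {0..T}" for \<sigma> s x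
    unfolding W_def vd[OF that] dv[OF that] ..
  show Wc: "continuous_on ({0..T} \<times> UNIV) (\<lambda>(s, x). W \<sigma> s x)" if \<sigma>: "\<sigma> \<in> spins" for \<sigma>
  proof (rule continuous_on_eq)
    show "continuous_on ({0..T} \<times> UNIV) (\<lambda>(s, x). r s x \<sigma> * (D \<sigma> 1 0 s x + of_int \<sigma> * D \<sigma> 0 1 s x + a \<sigma> s * (G s x (-\<sigma>) - G s x \<sigma>)))"
      using rc[OF \<sigma>] ac[OF \<sigma>] Gc[OF \<sigma>] Gc[OF neg_spins[OF \<sigma>]] Dc[OF \<sigma>, of 1 0] Dc[OF \<sigma>, of 0 1]
      unfolding case_prod_beta by (intro continuous_intros)
  qed (auto simp: W[OF \<sigma>])
  show "continuous_on ({0..T} \<times> UNIV) (\<lambda>(s, x). r s x \<sigma>)" if "\<sigma> \<in> spins" for \<sigma> by (rule rc[OF that])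
  show "continuous_on ({0..T} \<times> UNIV) (\<lambda>(s, x). G s x \<sigma>)" if "\<sigma> \<in> spins" for \<sigma> by (rule Gc[OF that])
  fix t assume t: "t \<in> {0..T}"
  have s: "(1::int) \<in> spins" "(-1::int) \<in> spins" by (auto simp: spins_def)
  have Ui: "(\<lambda>s. integral {0..1} (U \<sigma> s)) integrable_on {0..t}" if \<sigma>: "\<sigma> \<in> spins" for \<sigma>
  proof -
    have "continuous_on ({0..t} \<times> cbox 0 1) (\<lambda>(s, y). U \<sigma> s y)"
      by (rule continuous_on_subset[OF Uc[OF \<sigma>]]) (use t in auto)
    from integral_continuous_on_param[OF this] show ?thesis by (auto intro: integrable_continuous_real)
  qed
  have "(\<Sum>\<sigma>\<in>spins. integral {0..1} (\<lambda>x. r t x \<sigma> * G t x \<sigma>)) - (\<Sum>\<sigma>\<in>spins. integral {0..1} (\<lambda>x. r 0 x \<sigma> * G 0 x \<sigma>)) =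
      (\<Sum>\<sigma>\<in>spins. integral {0..t} (\<lambda>s. integral {0..1} (U \<sigma> s)))"
    unfolding sum_subtractf[symmetric] by (rule sum.cong[OF refl each[OF _ t]])
  also have "\<dots> = integral {0..t} (\<lambda>s. \<Sum>\<sigma>\<in>spins. integral {0..1} (U \<sigma> s))"
    by (rule integral_sum[symmetric]) (auto simp: Ui spins_def)
  also have "\<dots> = integral {0..t} (\<lambda>s. \<Sum>\<sigma>\<in>spins. integral {0..1} (W \<sigma> s))"
  proof (rule integral_cong)
    fix u assume "u \<in> {0..t}"
    then have u: "u \<in> {0..T}" using t by auto
    have "(\<Sum>\<sigma>\<in>spins. integral {0..1} (U \<sigma> u)) = integral {0..1} (\<lambda>x. \<Sum>\<sigma>\<in>spins. U \<sigma> u x)"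
      by (rule integral_sum[symmetric]) (auto simp: spins_def intro!: integrable_continuous_real slice[OF Uc u] s)
    also have "(\<lambda>x. \<Sum>\<sigma>\<in>spins. U \<sigma> u x) = (\<lambda>x. \<Sum>\<sigma>\<in>spins. W \<sigma> u x)"
    proof
      \<comment> \<open>For a single spin \<open>U\<close> and \<open>W\<close> differ; after
        summation they agree, the gain of one spin being the loss of the other.\<close>
      fix x show "(\<Sum>\<sigma>\<in>spins. U \<sigma> u x) = (\<Sum>\<sigma>\<in>spins. W \<sigma> u x)"
        using W[OF s(1) u, of x] W[OF s(2) u, of x] by (simp add: spins_def U_def algebra_simps)
    qed
    also have "integral {0..1} (\<lambda>x. \<Sum>\<sigma>\<in>spins. W \<sigma> u x) = (\<Sum>\<sigma>\<in>spins. integral {0..1} (W \<sigma> u))"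
      by (rule integral_sum) (auto simp: spins_def intro!: integrable_continuous_real slice[OF Wc u] s)
    finally show "(\<Sum>\<sigma>\<in>spins. integral {0..1} (U \<sigma> u)) = (\<Sum>\<sigma>\<in>spins. integral {0..1} (W \<sigma> u))" .
  qed
  finally show "(\<Sum>\<sigma>\<in>spins. integral {0..1} (\<lambda>x. r t x \<sigma> * G t x \<sigma>)) -
       (\<Sum>\<sigma>\<in>spins. integral {0..1} (\<lambda>x. r 0 x \<sigma> * G 0 x \<sigma>)) =
       integral {0..t} (\<lambda>s. \<Sum>\<sigma>\<in>spins. integral {0..1} (W \<sigma> s))" .
qed


text \<open>The nonlinearity enters only through the magnetization. Besides the two constructions a
  consistency check is required: the solution of the linear equation with rates driven by
  \<open>m\<close> must itself have magnetization \<open>m\<close>.\<close>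

lemma weak_solution_exists:
  assumes T: "0 < T" and sm: "smooth_on_V \<rho>" and \<rho>: "\<forall>x. \<forall>\<sigma>\<in>spins. \<rho> x \<sigma> \<ge> 0"
    and Z: "L2_inner \<rho> (\<lambda>x \<sigma>. 1) > 0"
    and b: "\<And>\<sigma> m. \<sigma> \<in> spins \<Longrightarrow> m \<in> {-1..1} \<Longrightarrow> 0 \<le> c \<sigma> m \<and> c \<sigma> m \<le> b"
    and L: "\<And>\<sigma> m m'. \<sigma> \<in> spins \<Longrightarrow> m \<in> {-1..1} \<Longrightarrow> m' \<in> {-1..1} \<Longrightarrow> \<bar>c \<sigma> m - c \<sigma> m'\<bar> \<le> L * \<bar>m - m'\<bar>"
  shows "\<exists>r. weak_solution T c \<rho> r"
proof -
  have s: "(1::int) \<in> spins" "(-1::int) \<in> spins" by (auto simp: spins_def)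
  \<comment> \<open>Projection onto [-1, 1]: the rates are bounded and Lipschitz there, while the
    existence result for the differential equation asks for a globally Lipschitz right side.\<close>
  define cl where "cl x = max (-1) (min 1 x)" for x :: real
  have cl: "cl x \<in> {-1..1}" "\<bar>cl x - cl y\<bar> \<le> \<bar>x - y\<bar>" for x y by (auto simp: cl_def)
  have b0: "0 \<le> b" using b[of 1 0] by (force simp: spins_def)
  have L0: "0 \<le> L" using L[of 1 0 1] by (simp add: spins_def)
  have lip: "\<bar>drift c (cl x) - drift c (cl y)\<bar> \<le> (4 * L + 2 * b) * \<bar>x - y\<bar>" for x y
  proof -
    have "\<bar>drift c (cl x) - drift c (cl y)\<bar> \<le> (4 * L + 2 * b) * \<bar>cl x - cl y\<bar>"
      by (rule drift_lipschitz[OF b L cl(1) cl(1)])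
    also have "\<dots> \<le> (4 * L + 2 * b) * \<bar>x - y\<bar>" using cl(2) b0 L0 by (intro mult_left_mono) auto
    finally show ?thesis .
  qed
  obtain m where m: "m 0 = density_magnetization \<rho>"
    "\<And>t. t \<in> {0..T} \<Longrightarrow> (m has_real_derivative drift c (cl (m t))) (at t within {0..T})"
    using ode_existence[of "4 * L + 2 * b" "\<lambda>x. drift c (cl x)" "density_magnetization \<rho>" T] lip b0 L0 by auto
  have cm: "continuous_on {0..T} m"
    using m(2) by (meson DERIV_continuous continuous_on_eq_continuous_within)
  define a where "a \<sigma> t = c \<sigma> (cl (m t))" for \<sigma> t
  have a0: "0 \<le> a \<sigma> t" if "\<sigma> \<in> spins" for \<sigma> t
    using b[OF that cl(1)] by (simp add: a_def)
  have ca: "continuous_on {0..T} (a \<sigma>)" if "\<sigma> \<in> spins" for \<sigma>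
  proof -
    have "continuous_on {-1..1} (c \<sigma>)"
      by (rule lipschitz_on_continuous_on[OF lipschitz_onI[where L=L]]) (use L[OF that] L0 in \<open>auto simp: dist_real_def\<close>)
    then show ?thesis
      unfolding a_def by (rule continuous_on_compose2) (use cl(1) in \<open>auto simp: cl_def intro!: continuous_intros cm\<close>)
  qed
  have \<rho>c: "continuous_on UNIV (\<lambda>x. \<rho> x \<sigma>)" if "\<sigma> \<in> spins" for \<sigma>
    by (rule smooth_on_V_continuous[OF sm that])
  have \<rho>p: "\<rho> (x + 1) \<sigma> = \<rho> x \<sigma>" if "\<sigma> \<in> spins" for x \<sigma>
    using sm that unfolding smooth_on_V_def by blast
  obtain v where v: "\<And>\<sigma>. \<sigma> \<in> spins \<Longrightarrow> continuous_on ({0..T} \<times> UNIV) (\<lambda>(t, x). v t x \<sigma>)"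
    "\<And>\<sigma> t x. \<sigma> \<in> spins \<Longrightarrow> t \<in> {0..T} \<Longrightarrow> 0 \<le> v t x \<sigma>"
    "\<And>\<sigma> t x. \<sigma> \<in> spins \<Longrightarrow> t \<in> {0..T} \<Longrightarrow> v t (x + 1) \<sigma> = v t x \<sigma>"
    "\<And>\<sigma> x. \<sigma> \<in> spins \<Longrightarrow> v 0 x \<sigma> = \<rho> x \<sigma>"
    "\<And>\<sigma> t x. \<sigma> \<in> spins \<Longrightarrow> t \<in> {0..T} \<Longrightarrow> ((\<lambda>t. v t x \<sigma>) has_real_derivative
       a (-\<sigma>) t * v t (x + 2 * of_int \<sigma> * t) (-\<sigma>) - a \<sigma> t * v t x \<sigma>) (at t within {0..T})"
  proof (rule linear_transport[of T a \<rho>])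
    show "\<And>\<sigma> x. \<sigma> \<in> spins \<Longrightarrow> 0 \<le> \<rho> x \<sigma>" using \<rho> by blast
  qed (use ca a0 \<rho>c \<rho>p T that in \<open>auto simp del: less_imp_le\<close>)
  define r where "r = (\<lambda>t x \<sigma>. v t (x - of_int \<sigma> * t) \<sigma>)"
  define W where "W G = (\<lambda>\<sigma> s x. r s x \<sigma> * (vector_derivative (\<lambda>u. G u x \<sigma>) (at s within {0..T}) +
      of_int \<sigma> * deriv (\<lambda>y. G s y \<sigma>) x + a \<sigma> s * (G s x (-\<sigma>) - G s x \<sigma>)))" for G :: "real \<Rightarrow> real \<Rightarrow> int \<Rightarrow> real"
  have Wc: "continuous_on ({0..T} \<times> UNIV) (\<lambda>(s, x). W G \<sigma> s x)" if G: "smooth_on_time_V T G" and \<sigma>: "\<sigma> \<in> spins" for G \<sigma>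
    unfolding W_def r_def by (rule transport_weak_form(1)[where a=a and v=v, OF T ca v(1) v(3) v(5) G \<sigma>])
  have Gc: "continuous_on ({0..T} \<times> UNIV) (\<lambda>(s, x). G s x \<sigma>)" if G: "smooth_on_time_V T G" and \<sigma>: "\<sigma> \<in> spins" for G \<sigma>
    by (rule transport_weak_form(4)[where a=a and v=v, OF T ca v(1) v(3) v(5) G \<sigma>])
  have rc: "continuous_on ({0..T} \<times> UNIV) (\<lambda>(s, x). r s x \<sigma>)" if \<sigma>: "\<sigma> \<in> spins" for \<sigma>
    unfolding r_def by (rule transport_weak_form(3)[where a=a and v=v, OF T ca v(1) v(3) v(5) smooth_on_time_V_const[of T "\<lambda>_. 0"] \<sigma>])
  have weak: "(\<Sum>\<sigma>\<in>spins. integral {0..1} (\<lambda>x. r t x \<sigma> * G t x \<sigma>)) -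
       (\<Sum>\<sigma>\<in>spins. integral {0..1} (\<lambda>x. r 0 x \<sigma> * G 0 x \<sigma>)) =
       integral {0..t} (\<lambda>s. \<Sum>\<sigma>\<in>spins. integral {0..1} (W G \<sigma> s))"
    if G: "smooth_on_time_V T G" and t: "t \<in> {0..T}" for G t
    unfolding W_def r_def by (rule transport_weak_form(2)[where a=a and v=v, OF T ca v(1) v(3) v(5) G t])
  have slice: "continuous_on S (f s)" if "continuous_on ({0..T} \<times> UNIV) (\<lambda>(s, y). f s y)" "s \<in> {0..T}"
    for f :: "real \<Rightarrow> real \<Rightarrow> real" and s S
    by (rule continuous_on_compose2[OF that(1), of S "\<lambda>y. (s, y)", simplified]) (use that(2) in \<open>auto intro!: continuous_intros\<close>)
  have ci: "continuous_on {0..T} (\<lambda>s. integral {0..1} (f s))" if "continuous_on ({0..T} \<times> UNIV) (\<lambda>(s, y). f s y)"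
    for f :: "real \<Rightarrow> real \<Rightarrow> real"
  proof -
    have "continuous_on ({0..T} \<times> cbox 0 1) (\<lambda>(s, y). f s y)"
      by (rule continuous_on_subset[OF that]) auto
    from integral_continuous_on_param[OF this] show ?thesis by simp
  qed
  have r0: "r 0 x \<sigma> = \<rho> x \<sigma>" if "\<sigma> \<in> spins" for x \<sigma>
    using v(4)[OF that] by (simp add: r_def)
  have rnn: "0 \<le> r t x \<sigma>" if "\<sigma> \<in> spins" "t \<in> {0..T}" for t x \<sigma>
    using v(2)[OF that] by (simp add: r_def)
  define I where "I \<sigma> t = integral {0..1} (\<lambda>x. r t x \<sigma>)" for \<sigma> t
  have mass: "spin_mass (r t) \<sigma> = I \<sigma> t" if "\<sigma> \<in> spins" "t \<in> {0..T}" for \<sigma> t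
    unfolding spin_mass_def I_def by (rule LBINT_eq_integral[OF slice[OF rc[OF that(1)] that(2)]])
  have Ic: "continuous_on {0..T} (I \<sigma>)" if "\<sigma> \<in> spins" for \<sigma>
    unfolding I_def by (rule ci[OF rc[OF that]])
  have Inn: "0 \<le> I \<sigma> t" if "\<sigma> \<in> spins" "t \<in> {0..T}" for \<sigma> t
    unfolding I_def by (intro integral_nonneg integrable_continuous_real slice[OF rc[OF that(1)] that(2)] rnn that)
  \<comment> \<open>A test function of the spin alone leaves only the exchange term; the constant 1
    gives the total mass and the spin the equation of the magnetization.\<close>
  have const: "I 1 t * g 1 + I (-1) t * g (-1) - (I 1 0 * g 1 + I (-1) 0 * g (-1)) =
      integral {0..t} (\<lambda>s. (a 1 s * I 1 s - a (-1) s * I (-1) s) * (g (-1) - g 1))" if t: "t \<in> {0..T}" for g :: "int \<Rightarrow> real" and t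
  proof -
    have "integral {0..1} (W (\<lambda>t x. g) \<sigma> s) = I \<sigma> s * (a \<sigma> s * (g (-\<sigma>) - g \<sigma>))" if "s \<in> {0..T}" for \<sigma> s
    proof -
      have "vector_derivative (\<lambda>u. g \<sigma>) (at s within {0..T}) = 0"
        by (rule vector_derivative_within_closed_interval[OF T that]) simp
      then have "W (\<lambda>t x. g) \<sigma> s = (\<lambda>x. r s x \<sigma> * (a \<sigma> s * (g (-\<sigma>) - g \<sigma>)))"
        by (auto simp: W_def)
      then show ?thesis by (simp add: I_def)
    qed
    note wi = this
    have "integral {0..t} (\<lambda>s. \<Sum>\<sigma>\<in>spins. integral {0..1} (W (\<lambda>t x. g) \<sigma> s)) =
        integral {0..t} (\<lambda>s. (a 1 s * I 1 s - a (-1) s * I (-1) s) * (g (-1) - g 1))"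
    proof (rule integral_cong)
      fix u assume "u \<in> {0..t}"
      then have u: "u \<in> {0..T}" using t by auto
      show "(\<Sum>\<sigma>\<in>spins. integral {0..1} (W (\<lambda>t x. g) \<sigma> u)) = (a 1 u * I 1 u - a (-1) u * I (-1) u) * (g (-1) - g 1)"
        unfolding wi[OF u] by (simp add: spins_def algebra_simps)
    qed
    then show ?thesis
      using weak[OF smooth_on_time_V_const[of T g] t] by (simp add: spins_def I_def)
  qed
  define Z0 where "Z0 = I 1 0 + I (-1) 0"
  have z: "0 \<in> {0..T}" using T by simp
  have tot: "I 1 t + I (-1) t = Z0" if "t \<in> {0..T}" for t
    using const[OF that, of "\<lambda>_. 1"] by (simp add: Z0_def)
  have rho_mass: "spin_mass \<rho> \<sigma> = I \<sigma> 0" if "\<sigma> \<in> spins" for \<sigma>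
    using mass[OF that z] r0[OF that] by (simp add: spin_mass_def)
  have Z0: "0 < Z0"
    using Z L2_inner_const[of \<rho> "\<lambda>_. 1"] rho_mass s by (simp add: Z0_def)
  define q where "q t = (I 1 t - I (-1) t) / Z0" for t
  have q: "density_magnetization (r t) = q t" if "t \<in> {0..T}" for t
    unfolding density_magnetization_altdef q_def mass[OF s(1) that] mass[OF s(2) that] tot[OF that] ..
  have Iq: "I 1 t = Z0 * (1 + q t) / 2" "I (-1) t = Z0 * (1 - q t) / 2" if "t \<in> {0..T}" for t
  proof -
    have "Z0 * q t = I 1 t - I (-1) t" using Z0 by (simp add: q_def)
    with tot[OF that] show "I 1 t = Z0 * (1 + q t) / 2" "I (-1) t = Z0 * (1 - q t) / 2"
      by (simp_all add: distrib_left right_diff_distrib)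
  qed
  have qb: "q t \<in> {-1..1}" if "t \<in> {0..T}" for t
    using Inn[OF s(1) that] Inn[OF s(2) that] unfolding Iq[OF that] using Z0 by (auto simp: zero_le_mult_iff)
  have dq: "(q has_real_derivative a (-1) t * (1 - q t) - a 1 t * (1 + q t)) (at t within {0..T})" if t: "t \<in> {0..T}" for t
  proof -
    \<comment> \<open>The factor -2 is g (-1) - g 1 for the spin as test function.\<close>
    define f where "f s = (a 1 s * I 1 s - a (-1) s * I (-1) s) * (-2)" for s
    have "continuous_on {0..T} f"
      unfolding f_def by (intro continuous_intros ca Ic s)
    from integral_has_real_derivative[OF this t]
    have "((\<lambda>t. (I 1 0 - I (-1) 0 + integral {0..t} f) / Z0) has_real_derivative (0 + f t) / Z0) (at t within {0..T})"
      by (intro DERIV_cdivide DERIV_add DERIV_const)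
    then have "(q has_real_derivative (0 + f t) / Z0) (at t within {0..T})"
    proof (rule has_field_derivative_transform_within[OF _ zero_less_one t])
      fix u assume u: "u \<in> {0..T}"
      show "(I 1 0 - I (-1) 0 + integral {0..u} f) / Z0 = q u"
      proof -
        have "integral {0..u} f = I 1 u - I (-1) u - (I 1 0 - I (-1) 0)"
          using const[OF u, of real_of_int] by (simp add: f_def[abs_def])
        then show ?thesis by (simp add: q_def)
      qed
    qed
    moreover have "(0 + f t) / Z0 = a (-1) t * (1 - q t) - a 1 t * (1 + q t)"
      unfolding f_def Iq[OF t] using Z0 by (simp add: field_simps)
    ultimately show ?thesis by simp
  qed
  have q0: "q 0 = m 0"
    unfolding m(1) density_magnetization_altdef rho_mass[OF s(1)] rho_mass[OF s(2)] by (simp add: q_def Z0_def)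
  have qm: "q t = m t" if t: "t \<in> {0..T}" for t
  proof -
    \<comment> \<open>\<open>q\<close> solves the linear equation with rates frozen at cl m, so the
      derivative of q - m is minus the total rate times q - cl m. As \<open>q\<close> lies in
      [-1, 1] and \<open>cl\<close> is the projection onto it, (q - m) (q - cl m) is nonnegative and
      the squared distance cannot grow from 0.\<close>
    define e where "e u = (q u - m u)\<^sup>2" for u
    have "e 0 \<ge> e t"
    proof (rule DERIV_nonpos_imp_decreasing_open[of 0 t e])
      show "0 \<le> t" using t by simp
      have cq: "continuous_on {0..T} q"
        using dq by (meson DERIV_continuous continuous_on_eq_continuous_within)
      show "continuous_on {0..t} e"
        unfolding e_def using t by (intro continuous_intros continuous_on_subset[OF cm] continuous_on_subset[OF cq]) auto
      fix u assume u: "0 < u" "u < t"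
      have uT: "u \<in> {0..T}" using u t by simp
      have uT2: "u \<in> {0<..<T}" using u t by simp
      have d: "((\<lambda>u. (q u - m u)\<^sup>2) has_real_derivative 2 * (q u - m u) * (a (-1) u * (1 - q u) - a 1 u * (1 + q u) - drift c (cl (m u)))) (at u)"
        using dq[OF uT] m(2)[OF uT] uT2
        by (auto simp: at_within_Icc_at intro!: derivative_eq_intros)
      have eq: "a (-1) u * (1 - q u) - a 1 u * (1 + q u) - drift c (cl (m u)) = - (a 1 u + a (-1) u) * (q u - cl (m u))"
        by (simp add: drift_def a_def algebra_simps)
      have n: "2 * (q u - m u) * (- (a 1 u + a (-1) u) * (q u - cl (m u))) \<le> 0"
      proof -
        have "0 \<le> (q u - m u) * (q u - cl (m u))"
          using qb[OF uT] unfolding cl_def by (cases "m u < -1"; cases "1 < m u") (auto intro: mult_nonneg_nonneg mult_nonpos_nonpos)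
        then have "0 \<le> (a 1 u + a (-1) u) * ((q u - m u) * (q u - cl (m u)))"
          using a0[OF s(1), of u] a0[OF s(2), of u] by (intro mult_nonneg_nonneg[of "a 1 u + a (-1) u"]) auto
        then show ?thesis by (simp add: algebra_simps)
      qed
      show "\<exists>y. (e has_real_derivative y) (at u) \<and> y \<le> 0"
        unfolding e_def using d[unfolded eq] n by (intro exI conjI)
    qed
    then have "(q t - m t)\<^sup>2 \<le> 0" unfolding e_def q0 diff_self zero_power2 .
    then show ?thesis unfolding power2_less_eq_zero_iff by (rule right_minus_eq[THEN iffD1])
  qed
  \<comment> \<open>Since m = q has values in [-1, 1], the clip acts as the identity and the rates
    are those of the solution's own magnetization.\<close>
  have rate: "a \<sigma> t = c \<sigma> (density_magnetization (r t))" if "t \<in> {0..T}" for \<sigma> t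
    using qb[OF that] by (simp add: a_def q[OF that] qm[OF that, symmetric] cl_def)
  have inner: "L2_inner (r t) (G t) = (\<Sum>\<sigma>\<in>spins. integral {0..1} (\<lambda>x. r t x \<sigma> * G t x \<sigma>))"
    if "smooth_on_time_V T G" "t \<in> {0..T}" for G t
    unfolding L2_inner_def
    by (intro sum.cong refl LBINT_eq_integral continuous_intros slice[OF rc that(2)] slice[OF Gc[OF that(1)] that(2)])
  have innerW: "L2_inner (r u) (weak_integrand T c G (density_magnetization (r u)) u) = (\<Sum>\<sigma>\<in>spins. integral {0..1} (W G \<sigma> u))"
    if G: "smooth_on_time_V T G" and u: "u \<in> {0..T}" for G u
    unfolding L2_inner_def
  proof (rule sum.cong[OF refl])
    fix \<sigma> assume \<sigma>: "\<sigma> \<in> spins"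
    have eq: "(\<lambda>x. r u x \<sigma> * weak_integrand T c G (density_magnetization (r u)) u x \<sigma>) = W G \<sigma> u"
      by (auto simp: weak_integrand_def W_def rate[OF u])
    show "(LBINT x:{0..1}. r u x \<sigma> * weak_integrand T c G (density_magnetization (r u)) u x \<sigma>) = integral {0..1} (W G \<sigma> u)"
      unfolding eq by (rule LBINT_eq_integral[OF slice[OF Wc[OF G \<sigma>] u]])
  qed
  have "weak_solution T c \<rho> r"
    unfolding weak_solution_def
  proof (intro conjI ballI allI impI)
    fix t \<sigma> assume t: "t \<in> {0..T}" and \<sigma>: "\<sigma> \<in> spins"
    show "0 \<le> r t x \<sigma>" for x by (rule rnn[OF \<sigma> t])
    show "set_integrable lborel {0..1} (\<lambda>x. r t x \<sigma>)"
      by (rule borel_integrable_atLeastAtMost'[OF slice[OF rc[OF \<sigma>] t]])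
  next
    fix \<sigma> assume "\<sigma> \<in> spins"
    then show "AE x in lborel. x \<in> {0..1} \<longrightarrow> r 0 x \<sigma> = \<rho> x \<sigma>" by (simp add: r0)
  next
    fix G assume G: "smooth_on_time_V T G"
    have cW: "continuous_on {0..T} (\<lambda>s. \<Sum>\<sigma>\<in>spins. integral {0..1} (W G \<sigma> s))"
      by (intro continuous_intros ci Wc[OF G])
    have cL: "continuous_on {0..T} (\<lambda>s. L2_inner (r s) (weak_integrand T c G (density_magnetization (r s)) s))"
      by (rule continuous_on_eq[OF cW]) (rule innerW[OF G, symmetric])
    show "set_integrable lborel {0..T} (\<lambda>s. L2_inner (r s) (weak_integrand T c G (density_magnetization (r s)) s))"
      by (rule borel_integrable_atLeastAtMost'[OF cL])
    fix t assume t: "t \<in> {0..T}"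
    have "(LBINT s:{0..t}. L2_inner (r s) (weak_integrand T c G (density_magnetization (r s)) s)) =
        integral {0..t} (\<lambda>s. L2_inner (r s) (weak_integrand T c G (density_magnetization (r s)) s))"
      by (rule LBINT_eq_integral[OF continuous_on_subset[OF cL]]) (use t in auto)
    also have "\<dots> = integral {0..t} (\<lambda>s. \<Sum>\<sigma>\<in>spins. integral {0..1} (W G \<sigma> s))"
      by (rule integral_cong, rule innerW[OF G]) (use t in auto)
    finally show "L2_inner (r t) (G t) - L2_inner (r 0) (G 0) -
        (LBINT s:{0..t}. L2_inner (r s) (weak_integrand T c G (density_magnetization (r s)) s)) = 0"
      unfolding inner[OF G t] inner[OF G z] weak[OF G t] by linarith
  qed
  then show ?thesis by blast
qed

section \<open>Convergence of the magnetization\<close>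

lemma space_borel_algebra: "space (borel_algebra X) = topspace X"
  by (simp add: borel_algebra_def space_measure_of_conv)

lemma openin_sets_borel_algebra: "openin X U \<Longrightarrow> U \<in> sets (borel_algebra X)"
  unfolding borel_algebra_def by (subst sets_measure_of) (auto dest: openin_subset)

lemma continuous_map_borel_measurable:
  assumes "continuous_map X euclideanreal F"
  shows "F \<in> borel_measurable (borel_algebra X)"
proof (rule borel_measurableI)
  fix S :: "real set" assume "open S"
  then have "openin X {x \<in> topspace X. F x \<in> S}"
    using openin_continuous_map_preimage[OF assms] by simp
  moreover have "{x \<in> topspace X. F x \<in> S} = F -` S \<inter> space (borel_algebra X)"
    by (auto simp: space_borel_algebra)
  ultimately show "F -` S \<inter> space (borel_algebra X) \<in> sets (borel_algebra X)"
    by (simp add: openin_sets_borel_algebra)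
qed

lemma continuous_path_cadlag:
  assumes "continuous_on {0..T} m" "\<And>t. t \<in> {0..T} \<Longrightarrow> m t \<in> E"
  shows "restrict m {0..T} \<in> cadlag_paths T E"
  unfolding cadlag_paths_def
proof (intro CollectI conjI ballI)
  show "restrict m {0..T} \<in> {0..T} \<rightarrow>\<^sub>E E" using assms(2) by auto
  have c: "continuous_on {0..T} (restrict m {0..T})"
    by (rule continuous_on_eq[OF assms(1)]) simp
  fix t assume t: "t \<in> {0..<T}"
  have "(restrict m {0..T} \<longlongrightarrow> restrict m {0..T} t) (at t within {0..T})"
    using bspec[OF c[unfolded continuous_on_def], of t] t by simp
  then have "(restrict m {0..T} \<longlongrightarrow> restrict m {0..T} t) (at t within {t..T})"
    by (rule tendsto_within_subset) (use t in auto)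
  then show "(restrict m {0..T} \<longlongrightarrow> restrict m {0..T} t) (at_right t)"
    using t by (simp add: at_within_Icc_at_right)
next
  have c: "continuous_on {0..T} (restrict m {0..T})"
    by (rule continuous_on_eq[OF assms(1)]) simp
  fix t assume t: "t \<in> {0<..T}"
  have "(restrict m {0..T} \<longlongrightarrow> restrict m {0..T} t) (at t within {0..T})"
    using bspec[OF c[unfolded continuous_on_def], of t] t by simp
  then have "(restrict m {0..T} \<longlongrightarrow> restrict m {0..T} t) (at t within {0..t})"
    by (rule tendsto_within_subset) (use t in auto)
  then have "(restrict m {0..T} \<longlongrightarrow> restrict m {0..T} t) (at_left t)"
    using t by (simp add: at_within_Icc_at_left)
  moreover have "restrict m {0..T} t \<in> E" using assms(2) t by auto
  ultimately show "\<exists>l\<in>E. (restrict m {0..T} \<longlongrightarrow> l) (at_left t)" by blast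
qed

lemma magnetization_law_eq:
  assumes "1 \<le> N"
  shows "magnetization_law T N P = distr P (borel_algebra (skorokhod_topology T {-1..1}))
    (\<lambda>\<omega>. \<lambda>t\<in>{0..T}. magnetization N (\<omega> t))"
  unfolding magnetization_law_def measure_magnetization_empirical_measure[OF assms] ..

text \<open>The limit is a single continuous path, so uniform closeness outside an event of small
  probability suffices, with the identity as time change. A bounded continuous functional changes by
  at most e / 2 off that event and by at most 2 B on it.\<close>

lemma magnetization_law_converges_weakly:
  fixes m :: "real \<Rightarrow> real"
  assumes T: "0 < T" and P: "\<forall>N\<ge>1. path_law T c N (initial_law N \<rho>) (P N)"
    and b: "\<And>\<sigma> m. \<sigma> \<in> spins \<Longrightarrow> m \<in> {-1..1} \<Longrightarrow> 0 \<le> c \<sigma> m \<and> c \<sigma> m \<le> b" "0 < b"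
    and L: "\<And>\<sigma> m m'. \<sigma> \<in> spins \<Longrightarrow> m \<in> {-1..1} \<Longrightarrow> m' \<in> {-1..1} \<Longrightarrow> \<bar>c \<sigma> m - c \<sigma> m'\<bar> \<le> L * \<bar>m - m'\<bar>"
    and sm: "smooth_on_V \<rho>" and \<rho>: "\<forall>x. \<forall>\<sigma>\<in>spins. \<rho> x \<sigma> \<ge> 0" and Z: "L2_inner \<rho> (\<lambda>x \<sigma>. 1) > 0"
    and m: "\<And>t. t \<in> {0..T} \<Longrightarrow> m t \<in> {-1..1}" "m 0 = density_magnetization \<rho>"
    and ode: "\<And>t. t \<in> {0..T} \<Longrightarrow> (m has_real_derivative drift c (m t)) (at t within {0..T})"
  shows "converges_weakly (skorokhod_topology T {-1..1}) (\<lambda>N. magnetization_law T N (P N))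
    (return (borel_algebra (skorokhod_topology T {-1..1})) (\<lambda>t\<in>{0..T}. m t))"
proof -
  let ?X = "skorokhod_topology T {-1..1::real}" and ?D = "cadlag_paths T {-1..1::real}"
  let ?\<Phi> = "\<lambda>N \<omega>. \<lambda>t\<in>{0..T}. magnetization N (\<omega> t)"
  interpret S: Metric_space ?D "skorokhod_dist T {-1..1::real}" by (rule Metric_space_skorokhod)
  have top: "topspace ?X = ?D" by (rule topspace_skorokhod)
  have cm: "continuous_on {0..T} m"
    using ode by (meson DERIV_continuous continuous_on_eq_continuous_within)
  have mD: "restrict m {0..T} \<in> ?D" by (rule continuous_path_cadlag[OF cm m(1)])
  have L0: "0 \<le> L" using L[of 1 0 1] by (simp add: spins_def)
  \<comment> \<open>\<open>C\<close> is twice the Lipschitz constant of the drift, and \<kappa> is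
    then fixed by C \<kappa> = 8 b: the equality cases of the conditions in
    \<open>lyapunov_supermartingale\<close>.\<close>
  define C where "C = 2 * (4 * L + 2 * b)"
  define \<kappa> where "\<kappa> = 8 * b / C"
  have C: "0 < C" using L0 b(2) by (simp add: C_def)
  have \<kappa>: "0 \<le> \<kappa>" "C * \<kappa> = 8 * b" using C b(2) by (simp_all add: \<kappa>_def)
  have C1: "2 * (4 * L + 2 * b) \<le> C" "8 * b \<le> C * \<kappa>" using \<kappa>(2) by (simp_all add: C_def)
  define \<E> where "\<E> N = measure_pmf.expectation (initial_law N \<rho>) (lyapunov C \<kappa> N m 0)" for N
  have z: "0 \<in> {0..T}" using T by simp
  have \<E>: "\<E> \<longlonglongrightarrow> 0"
    unfolding \<E>_def using initial_lyapunov_tendsto[where m=m, OF sm \<rho> Z m(1)[OF z] m(2) \<kappa>(1)] .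
  \<comment> \<open>A deviation beyond \<open>d\<close> at time \<open>t\<close> pushes the
    discounted function above d^2 exp (- C t), which is at least d^2 exp (- C T); this is the level
    for the maximal inequality.\<close>
  have dev: "\<exists>U\<in>sets (P N). d\<^sup>2 * exp (- C * T) * measure (P N) U \<le> \<E> N \<and>
      (\<forall>\<omega>\<in>space (P N) - U. \<forall>t\<in>{0..T}. \<bar>magnetization N (\<omega> t) - m t\<bar> \<le> d)"
    if N: "1 \<le> N" and d: "0 < d" for N d
  proof -
    have PN: "path_law T c N (initial_law N \<rho>) (P N)" using P N by blast
    obtain U where U: "U \<in> sets (P N)"
      "d\<^sup>2 * exp (- C * T) * measure (P N) U \<le> measure_pmf.expectation (initial_law N \<rho>) (lyapunov C \<kappa> N m 0)"
      "\<And>\<omega> t. \<omega> \<in> space (P N) - U \<Longrightarrow> t \<in> {0..T} \<Longrightarrow> lyapunov C \<kappa> N m t (\<omega> t) \<le> d\<^sup>2 * exp (- C * T)"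
    proof (rule path_maximal_inequality[where X="lyapunov C \<kappa> N m" and B="4 + \<kappa>" and r="d\<^sup>2 * exp (- C * T)", OF PN T])
      fix t \<eta> assume "t \<in> {0..T}"
      then show "0 \<le> lyapunov C \<kappa> N m t \<eta> \<and> lyapunov C \<kappa> N m t \<eta> \<le> 4 + \<kappa>"
        using lyapunov_bounds[of m t \<kappa> C N \<eta>] m(1)[of t] \<kappa>(1) C by auto
    next
      fix K s t \<eta>
      assume "transition_semigroup N K" "has_generator N K (generator c N)" "0 \<le> s" "s \<le> t" "t \<le> T" "\<eta> \<in> configs N"
      then show "measure_pmf.expectation (K (t - s) \<eta>) (lyapunov C \<kappa> N m t) \<le> lyapunov C \<kappa> N m s \<eta>"
        by (intro lyapunov_supermartingale[where c=c and b=b and L=L and T=T] b(1) L m(1) ode \<kappa>(1) C1)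
    next
      show "continuous_on {0..T} (\<lambda>t. lyapunov C \<kappa> N m t \<eta>)" for \<eta>
        unfolding lyapunov_def by (intro continuous_intros cm)
    next
      fix U
      assume "U \<in> sets (P N)"
        "d\<^sup>2 * exp (- C * T) * measure (P N) U \<le> measure_pmf.expectation (initial_law N \<rho>) (lyapunov C \<kappa> N m 0)"
        "\<And>\<omega> t. \<omega> \<in> space (P N) - U \<Longrightarrow> t \<in> {0..T} \<Longrightarrow> lyapunov C \<kappa> N m t (\<omega> t) \<le> d\<^sup>2 * exp (- C * T)"
      then show thesis by (rule that)
    qed
    have "\<bar>magnetization N (\<omega> t) - m t\<bar> \<le> d" if \<omega>: "\<omega> \<in> space (P N) - U" and t: "t \<in> {0..T}" for \<omega> t
    proof -
      let ?q = "(magnetization N (\<omega> t) - m t)\<^sup>2"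
      have "exp (- C * T) * ?q \<le> exp (- C * t) * ?q"
        using t C by (intro mult_right_mono) auto
      also have "\<dots> \<le> lyapunov C \<kappa> N m t (\<omega> t)"
        unfolding lyapunov_def using \<kappa>(1) by (intro mult_left_mono) auto
      also have "\<dots> \<le> exp (- C * T) * d\<^sup>2" using U(3)[OF \<omega> t] by (simp add: mult.commute)
      finally have "?q \<le> d\<^sup>2" by simp
      then show ?thesis using d by (simp add: power2_le_iff_abs_le)
    qed
    then show ?thesis using U(1,2) unfolding \<E>_def by blast
  qed
  show ?thesis
    unfolding converges_weakly_def
  proof (intro conjI allI impI)
    show "\<forall>\<^sub>F N in sequentially. borel_prob ?X (magnetization_law T N (P N))"
      using eventually_ge_at_top[of 1]
    proof eventually_elim
      case (elim N)
      then have PN: "path_law T c N (initial_law N \<rho>) (P N)" using P by blast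
      interpret prob_space "P N" by (rule path_law_space(1)[OF PN])
      show ?case
        unfolding borel_prob_def magnetization_law_eq[OF elim]
        using prob_space_distr[OF measurable_magnetization_path[OF PN T]]
        by (simp add: space_borel_algebra)
    qed
    show "borel_prob ?X (return (borel_algebra ?X) (restrict m {0..T}))"
      unfolding borel_prob_def
      using prob_space_return[of "restrict m {0..T}" "borel_algebra ?X"] mD
      by (simp add: space_borel_algebra top)
  next
    fix F assume F: "continuous_map ?X euclideanreal F \<and> bounded (F ` topspace ?X)"
    then obtain B where B: "\<And>f. f \<in> ?D \<Longrightarrow> \<bar>F f\<bar> \<le> B"
      unfolding top by (auto simp: bounded_iff)
    have B0: "0 \<le> B" using B[OF mD] by linarith
    have Fm: "F \<in> borel_measurable (borel_algebra ?X)"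
      using F by (intro continuous_map_borel_measurable) blast
    have ret: "(\<integral>\<omega>. F \<omega> \<partial>return (borel_algebra ?X) (restrict m {0..T})) = F (restrict m {0..T})"
      by (rule integral_return[OF _ Fm]) (simp add: space_borel_algebra top mD)
    show "(\<lambda>N. \<integral>\<omega>. F \<omega> \<partial>magnetization_law T N (P N)) \<longlonglongrightarrow> (\<integral>\<omega>. F \<omega> \<partial>return (borel_algebra ?X) (restrict m {0..T}))"
      unfolding ret
    proof (rule LIMSEQ_I)
      fix e :: real assume e: "0 < e"
      have "openin S.mtopology {f \<in> ?D. F f \<in> ball (F (restrict m {0..T})) (e / 2)}"
        using openin_continuous_map_preimage[of ?X euclideanreal F "ball (F (restrict m {0..T})) (e / 2)"] F
        by (simp add: top) (simp add: skorokhod_topology_def)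
      then obtain d where d: "0 < d" "S.mball (restrict m {0..T}) d \<subseteq> {f \<in> ?D. F f \<in> ball (F (restrict m {0..T})) (e / 2)}"
        using mD e unfolding S.openin_mtopology by force
      \<comment> \<open>Half of \<open>d\<close>, because the deviation bound is not strict while
        the ball is open.\<close>
      define r where "r = (d / 2)\<^sup>2 * exp (- C * T)"
      have r: "0 < r" using d by (simp add: r_def)
      have "(\<lambda>N. 2 * B * (\<E> N / r)) \<longlonglongrightarrow> 2 * B * (0 / r)"
        using r by (intro tendsto_intros \<E>) auto
      then have "\<forall>\<^sub>F N in sequentially. 2 * B * (\<E> N / r) < e / 2"
        using e by (intro order_tendstoD(2)) auto
      then obtain N0 where N0: "\<And>N. N \<ge> N0 \<Longrightarrow> 2 * B * (\<E> N / r) < e / 2"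
        by (auto simp: eventually_sequentially)
      show "\<exists>N0. \<forall>N\<ge>N0. norm ((\<integral>\<omega>. F \<omega> \<partial>magnetization_law T N (P N)) - F (restrict m {0..T})) < e"
      proof (intro exI[of _ "max 1 N0"] allI impI)
        fix N assume "max 1 N0 \<le> N"
        then have N: "1 \<le> N" "N0 \<le> N" by auto
        then have PN: "path_law T c N (initial_law N \<rho>) (P N)" using P by blast
        interpret prob_space "P N" by (rule path_law_space(1)[OF PN])
        note \<Phi> = measurable_magnetization_path[OF PN T]
        have \<Phi>D: "?\<Phi> N \<omega> \<in> ?D" if "\<omega> \<in> space (P N)" for \<omega>
          using measurable_space[OF \<Phi> that] by (simp add: space_borel_algebra top)
        obtain U where U: "U \<in> sets (P N)" "r * prob U \<le> \<E> N"
          "\<And>\<omega> t. \<omega> \<in> space (P N) - U \<Longrightarrow> t \<in> {0..T} \<Longrightarrow> \<bar>magnetization N (\<omega> t) - m t\<bar> \<le> d / 2"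
          using dev[OF N(1), of "d / 2"] d(1) unfolding r_def by auto
        have near: "\<bar>F (?\<Phi> N \<omega>) - F (restrict m {0..T})\<bar> \<le> e / 2" if \<omega>: "\<omega> \<in> space (P N) - U" for \<omega>
        proof -
          have "skorokhod_dist T {-1..1} (restrict m {0..T}) (?\<Phi> N \<omega>) \<le> d / 2"
          proof (rule skorokhod_dist_le[where \<theta>="\<lambda>t. t"])
            show "restrict m {0..T} \<in> ?D" by (rule mD)
            show "?\<Phi> N \<omega> \<in> ?D" using \<Phi>D \<omega> by blast
            show "(\<lambda>t. t) \<in> time_changes T" by (auto simp: time_changes_def strict_mono_on_def)
            show "0 < d / 2" using d by simp
            fix t assume "t \<in> {0..T}"
            then show "\<bar>t - t\<bar> \<le> d / 2 \<and> dist (restrict m {0..T} t) (?\<Phi> N \<omega> t) \<le> d / 2"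
              using U(3)[OF \<omega>, of t] d by (simp add: dist_real_def abs_minus_commute)
          qed
          then have "?\<Phi> N \<omega> \<in> S.mball (restrict m {0..T}) d"
            using \<Phi>D \<omega> mD d(1) by (simp add: S.in_mball)
          then show ?thesis using d(2) by (auto simp: dist_real_def abs_minus_commute)
        qed
        have Fb: "\<bar>F (?\<Phi> N \<omega>) - F (restrict m {0..T})\<bar> \<le> 2 * B" if "\<omega> \<in> space (P N)" for \<omega>
          using B[OF \<Phi>D[OF that]] B[OF mD] by linarith
        have meas: "(\<lambda>\<omega>. F (?\<Phi> N \<omega>)) \<in> borel_measurable (P N)"
          by (rule measurable_compose[OF \<Phi> Fm])
        have int: "integrable (P N) (\<lambda>\<omega>. F (?\<Phi> N \<omega>))"
          by (rule integrable_const_bound[where B=B]) (use B \<Phi>D meas in \<open>auto intro!: AE_I2\<close>)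
        have "(\<integral>\<omega>. F \<omega> \<partial>magnetization_law T N (P N)) = expectation (\<lambda>\<omega>. F (?\<Phi> N \<omega>))"
          unfolding magnetization_law_eq[OF N(1)] by (rule integral_distr[OF \<Phi> Fm])
        then have "norm ((\<integral>\<omega>. F \<omega> \<partial>magnetization_law T N (P N)) - F (restrict m {0..T})) =
            \<bar>expectation (\<lambda>\<omega>. F (?\<Phi> N \<omega>) - F (restrict m {0..T}))\<bar>"
          using int by (simp add: prob_space)
        also have "\<dots> \<le> expectation (\<lambda>\<omega>. \<bar>F (?\<Phi> N \<omega>) - F (restrict m {0..T})\<bar>)"
          using integral_norm_bound[of "P N" "\<lambda>\<omega>. F (?\<Phi> N \<omega>) - F (restrict m {0..T})"] by simp
        also have "\<dots> \<le> expectation (\<lambda>\<omega>. e / 2 + 2 * B * indicator U \<omega>)"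
        proof (rule integral_mono)
          show "integrable (P N) (\<lambda>\<omega>. \<bar>F (?\<Phi> N \<omega>) - F (restrict m {0..T})\<bar>)" using int by simp
          show "integrable (P N) (\<lambda>\<omega>. e / 2 + 2 * B * indicator U \<omega>)"
            using U(1) by (simp add: emeasure_eq_measure)
          fix \<omega> assume "\<omega> \<in> space (P N)"
          then show "\<bar>F (?\<Phi> N \<omega>) - F (restrict m {0..T})\<bar> \<le> e / 2 + 2 * B * indicator U \<omega>"
            using near[of \<omega>] Fb[of \<omega>] e B0 by (cases "\<omega> \<in> U") auto
        qed
        also have "\<dots> = e / 2 + 2 * B * prob U"
          using U(1) by (simp add: emeasure_eq_measure prob_space)
        also have "\<dots> \<le> e / 2 + 2 * B * (\<E> N / r)"
          using U(2) r B0 by (intro add_left_mono mult_left_mono) (auto simp: pos_le_divide_eq mult.commute)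
        also have "\<dots> < e" using N0[OF N(2)] by simp
        finally show "norm ((\<integral>\<omega>. F \<omega> \<partial>magnetization_law T N (P N)) - F (restrict m {0..T})) < e" .
      qed
    qed
  qed
qed

text \<open>Convergence is shown along every weak solution: its magnetization solves the
  differential equation with values in [-1, 1], and the Lyapunov estimate compares the particle
  system with any such function. Existence makes the statement non-vacuous.\<close>

theorem corollary2p2:
  fixes T :: real
    and c :: "int \<Rightarrow> real \<Rightarrow> real"
    and \<rho> :: "real \<Rightarrow> int \<Rightarrow> real"
    and P :: "nat \<Rightarrow> (real \<Rightarrow> config) measure"
  assumes "T > 0"
    and "jump_rates c"
    and "smooth_on_V \<rho>"
    and "\<forall>x. \<forall>\<sigma>\<in>spins. \<rho> x \<sigma> \<ge> 0"
    and "L2_inner \<rho> (\<lambda>x \<sigma>. 1) > 0"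
    and "\<forall>N\<ge>1. path_law T c N (initial_law N \<rho>) (P N)"
  shows "(\<exists>r. weak_solution T c \<rho> r) \<and>
    (\<forall>r. weak_solution T c \<rho> r \<longrightarrow>
       converges_weakly (skorokhod_topology T {-1..1})
         (\<lambda>N. magnetization_law T N (P N))
         (return (borel_algebra (skorokhod_topology T {-1..1}))
            (\<lambda>t\<in>{0..T}. density_magnetization (r t))) \<and>
       (\<forall>t\<in>{0..T}. ((\<lambda>s. density_magnetization (r s)) has_real_derivative
          c (-1) (density_magnetization (r t)) * (1 - density_magnetization (r t)) -
          c 1 (density_magnetization (r t)) * (1 + density_magnetization (r t)))
          (at t within {0..T})) \<and>
       density_magnetization (r 0) = density_magnetization \<rho>)"
proof -
  obtain a b where ab: "0 < a" "\<And>\<sigma> m. \<sigma> \<in> spins \<Longrightarrow> m \<in> {-1..1} \<Longrightarrow> a \<le> c \<sigma> m \<and> c \<sigma> m \<le> b"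
    using assms(2) unfolding jump_rates_def by blast
  obtain L where L: "\<And>\<sigma> m m'. \<sigma> \<in> spins \<Longrightarrow> m \<in> {-1..1} \<Longrightarrow> m' \<in> {-1..1} \<Longrightarrow> \<bar>c \<sigma> m - c \<sigma> m'\<bar> \<le> L * \<bar>m - m'\<bar>"
    using assms(2) unfolding jump_rates_def by blast
  have b: "0 \<le> c \<sigma> m \<and> c \<sigma> m \<le> b" if "\<sigma> \<in> spins" "m \<in> {-1..1}" for \<sigma> m
    using ab(2)[OF that] ab(1) by linarith
  have b0: "0 < b" using ab(1) ab(2)[of 1 0] by (force simp: spins_def)
  show ?thesis
  proof (intro conjI allI impI)
    show "\<exists>r. weak_solution T c \<rho> r"
      by (rule weak_solution_exists[OF assms(1,3,4,5) b L])
    fix r assume r: "weak_solution T c \<rho> r"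
    note w = r assms(1,3,5) b L
    show m0: "density_magnetization (r 0) = density_magnetization \<rho>"
      by (rule weak_solution_magnetization_0[OF w])
    have bounds: "density_magnetization (r t) \<in> {-1..1}" if "t \<in> {0..T}" for t
      by (rule weak_solution_magnetization_bounds[OF w that])
    have ode: "((\<lambda>s. density_magnetization (r s)) has_real_derivative drift c (density_magnetization (r t)))
        (at t within {0..T})" if "t \<in> {0..T}" for t
      by (rule weak_solution_magnetization_ode[OF w that])
    then show "\<forall>t\<in>{0..T}. ((\<lambda>s. density_magnetization (r s)) has_real_derivative
          c (-1) (density_magnetization (r t)) * (1 - density_magnetization (r t)) -
          c 1 (density_magnetization (r t)) * (1 + density_magnetization (r t)))
          (at t within {0..T})"
      by (simp add: drift_def)
    show "converges_weakly (skorokhod_topology T {-1..1}) (\<lambda>N. magnetization_law T N (P N))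
         (return (borel_algebra (skorokhod_topology T {-1..1}))
            (\<lambda>t\<in>{0..T}. density_magnetization (r t)))"
      by (rule magnetization_law_converges_weakly[OF assms(1,6) b b0 L assms(3,4,5) bounds m0 ode])
  qed
qed

end
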